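(* Let $m>0$ and let $\mathcal H_a=e^{-2aB}$ with real-valued $a\in H^1(\mathbb R)\cap L^\infty(\mathbb R)$. Then $$\begin{aligned}\mathfrak E_m(\mathcal H_a;\mathbb R)=2\inf_\delta\int_{\mathbb R}\Big[&(\delta'+m\sinh(2a))^2\\&+\big(m\cosh(2a)\cos(2\delta)-a'\sin(2\delta)-m\big)^2\\&+\big(m\cosh(2a)\sin(2\delta)+a'\cos(2\delta)\big)^2\Big]dt,\end{aligned}$$ where the infimum is over real-valued phases $\delta\in H^1_{\rm loc}(\mathbb R)$ for which the displayed integral is finite. For fixed $\delta$, let $\mathcal E_a[\delta]$ denote twice the displayed integral. Every critical phase satisfies, in the weak sense, $$\delta''+2ma'\cosh(2a)-2m^2\cosh(2a)\sin(2\delta)-2ma'\cos(2\delta)=0.$$ The positive lift $\mathcal H_a^{-1/2}=e^{aB}$ corresponds to $\delta=0$. It is stationary if and only if $$a'(\cosh(2a)-1)=0\quad\text{a.e.}$$ If this condition fails, a compactly supported phase perturbation strictly lowers the positive-lift energy, i.e. there is a compactly supported $\delta$ with $\mathcal E_a[\delta]<\mathcal E_a[0]$.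
   Context: Here $n=1$, $J=\begin{pmatrix}1&0\\0&-1\end{pmatrix}$, $B=\begin{pmatrix}0&1\\1&0\end{pmatrix}$. A $2\times2$ matrix $\Theta$ is $J$-unitary if $\Theta^*J\Theta=J$. $\mathcal G(\mathcal H;\mathbb R)$ is the set of locally absolutely continuous $J$-unitary $\Theta:\mathbb R\to\mathbb C^{2\times2}$ with $\mathcal H=\Theta^{-*}\Theta^{-1}$ and, for such $\Theta$, $P_{m,\Theta}=-i\Theta^*J\Theta'+m(\Theta^*B\Theta-B)$. The optimal-gauge energy is $$\mathfrak E_m(\mathcal H;\mathbb R)=\inf\Big\{\int_{\mathbb R}\operatorname{Tr}|P_{m,\Theta}|^2dt:\Theta\in\mathcal G(\mathcal H;\mathbb R),\ P_{m,\Theta}\in L^2(\mathbb R)\Big\}.$$ Every gauge of $\mathcal H_a$ has the form $e^{aB}e^{i\alpha}e^{i\delta J}$ with real phases $\alpha,\delta$; $\delta$ is the phase in the statement. A phase $\delta$ is critical (stationary) if the first variation of $\mathcal E_a$ at $\delta$ vanishes in all compactly supported directions. *)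

theory Defs
  imports "HOL-Analysis.Analysis"
begin

section \<open>Function spaces on the real line\<close>

definition compactly_supported :: "(real \<Rightarrow> real) \<Rightarrow> bool" where
  "compactly_supported f \<longleftrightarrow> compact (closure {t. f t \<noteq> 0})"

definition test_function :: "(real \<Rightarrow> real) \<Rightarrow> bool" where
  "test_function \<phi> \<longleftrightarrow>
     (\<forall>k t. ((deriv ^^ k) \<phi>) differentiable (at t)) \<and> compactly_supported \<phi>"

definition loc_integrable :: "(real \<Rightarrow> 'a::euclidean_space) \<Rightarrow> bool" where
  "loc_integrable f \<longleftrightarrow> (\<forall>c d. set_integrable lebesgue {c..d} f)"

definition has_weak_deriv ::
    "(real \<Rightarrow> 'a::euclidean_space) \<Rightarrow> (real \<Rightarrow> 'a) \<Rightarrow> bool" where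
  "has_weak_deriv f g \<longleftrightarrow> loc_integrable f \<and> loc_integrable g \<and>
     (\<forall>\<phi>. test_function \<phi> \<longrightarrow>
        (LINT t|lebesgue. deriv \<phi> t *\<^sub>R f t) = - (LINT t|lebesgue. \<phi> t *\<^sub>R g t))"

text \<open>Weak derivatives are unique up to null sets, and everything below depends on
  the chosen representative only up to null sets.\<close>

definition wderiv :: "(real \<Rightarrow> 'a::euclidean_space) \<Rightarrow> real \<Rightarrow> 'a" where
  "wderiv f = (SOME g. has_weak_deriv f g)"

definition L2_loc :: "(real \<Rightarrow> real) set" where
  "L2_loc = {f. f \<in> borel_measurable lebesgue \<and>
     (\<forall>c d. set_integrable lebesgue {c..d} (\<lambda>t. (f t)\<^sup>2))}"

definition L2 :: "(real \<Rightarrow> real) set" where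
  "L2 = {f. f \<in> borel_measurable lebesgue \<and> integrable lebesgue (\<lambda>t. (f t)\<^sup>2)}"

definition Linf :: "(real \<Rightarrow> real) set" where
  "Linf = {f. f \<in> borel_measurable lebesgue \<and> (\<exists>C. AE t in lebesgue. \<bar>f t\<bar> \<le> C)}"

definition H1_loc :: "(real \<Rightarrow> real) set" where
  "H1_loc = {f \<in> L2_loc. \<exists>g \<in> L2_loc. has_weak_deriv f g}"

definition H1 :: "(real \<Rightarrow> real) set" where
  "H1 = {f \<in> L2. \<exists>g \<in> L2. has_weak_deriv f g}"

text \<open>The usual epsilon-delta definition on every compact interval; a pair \<open>(x, y)\<close>
  encodes the interval from \<open>x\<close> to \<open>y\<close>.\<close>

definition loc_abs_cont :: "(real \<Rightarrow> 'a::real_normed_vector) \<Rightarrow> bool" where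
  "loc_abs_cont f \<longleftrightarrow>
     (\<forall>c d. \<forall>\<epsilon>>0. \<exists>r>0. \<forall>S :: (real \<times> real) set.
        finite S \<and> (\<forall>(x, y)\<in>S. c \<le> x \<and> x \<le> y \<and> y \<le> d) \<and>
        pairwise (\<lambda>(x, y) (u, v). {x<..<y} \<inter> {u<..<v} = {}) S \<and>
        (\<Sum>(x, y)\<in>S. y - x) < r
        \<longrightarrow> (\<Sum>(x, y)\<in>S. norm (f y - f x)) < \<epsilon>)"


section \<open>Two by two matrices\<close>

type_synonym cmat2 = "complex ^ 2 ^ 2"

definition Jmat :: cmat2 where
  "Jmat = vector [vector [1, 0], vector [0, - 1]]"

definition Bmat :: cmat2 where
  "Bmat = vector [vector [0, 1], vector [1, 0]]"

definition cadj :: "cmat2 \<Rightarrow> cmat2" where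
  "cadj A = (\<chi> i j. cnj (A $ j $ i))"

definition J_unitary :: "cmat2 \<Rightarrow> bool" where
  "J_unitary A \<longleftrightarrow> cadj A ** Jmat ** A = Jmat"

text \<open>The exponential series with respect to the matrix product; the library's \<open>*\<close> and
  \<open>^\<close> on vectors are componentwise.\<close>

definition mexp :: "cmat2 \<Rightarrow> cmat2" where
  "mexp A = (\<Sum>k. (1 / fact k) *\<^sub>R (((**) A ^^ k) (mat 1)))"

definition positive_definite :: "cmat2 \<Rightarrow> bool" where
  "positive_definite A \<longleftrightarrow> cadj A = A \<and>
     (\<forall>x. x \<noteq> 0 \<longrightarrow> 0 < Re (\<Sum>i\<in>UNIV. cnj (x $ i) * (A *v x) $ i))"

definition inv_sqrt :: "cmat2 \<Rightarrow> cmat2" where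
  "inv_sqrt H = (THE R. positive_definite R \<and> R ** R = matrix_inv H)"

definition hs_norm_sq :: "cmat2 \<Rightarrow> real" where  \<comment> \<open>\<open>Tr |P|\<^sup>2\<close> with \<open>|P|\<^sup>2 = P\<^sup>* P\<close>\<close>
  "hs_norm_sq P = Re (trace (cadj P ** P))"


section \<open>Gauges and the optimal-gauge energy\<close>

definition gauges :: "(real \<Rightarrow> cmat2) \<Rightarrow> (real \<Rightarrow> cmat2) set" where
  "gauges H = {\<Theta>. loc_abs_cont \<Theta> \<and> (\<forall>t. J_unitary (\<Theta> t)) \<and>
     (AE t in lebesgue. H t = cadj (matrix_inv (\<Theta> t)) ** matrix_inv (\<Theta> t))}"

text \<open>For a locally absolutely continuous function the weak derivative is the
  almost-everywhere derivative. The factor \<open>mat (- \<i>)\<close> is the scalar \<open>- \<i>\<close>.\<close>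

definition gauge_potential :: "real \<Rightarrow> (real \<Rightarrow> cmat2) \<Rightarrow> real \<Rightarrow> cmat2" where
  "gauge_potential m \<Theta> t =
     mat (- \<i>) ** cadj (\<Theta> t) ** Jmat ** wderiv \<Theta> t
     + m *\<^sub>R (cadj (\<Theta> t) ** Bmat ** \<Theta> t - Bmat)"

definition gauge_energy :: "real \<Rightarrow> (real \<Rightarrow> cmat2) \<Rightarrow> ennreal" where
  "gauge_energy m \<Theta> = (\<integral>\<^sup>+ t. ennreal (hs_norm_sq (gauge_potential m \<Theta> t)) \<partial>lebesgue)"

definition potential_in_L2 :: "real \<Rightarrow> (real \<Rightarrow> cmat2) \<Rightarrow> bool" where
  "potential_in_L2 m \<Theta> \<longleftrightarrow>
     gauge_potential m \<Theta> \<in> borel_measurable lebesgue \<and> gauge_energy m \<Theta> < \<infinity>"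

definition optimal_energy :: "real \<Rightarrow> (real \<Rightarrow> cmat2) \<Rightarrow> ennreal" where
  "optimal_energy m H = (INF \<Theta>\<in>{\<Theta> \<in> gauges H. potential_in_L2 m \<Theta>}. gauge_energy m \<Theta>)"


section \<open>The family \<open>e\<^bsup>-2aB\<^esup>\<close> and its phases\<close>

definition Ham :: "(real \<Rightarrow> real) \<Rightarrow> real \<Rightarrow> cmat2" where
  "Ham a t = mexp ((- 2 * a t) *\<^sub>R Bmat)"

text \<open>\<open>e\<^bsup>aB\<^esup> e\<^bsup>i\<alpha>\<^esup> e\<^bsup>i\<delta>J\<^esup>\<close>\<close>

definition phase_gauge ::
    "(real \<Rightarrow> real) \<Rightarrow> (real \<Rightarrow> real) \<Rightarrow> (real \<Rightarrow> real) \<Rightarrow> real \<Rightarrow> cmat2" where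
  "phase_gauge a \<alpha> \<delta> t =
     mexp (a t *\<^sub>R Bmat) ** mat (exp (\<i> * of_real (\<alpha> t)))
     ** mexp (mat (\<i> * of_real (\<delta> t)) ** Jmat)"

definition phase_integral ::
    "real \<Rightarrow> (real \<Rightarrow> real) \<Rightarrow> (real \<Rightarrow> real) \<Rightarrow> ennreal" where
  "phase_integral m a \<delta> = (\<integral>\<^sup>+ t. ennreal (
       (wderiv \<delta> t + m * sinh (2 * a t))\<^sup>2
     + (m * cosh (2 * a t) * cos (2 * \<delta> t) - wderiv a t * sin (2 * \<delta> t) - m)\<^sup>2
     + (m * cosh (2 * a t) * sin (2 * \<delta> t) + wderiv a t * cos (2 * \<delta> t))\<^sup>2) \<partial>lebesgue)"

definition phase_energy ::
    "real \<Rightarrow> (real \<Rightarrow> real) \<Rightarrow> (real \<Rightarrow> real) \<Rightarrow> ennreal" where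
  "phase_energy m a \<delta> = 2 * phase_integral m a \<delta>"

definition admissible_phases :: "real \<Rightarrow> (real \<Rightarrow> real) \<Rightarrow> (real \<Rightarrow> real) set" where
  "admissible_phases m a = {\<delta> \<in> H1_loc. phase_integral m a \<delta> < \<infinity>}"

text \<open>Compactly supported perturbations of an admissible phase are admissible when \<open>a\<close> is in
  \<open>H1\<close>, so \<open>enn2real\<close> is applied to finite energies only.\<close>

definition critical_phase :: "real \<Rightarrow> (real \<Rightarrow> real) \<Rightarrow> (real \<Rightarrow> real) \<Rightarrow> bool" where
  "critical_phase m a \<delta> \<longleftrightarrow> \<delta> \<in> admissible_phases m a \<and>
     (\<forall>\<eta>\<in>H1_loc. compactly_supported \<eta> \<longrightarrow>
        ((\<lambda>s. enn2real (phase_energy m a (\<lambda>t. \<delta> t + s * \<eta> t))) has_real_derivative 0) (at 0))"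

end

theory Submission
  imports Defs
begin

text \<open>
  All the analysis is carried out with indefinite Lebesgue integrals. An absolutely continuous \<open>F\<close> is
  an indefinite integral, because its positive variation \<open>P\<close> and \<open>P - F\<close> are monotone and absolutely
  continuous and hence have Radon-Nikodym densities. Lebesgue differentiation then makes the product
  and chain rules available almost everywhere, and by the du Bois-Reymond lemma a function has a weak
  derivative iff it agrees almost everywhere with an indefinite integral.

  A \<open>J\<close>-unitary \<open>\<Theta>\<close> with \<open>\<Theta> \<Theta>* = e^(2aB)\<close> is \<open>e^(aB)\<close> times a unitary diagonal matrix. Lifting its
  diagonal entries to phases \<open>\<alpha> + \<delta>\<close> and \<open>\<alpha> - \<delta>\<close> gives \<open>Tr |P|^2\<close> as twice the integrand of the phase
  integral plus \<open>2 \<alpha>'^2\<close>, so \<open>\<alpha> = 0\<close> is optimal.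

  Up to terms independent of \<open>\<delta>\<close> the integrand is
  \<open>(\<delta>' + m sinh 2a)^2 - 2m (m cosh 2a cos 2\<delta> - a' sin 2\<delta>)\<close>, whose first variation has a quadratic
  remainder. At \<open>\<delta> = 0\<close> integration by parts turns the first variation of the energy in direction
  \<open>\<eta>\<close> into \<open>-8m\<close> times the integral of \<open>a' (cosh 2a - 1) \<eta>\<close>.
\<close>

subsection \<open>Families of nonoverlapping intervals\<close>

text \<open>The obstacle throughout is that \<open>wderiv\<close> is an arbitrary weak derivative
  and a Sobolev function is fixed only almost everywhere, whereas a gauge is locally absolutely
  continuous and J-unitary at every point. So \<open>a\<close>, \<delta> and the test directions are
  traded for the continuous representatives given by their indefinite integrals, and an a.e.
  identity between continuous functions is promoted to every point before phases are lifted.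

  A gauge reduces to a diagonal factor because e^(-aB) \<Theta> is J-unitary and unitary at once.
  Its phase lies in \<open>H1_loc\<close> when the energy is finite, because the first square of the
  integrand differs from \<delta>'^2 only through a continuous shift of \<delta>'.

  In the remainder of the first variation a' occurs only to the first power, multiplied by a bounded
  function of compact support, so local integrability of a' controls it. The resulting bound C s^2
  holds for all real s; it yields both the derivative of the energy and the strict descent.\<close>

definition nonoverlapping :: "'i set \<Rightarrow> ('i \<Rightarrow> real) \<Rightarrow> ('i \<Rightarrow> real) \<Rightarrow> bool" where
  "nonoverlapping I l r \<longleftrightarrow> finite I \<and> (\<forall>i\<in>I. l i \<le> r i) \<and>
     disjoint_family_on (\<lambda>i. {l i<..<r i}) I"

text \<open>Truncation may collapse an interval to a point outside the original one. Its open
  interval is then empty, so disjointness survives. Families are indexed so that such collapses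
  leave the index set alone.\<close>

lemma nonoverlapping_mono:
  assumes "nonoverlapping I l r"
    and "\<And>i. i \<in> I \<Longrightarrow> l i \<le> l' i \<and> l' i \<le> r' i \<and> r' i \<le> r i \<or> l' i = r' i"
  shows "nonoverlapping I l' r'"
proof -
  have "{l' i<..<r' i} \<inter> {l' j<..<r' j} = {}" if "i \<in> I" "j \<in> I" "i \<noteq> j" for i j
  proof -
    have "{l' i<..<r' i} \<subseteq> {l i<..<r i}" "{l' j<..<r' j} \<subseteq> {l j<..<r j}"
      using assms(2) that by fastforce+
    moreover have "{l i<..<r i} \<inter> {l j<..<r j} = {}"
      using assms(1) that by (auto simp: nonoverlapping_def disjoint_family_on_def)
    ultimately show ?thesis by blast
  qed
  then show ?thesis
    using assms by (force simp: nonoverlapping_def disjoint_family_on_def)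
qed

text \<open>Passage from indexed families to the sets of pairs used by \<open>loc_abs_cont\<close>.
  Several indices may carry the same degenerate pair, so degenerate intervals are dropped; this is
  why \<open>h\<close> must vanish on the diagonal.\<close>

lemma nonoverlapping_as_set:
  assumes "nonoverlapping I l r"
  obtains S where "finite S" "\<And>x y. (x, y) \<in> S \<Longrightarrow> \<exists>i\<in>I. x = l i \<and> y = r i \<and> x < y"
    "pairwise (\<lambda>(x, y) (u, v). {x<..<y} \<inter> {u<..<v} = {}) S"
    "\<And>h :: real \<Rightarrow> real \<Rightarrow> real. (\<And>x. h x x = 0) \<Longrightarrow> (\<Sum>(x, y)\<in>S. h x y) = (\<Sum>i\<in>I. h (l i) (r i))"
    "nonoverlapping S fst snd"
proof -
  define K where "K = {i\<in>I. l i < r i}"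
  define f where "f i = (l i, r i)" for i
  have disj: "{l i<..<r i} \<inter> {l j<..<r j} = {}" if "i \<in> I" "j \<in> I" "i \<noteq> j" for i j
    using assms that by (auto simp: nonoverlapping_def disjoint_family_on_def)
  have inj: "inj_on f K"
  proof (rule inj_onI)
    fix i j assume "i \<in> K" "j \<in> K" "f i = f j"
    \<comment> \<open>The midpoint of a nondegenerate interval shared by two indices would lie in
      both members of a disjoint family.\<close>
    then have "(l i + r i) / 2 \<in> {l i<..<r i} \<inter> {l j<..<r j}" "i \<in> I" "j \<in> I"
      by (auto simp: K_def f_def)
    then show "i = j" using disj by blast
  qed
  show thesis
  proof
    show "finite (f ` K)" using assms by (auto simp: nonoverlapping_def K_def)
    show "\<exists>i\<in>I. x = l i \<and> y = r i \<and> x < y" if "(x, y) \<in> f ` K" for x y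
      using that by (auto simp: f_def K_def)
    show "pairwise (\<lambda>(x, y) (u, v). {x<..<y} \<inter> {u<..<v} = {}) (f ` K)"
      unfolding pairwise_image pairwise_def using disj by (auto simp: f_def K_def)
    show "nonoverlapping (f ` K) fst snd"
      unfolding nonoverlapping_def disjoint_family_on_def
    proof (intro conjI ballI impI)
      show "finite (f ` K)" using assms by (auto simp: nonoverlapping_def K_def)
      show "fst p \<le> snd p" if "p \<in> f ` K" for p using that by (auto simp: f_def K_def)
      show "{fst p<..<snd p} \<inter> {fst q<..<snd q} = {}" if pq: "p \<in> f ` K" "q \<in> f ` K" "p \<noteq> q" for p q
      proof -
        obtain i j where "p = f i" "i \<in> I" "q = f j" "j \<in> I" using pq(1,2) by (auto simp: K_def)
        then show ?thesis using disj[of i j] pq(3) by (auto simp: f_def simp del: Int_greaterThanLessThan)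
      qed
    qed
    fix h :: "real \<Rightarrow> real \<Rightarrow> real" assume h: "\<And>x. h x x = 0"
    have "(\<Sum>(x, y)\<in>f ` K. h x y) = (\<Sum>i\<in>K. h (l i) (r i))"
      by (subst sum.reindex[OF inj]) (simp add: f_def)
    also have "\<dots> = (\<Sum>i\<in>I. h (l i) (r i))"
      using assms h by (intro sum.mono_neutral_left) (force simp: K_def nonoverlapping_def)+
    finally show "(\<Sum>(x, y)\<in>f ` K. h x y) = (\<Sum>i\<in>I. h (l i) (r i))" .
  qed
qed

lemma nonoverlapping_sum_indicator_le:
  assumes "nonoverlapping I l r"
  shows "(\<Sum>i\<in>I. indicator {l i<..<r i} t :: real) \<le> 1"
proof (cases "\<exists>i\<in>I. t \<in> {l i<..<r i}")
  case True
  then obtain i where i: "i \<in> I" "t \<in> {l i<..<r i}" by blast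
  have "indicator {l j<..<r j} t = (0 :: real)" if "j \<in> I - {i}" for j
  proof -
    have "{l j<..<r j} \<inter> {l i<..<r i} = {}"
      using assms that i(1) by (simp add: nonoverlapping_def disjoint_family_on_def)
    then have "t \<notin> {l j<..<r j}" using i(2) by blast
    then show ?thesis by simp
  qed
  then have "(\<Sum>j\<in>I - {i}. indicator {l j<..<r j} t :: real) = 0" by (intro sum.neutral) auto
  then show ?thesis
    using assms i sum.remove[of I i "\<lambda>j. indicator {l j<..<r j} t :: real"]
    by (simp add: nonoverlapping_def)
next
  case False
  then have "(\<Sum>i\<in>I. indicator {l i<..<r i} t :: real) = 0" by (intro sum.neutral) (auto simp: indicator_def)
  then show ?thesis by simp
qed

text \<open>Endpoints do not change the integrals, and the indicators of the open intervals sum to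
  at most 1 at every point.\<close>

lemma nonoverlapping_sum_integral_le:
  fixes g :: "real \<Rightarrow> real"
  assumes I: "nonoverlapping I l r" and g: "integrable lebesgue g" and nn: "\<And>t. 0 \<le> g t"
  shows "(\<Sum>i\<in>I. integral {l i..r i} g) \<le> (LINT t|lebesgue. g t)"
proof -
  have fin: "finite I" using I by (simp add: nonoverlapping_def)
  have int: "integrable lebesgue (\<lambda>t. indicator {l i<..<r i} t * g t)" for i
    using integrable_mult_indicator[OF _ g, of "{l i<..<r i}"] by simp
  have eq: "integral {l i..r i} g = (LINT t|lebesgue. indicator {l i<..<r i} t * g t)" if "i \<in> I" for i
  proof -
    have "integral {l i..r i} g = integral {l i<..<r i} g"
      using integral_open_interval_real[of "l i" "r i" g] by simp
    also have "\<dots> = (LINT t:{l i<..<r i}|lebesgue. g t)"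
      using int by (subst set_lebesgue_integral_eq_integral) (auto simp: set_integrable_def)
    finally show ?thesis by (simp add: set_lebesgue_integral_def)
  qed
  have "(\<Sum>i\<in>I. integral {l i..r i} g) = (LINT t|lebesgue. (\<Sum>i\<in>I. indicator {l i<..<r i} t * g t))"
    using int eq by (simp add: Bochner_Integration.integral_sum)
  also have "\<dots> \<le> (LINT t|lebesgue. g t)"
  proof (rule integral_mono)
    show "integrable lebesgue (\<lambda>t. \<Sum>i\<in>I. indicator {l i<..<r i} t * g t)" using int by auto
    show "(\<Sum>i\<in>I. indicator {l i<..<r i} t * g t) \<le> g t" for t
      using mult_right_mono[OF nonoverlapping_sum_indicator_le[OF I, of t] nn[of t]]
      by (simp add: sum_distrib_right)
  qed (rule g)
  finally show ?thesis .
qed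

text \<open>The preceding bound with the indicator of \<open>{c..d}\<close> as integrand.\<close>

lemma nonoverlapping_sum_length_le:
  assumes I: "nonoverlapping I l r" and sub: "\<And>i. i \<in> I \<Longrightarrow> c \<le> l i \<and> r i \<le> d" and "c \<le> d"
  shows "(\<Sum>i\<in>I. r i - l i) \<le> d - c"
proof -
  have "(\<Sum>i\<in>I. r i - l i) = (\<Sum>i\<in>I. integral {l i..r i} (indicator {c..d} :: real \<Rightarrow> real))"
  proof (rule sum.cong[OF refl])
    fix i assume i: "i \<in> I"
    then have "integral {l i..r i} (indicator {c..d} :: real \<Rightarrow> real) = integral {l i..r i} (\<lambda>_. 1)"
      using sub[OF i] by (intro integral_cong) auto
    then show "r i - l i = integral {l i..r i} (indicator {c..d} :: real \<Rightarrow> real)"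
      using I i by (simp add: nonoverlapping_def)
  qed
  also have "\<dots> \<le> (LINT t|lebesgue. indicator {c..d} t)"
    by (rule nonoverlapping_sum_integral_le[OF I]) (use \<open>c \<le> d\<close> in \<open>auto simp: integrable_indicator_iff\<close>)
  also have "\<dots> = d - c" using \<open>c \<le> d\<close> by simp
  finally show ?thesis .
qed

section \<open>Absolute continuity on the whole line\<close>

definition abs_cont :: "(real \<Rightarrow> real) \<Rightarrow> bool" where
  "abs_cont F \<longleftrightarrow> (\<forall>\<epsilon>>0. \<exists>\<rho>>0. \<forall>(S :: (real \<times> real) set).
     nonoverlapping S fst snd \<and> (\<Sum>p\<in>S. snd p - fst p) < \<rho> \<longrightarrow>
     (\<Sum>p\<in>S. \<bar>F (snd p) - F (fst p)\<bar>) < \<epsilon>)"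

text \<open>The index type is left free because later families are indexed by a single point, by
  dyadic integers and by dependent pairs of intervals.\<close>

lemma abs_contD:
  assumes "abs_cont F" "0 < \<epsilon>"
  shows "\<exists>\<rho>>0. \<forall>(I :: 'i set) l r. nonoverlapping I l r \<and> (\<Sum>i\<in>I. r i - l i) < \<rho> \<longrightarrow>
     (\<Sum>i\<in>I. \<bar>F (r i) - F (l i)\<bar>) < \<epsilon>"
proof -
  obtain \<rho> where \<rho>: "\<rho> > 0" "\<And>S :: (real \<times> real) set. nonoverlapping S fst snd \<Longrightarrow>
     (\<Sum>p\<in>S. snd p - fst p) < \<rho> \<Longrightarrow> (\<Sum>p\<in>S. \<bar>F (snd p) - F (fst p)\<bar>) < \<epsilon>"
    using assms unfolding abs_cont_def by metis
  show ?thesis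
  proof (intro exI[of _ \<rho>] conjI allI impI \<rho>(1))
    fix I :: "'i set" and l r
    assume I: "nonoverlapping I l r \<and> (\<Sum>i\<in>I. r i - l i) < \<rho>"
    obtain S where S: "finite S" "\<And>x y. (x, y) \<in> S \<Longrightarrow> \<exists>i\<in>I. x = l i \<and> y = r i \<and> x < y"
      "pairwise (\<lambda>(x, y) (u, v). {x<..<y} \<inter> {u<..<v} = {}) S"
      "\<And>h :: real \<Rightarrow> real \<Rightarrow> real. (\<And>x. h x x = 0) \<Longrightarrow> (\<Sum>(x, y)\<in>S. h x y) = (\<Sum>i\<in>I. h (l i) (r i))"
      "nonoverlapping S fst snd"
      using nonoverlapping_as_set[OF conjunct1[OF I]] by blast
    have "(\<Sum>p\<in>S. snd p - fst p) = (\<Sum>i\<in>I. r i - l i)"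
      using S(4)[of "\<lambda>x y. y - x"] by (simp add: case_prod_beta)
    moreover have "(\<Sum>p\<in>S. \<bar>F (snd p) - F (fst p)\<bar>) = (\<Sum>i\<in>I. \<bar>F (r i) - F (l i)\<bar>)"
      using S(4)[of "\<lambda>x y. \<bar>F y - F x\<bar>"] by (simp add: case_prod_beta)
    ultimately show "(\<Sum>i\<in>I. \<bar>F (r i) - F (l i)\<bar>) < \<epsilon>" using \<rho>(2)[OF S(5)] I by simp
  qed
qed

lemma abs_cont_continuous:
  assumes "abs_cont F"
  shows "continuous_on UNIV F"
  unfolding continuous_on_iff
proof safe
  fix x e :: real assume "0 < e"
  then obtain \<rho> where \<rho>: "\<rho> > 0" "\<forall>(I :: unit set) l r. nonoverlapping I l r \<and> (\<Sum>i\<in>I. r i - l i) < \<rho> \<longrightarrow>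
     (\<Sum>i\<in>I. \<bar>F (r i) - F (l i)\<bar>) < e"
    using abs_contD[OF assms] by blast
  have "dist (F y) (F x) < e" if "dist y x < \<rho>" for y
    using \<rho>(2)[rule_format, of "{()}" "\<lambda>_. min x y" "\<lambda>_. max x y"] that
    by (cases "x \<le> y") (auto simp: nonoverlapping_def disjoint_family_on_def dist_real_def min_def max_def abs_minus_commute)
  then show "\<exists>d>0. \<forall>x'\<in>UNIV. dist x' x < d \<longrightarrow> dist (F x') (F x) < e" using \<rho>(1) by blast
qed

subsection \<open>Positive variation\<close>

lemma nonoverlapping_le: "nonoverlapping I l r \<Longrightarrow> i \<in> I \<Longrightarrow> l i \<le> r i"
  by (simp add: nonoverlapping_def)

lemma nonoverlapping_min:
  assumes "nonoverlapping I l r"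
  shows "nonoverlapping I (\<lambda>i. min (l i) y) (\<lambda>i. min (r i) y)"
proof (rule nonoverlapping_mono[OF assms])
  fix i assume "i \<in> I"
  from nonoverlapping_le[OF assms this]
  show "l i \<le> min (l i) y \<and> min (l i) y \<le> min (r i) y \<and> min (r i) y \<le> r i \<or> min (l i) y = min (r i) y"
    by (auto simp: min_def)
qed

lemma nonoverlapping_max:
  assumes "nonoverlapping I l r"
  shows "nonoverlapping I (\<lambda>i. max (l i) y) (\<lambda>i. max (r i) y)"
proof (rule nonoverlapping_mono[OF assms])
  fix i assume "i \<in> I"
  from nonoverlapping_le[OF assms this]
  show "l i \<le> max (l i) y \<and> max (l i) y \<le> max (r i) y \<and> max (r i) y \<le> r i \<or> max (l i) y = max (r i) y"
    by (auto simp: max_def)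
qed

text \<open>Bisection: bounds for the variation add up over adjacent intervals, and on an interval
  shorter than \<rho> the variation is at most 1.\<close>

lemma abs_cont_bounded_variation:
  assumes F: "abs_cont F" and cd: "c \<le> d"
    and left: "\<And>x. x \<le> c \<Longrightarrow> F x = F c" and right: "\<And>x. d \<le> x \<Longrightarrow> F x = F d"
  shows "\<exists>C. \<forall>(I :: (real \<times> real) set) l r. nonoverlapping I l r \<longrightarrow> (\<Sum>i\<in>I. \<bar>F (r i) - F (l i)\<bar>) \<le> C"
proof -
  define bv where "bv x y \<longleftrightarrow> (\<exists>C. \<forall>(I :: (real \<times> real) set) l r. nonoverlapping I l r \<and>
     (\<forall>i\<in>I. x \<le> l i \<and> r i \<le> y) \<longrightarrow> (\<Sum>i\<in>I. \<bar>F (r i) - F (l i)\<bar>) \<le> C)" for x y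
  obtain \<rho> where \<rho>: "\<rho> > 0" "\<forall>(I :: (real \<times> real) set) l r. nonoverlapping I l r \<and>
     (\<Sum>i\<in>I. r i - l i) < \<rho> \<longrightarrow> (\<Sum>i\<in>I. \<bar>F (r i) - F (l i)\<bar>) < 1"
    using abs_contD[OF F zero_less_one] by blast
  have "bv c d"
    using cd
  proof (induction rule: Bolzano)
    case (trans x y z)
    from trans(1) obtain C where C: "\<And>(I :: (real \<times> real) set) l r. nonoverlapping I l r \<Longrightarrow>
     (\<forall>i\<in>I. x \<le> l i \<and> r i \<le> y) \<Longrightarrow> (\<Sum>i\<in>I. \<bar>F (r i) - F (l i)\<bar>) \<le> C" unfolding bv_def by blast
    from trans(2) obtain D where D: "\<And>(I :: (real \<times> real) set) l r. nonoverlapping I l r \<Longrightarrow>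
     (\<forall>i\<in>I. y \<le> l i \<and> r i \<le> z) \<Longrightarrow> (\<Sum>i\<in>I. \<bar>F (r i) - F (l i)\<bar>) \<le> D" unfolding bv_def by blast
    have "(\<Sum>i\<in>I. \<bar>F (r i) - F (l i)\<bar>) \<le> C + D"
      if I: "nonoverlapping I l r" and sub: "\<forall>i\<in>I. x \<le> l i \<and> r i \<le> z" for I :: "(real \<times> real) set" and l r
    proof -
      have lr: "l i \<le> r i" if "i \<in> I" for i using I that by (simp add: nonoverlapping_def)
      \<comment> \<open>Each interval is cut at \<open>y\<close>. If it lies on one side, the piece
        on the other side collapses to a point and contributes 0.\<close>
      have "\<bar>F (r i) - F (l i)\<bar> \<le> \<bar>F (min (r i) y) - F (min (l i) y)\<bar> + \<bar>F (max (r i) y) - F (max (l i) y)\<bar>"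
        if "i \<in> I" for i
        using lr[OF that] by (auto simp: min_def max_def)
      then have "(\<Sum>i\<in>I. \<bar>F (r i) - F (l i)\<bar>) \<le>
          (\<Sum>i\<in>I. \<bar>F (min (r i) y) - F (min (l i) y)\<bar>) + (\<Sum>i\<in>I. \<bar>F (max (r i) y) - F (max (l i) y)\<bar>)"
        unfolding sum.distrib[symmetric] by (intro sum_mono) auto
      also have "(\<Sum>i\<in>I. \<bar>F (min (r i) y) - F (min (l i) y)\<bar>) \<le> C"
        by (rule C[OF nonoverlapping_min[OF I]]) (use lr sub trans in \<open>auto simp: min_def\<close>)
      also have "(\<Sum>i\<in>I. \<bar>F (max (r i) y) - F (max (l i) y)\<bar>) \<le> D"
        by (rule D[OF nonoverlapping_max[OF I]]) (use lr sub trans in \<open>auto simp: max_def\<close>)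
      finally show ?thesis by simp
    qed
    then show ?case unfolding bv_def by blast
  next
    case (local x)
    have "bv u v" if "u \<le> x" "x \<le> v" "v - u < \<rho>" for u v
      unfolding bv_def
    proof (intro exI allI impI)
      fix I :: "(real \<times> real) set" and l r
      assume I: "nonoverlapping I l r \<and> (\<forall>i\<in>I. u \<le> l i \<and> r i \<le> v)"
      then have "(\<Sum>i\<in>I. r i - l i) \<le> v - u"
        using that by (intro nonoverlapping_sum_length_le) auto
      then show "(\<Sum>i\<in>I. \<bar>F (r i) - F (l i)\<bar>) \<le> 1"
        using \<rho>(2)[rule_format, of I l r] I that by simp
    qed
    then show ?case using \<rho>(1) by blast
  qed
  then obtain C where C: "\<And>(I :: (real \<times> real) set) l r. nonoverlapping I l r \<Longrightarrow>
     (\<forall>i\<in>I. c \<le> l i \<and> r i \<le> d) \<Longrightarrow> (\<Sum>i\<in>I. \<bar>F (r i) - F (l i)\<bar>) \<le> C" unfolding bv_def by blast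
  \<comment> \<open>Since \<open>F\<close> is constant on either side of \<open>{c..d}\<close>, an
    arbitrary family may be clamped into \<open>{c..d}\<close> without changing any
    increment.\<close>
  have clamp: "F (max c (min d x)) = F x" for x
    using left[of x] right[of x] cd by (cases "x \<le> c"; cases "d \<le> x") (auto simp: min_def max_def)
  have "(\<Sum>i\<in>I. \<bar>F (r i) - F (l i)\<bar>) \<le> C" if I: "nonoverlapping I l r" for I :: "(real \<times> real) set" and l r
  proof -
    have "nonoverlapping I (\<lambda>i. max c (min d (l i))) (\<lambda>i. max c (min d (r i)))"
      using nonoverlapping_max[OF nonoverlapping_min[OF I]] by (simp add: min.commute max.commute)
    from C[OF this] show ?thesis using cd by (simp add: clamp)
  qed
  then show ?thesis by blast
qed

text \<open>Signed increments give the positive variation, because intervals on which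
  \<open>F\<close> decreases may simply be left out of the family.\<close>

definition pos_variation :: "(real \<Rightarrow> real) \<Rightarrow> real \<Rightarrow> real" where
  "pos_variation F x = Sup {\<Sum>p\<in>S. F (snd p) - F (fst p) | S :: (real \<times> real) set.
     nonoverlapping S fst snd \<and> (\<forall>p\<in>S. snd p \<le> x)}"

context
  fixes F :: "real \<Rightarrow> real" and c d :: real
  assumes F: "abs_cont F" and cd: "c \<le> d"
    and left: "\<And>x. x \<le> c \<Longrightarrow> F x = F c" and right: "\<And>x. d \<le> x \<Longrightarrow> F x = F d"
begin

lemma pos_variation_bdd: "bdd_above {\<Sum>p\<in>S. F (snd p) - F (fst p) | S :: (real \<times> real) set.
     nonoverlapping S fst snd \<and> (\<forall>p\<in>S. snd p \<le> x)}"
proof -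
  obtain C where C: "\<And>(I :: (real \<times> real) set) l r. nonoverlapping I l r \<Longrightarrow> (\<Sum>i\<in>I. \<bar>F (r i) - F (l i)\<bar>) \<le> C"
    using abs_cont_bounded_variation[OF F cd left right] by blast
  have "(\<Sum>p\<in>S. F (snd p) - F (fst p)) \<le> C" if "nonoverlapping S fst snd" for S
    using C[OF that] sum_mono[of S "\<lambda>p. F (snd p) - F (fst p)" "\<lambda>p. \<bar>F (snd p) - F (fst p)\<bar>"] by force
  then show ?thesis by (intro bdd_aboveI[of _ C]) blast
qed

lemma pos_variation_upper:
  assumes I: "nonoverlapping I l r" and le: "\<And>i. i \<in> I \<Longrightarrow> r i \<le> x"
  shows "(\<Sum>i\<in>I. F (r i) - F (l i)) \<le> pos_variation F x"
proof -
  obtain S where S: "finite S" "\<And>x y. (x, y) \<in> S \<Longrightarrow> \<exists>i\<in>I. x = l i \<and> y = r i \<and> x < y"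
      "pairwise (\<lambda>(x, y) (u, v). {x<..<y} \<inter> {u<..<v} = {}) S"
      "\<And>h :: real \<Rightarrow> real \<Rightarrow> real. (\<And>x. h x x = 0) \<Longrightarrow> (\<Sum>(x, y)\<in>S. h x y) = (\<Sum>i\<in>I. h (l i) (r i))"
      "nonoverlapping S fst snd"
    using nonoverlapping_as_set[OF I] by blast
  have "snd p \<le> x" if "p \<in> S" for p
    using S(2)[of "fst p" "snd p"] that le by auto
  with S(5) have "(\<Sum>p\<in>S. F (snd p) - F (fst p)) \<le> pos_variation F x"
    unfolding pos_variation_def by (intro cSup_upper pos_variation_bdd) blast
  then show ?thesis using S(4)[of "\<lambda>x y. F y - F x"] by (simp add: case_prod_beta)
qed

lemma pos_variation_least:
  assumes "\<And>S. nonoverlapping S fst snd \<Longrightarrow> (\<And>p. p \<in> S \<Longrightarrow> snd p \<le> x) \<Longrightarrow> (\<Sum>p\<in>S. F (snd p) - F (fst p)) \<le> z"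
  shows "pos_variation F x \<le> z"
  unfolding pos_variation_def
proof (rule cSup_least)
  show "{\<Sum>p\<in>S. F (snd p) - F (fst p) | S :: (real \<times> real) set.
     nonoverlapping S fst snd \<and> (\<forall>p\<in>S. snd p \<le> x)} \<noteq> {}"
    by (auto intro!: exI[of _ "{}"] simp: nonoverlapping_def disjoint_family_on_def)
qed (use assms in blast)

text \<open>Any family to the left of \<open>x\<close> can be enlarged by the interval from
  \<open>x\<close> to \<open>y\<close>. Rearranged, the inequality says that
  \<open>pos_variation F\<close> minus \<open>F\<close> is increasing.\<close>

lemma pos_variation_add:
  assumes "x \<le> y"
  shows "pos_variation F x + (F y - F x) \<le> pos_variation F y"
proof (cases "x = y")
  case False
  have "pos_variation F x \<le> pos_variation F y - (F y - F x)"
  proof (rule pos_variation_least)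
    fix S :: "(real \<times> real) set" assume S: "nonoverlapping S fst snd" and le: "\<And>p. p \<in> S \<Longrightarrow> snd p \<le> x"
    have notin: "(x, y) \<notin> S" using le[of "(x, y)"] assms False by auto
    have "nonoverlapping (insert (x, y) S) fst snd"
      unfolding nonoverlapping_def disjoint_family_on_def
    proof (intro conjI ballI impI)
      show "{fst p<..<snd p} \<inter> {fst q<..<snd q} = {}"
        if "p \<in> insert (x, y) S" "q \<in> insert (x, y) S" "p \<noteq> q" for p q
      proof -
        have "{fst p<..<snd p} \<inter> {x<..<y} = {}" if "p \<in> S" for p
          using le[OF that] by force
        moreover have "{fst p<..<snd p} \<inter> {fst q<..<snd q} = {}" if "p \<in> S" "q \<in> S" "p \<noteq> q"
          using S that unfolding nonoverlapping_def disjoint_family_on_def by blast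
        ultimately show ?thesis using that by (metis Int_commute fst_conv insertE snd_conv)
      qed
    qed (use S assms in \<open>auto simp: nonoverlapping_def\<close>)
    then have "(\<Sum>p\<in>insert (x, y) S. F (snd p) - F (fst p)) \<le> pos_variation F y"
      by (rule pos_variation_upper) (use le assms in force)
    then show "(\<Sum>p\<in>S. F (snd p) - F (fst p)) \<le> pos_variation F y - (F y - F x)"
      using notin S by (simp add: nonoverlapping_def)
  qed
  then show ?thesis by simp
qed simp

lemma pos_variation_mono:
  assumes "x \<le> y"
  shows "pos_variation F x \<le> pos_variation F y"
proof (rule pos_variation_least)
  fix S :: "(real \<times> real) set" assume S: "nonoverlapping S fst snd" and le: "\<And>p. p \<in> S \<Longrightarrow> snd p \<le> x"
  show "(\<Sum>p\<in>S. F (snd p) - F (fst p)) \<le> pos_variation F y"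
    by (rule pos_variation_upper[OF S]) (use le assms in force)
qed

text \<open>Cut an almost optimal family for \<open>y\<close> at the point \<open>x\<close>: the
  left pieces contribute at most \<open>pos_variation F x\<close>, and the right pieces form the
  required family.\<close>

lemma pos_variation_increment:
  assumes xy: "x \<le> y" and e: "0 < e"
  obtains S :: "(real \<times> real) set" and l r where "nonoverlapping S l r" "\<forall>i\<in>S. x \<le> l i \<and> r i \<le> y"
    "pos_variation F y - pos_variation F x \<le> (\<Sum>i\<in>S. \<bar>F (r i) - F (l i)\<bar>) + e"
proof -
  obtain S where S: "nonoverlapping S fst snd" "\<And>p. p \<in> S \<Longrightarrow> snd p \<le> y"
    and less: "pos_variation F y - e < (\<Sum>p\<in>S. F (snd p) - F (fst p))"
    using pos_variation_least[of y "pos_variation F y - e"] e by force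
  have lr: "fst p \<le> snd p" if "p \<in> S" for p using S(1) that by (simp add: nonoverlapping_def)
  define l where "l p = max (fst p) x" for p :: "real \<times> real"
  define r where "r p = max (snd p) x" for p :: "real \<times> real"
  have no: "nonoverlapping S l r"
    using nonoverlapping_max[OF S(1)] by (simp add: l_def[abs_def] r_def[abs_def])
  have "(\<Sum>p\<in>S. F (snd p) - F (fst p)) = (\<Sum>p\<in>S. F (min (snd p) x) - F (min (fst p) x)) + (\<Sum>p\<in>S. F (r p) - F (l p))"
    unfolding sum.distrib[symmetric]
  proof (rule sum.cong[OF refl])
    fix p assume "p \<in> S"
    from lr[OF this] show "F (snd p) - F (fst p) = F (min (snd p) x) - F (min (fst p) x) + (F (r p) - F (l p))"
      by (auto simp: l_def r_def max_def min_def)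
  qed
  also have "(\<Sum>p\<in>S. F (min (snd p) x) - F (min (fst p) x)) \<le> pos_variation F x"
    by (rule pos_variation_upper[OF nonoverlapping_min[OF S(1)]]) simp
  also have "(\<Sum>p\<in>S. F (r p) - F (l p)) \<le> (\<Sum>p\<in>S. \<bar>F (r p) - F (l p)\<bar>)"
    by (intro sum_mono) auto
  finally show thesis
    using less S(2) xy by (intro that[OF no]) (auto simp: l_def r_def)
qed

text \<open>Inside every interval of a short family choose an almost optimal subfamily. The union of
  the subfamilies, indexed by a dependent sum, is again short, so the absolute continuity of
  \<open>F\<close> applies to it in one go.\<close>

lemma abs_cont_pos_variation: "abs_cont (pos_variation F)"
  unfolding abs_cont_def
proof (intro allI impI)
  fix \<epsilon> :: real assume \<epsilon>: "\<epsilon> > 0"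
  obtain \<rho> where \<rho>: "\<rho> > 0" "\<forall>(I :: ((real \<times> real) \<times> real \<times> real) set) l r. nonoverlapping I l r \<and>
     (\<Sum>i\<in>I. r i - l i) < \<rho> \<longrightarrow> (\<Sum>i\<in>I. \<bar>F (r i) - F (l i)\<bar>) < \<epsilon> / 2"
    using abs_contD[OF F half_gt_zero[OF \<epsilon>]] by blast
  have "(\<Sum>p\<in>T. \<bar>pos_variation F (snd p) - pos_variation F (fst p)\<bar>) < \<epsilon>"
    if T: "nonoverlapping T fst snd" and len: "(\<Sum>p\<in>T. snd p - fst p) < \<rho>" for T :: "(real \<times> real) set"
  proof -
    \<comment> \<open>One error \<open>e\<close> is spent on each member of \<open>T\<close>, in
      total at most \<epsilon>/2; the added 1 covers the empty family.\<close>
    define e where "e = \<epsilon> / (2 * (real (card T) + 1))"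
    have e: "e > 0" using \<epsilon> by (simp add: e_def add_nonneg_pos)
    have finT: "finite T" and leT: "\<And>p. p \<in> T \<Longrightarrow> fst p \<le> snd p"
      and disjT: "\<And>p q. p \<in> T \<Longrightarrow> q \<in> T \<Longrightarrow> p \<noteq> q \<Longrightarrow> {fst p<..<snd p} \<inter> {fst q<..<snd q} = {}"
      using T unfolding nonoverlapping_def disjoint_family_on_def by blast+
    have "\<forall>p\<in>T. \<exists>q. nonoverlapping (fst q :: (real \<times> real) set) (fst (snd q)) (snd (snd q)) \<and>
        (\<forall>i\<in>fst q. fst p \<le> fst (snd q) i \<and> snd (snd q) i \<le> snd p) \<and>
        pos_variation F (snd p) - pos_variation F (fst p) \<le> (\<Sum>i\<in>fst q. \<bar>F (snd (snd q) i) - F (fst (snd q) i)\<bar>) + e"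
    proof
      fix p assume "p \<in> T"
      from pos_variation_increment[OF leT[OF this] e]
      obtain S :: "(real \<times> real) set" and l r where "nonoverlapping S l r" "\<forall>i\<in>S. fst p \<le> l i \<and> r i \<le> snd p"
        "pos_variation F (snd p) - pos_variation F (fst p) \<le> (\<Sum>i\<in>S. \<bar>F (r i) - F (l i)\<bar>) + e" .
      then show "\<exists>q. nonoverlapping (fst q :: (real \<times> real) set) (fst (snd q)) (snd (snd q)) \<and>
        (\<forall>i\<in>fst q. fst p \<le> fst (snd q) i \<and> snd (snd q) i \<le> snd p) \<and>
        pos_variation F (snd p) - pos_variation F (fst p) \<le> (\<Sum>i\<in>fst q. \<bar>F (snd (snd q) i) - F (fst (snd q) i)\<bar>) + e"
        by (intro exI[of _ "(S, l, r)"]) auto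
    qed
    from bchoice[OF this] obtain f where f: "\<forall>p\<in>T. nonoverlapping (fst (f p) :: (real \<times> real) set) (fst (snd (f p))) (snd (snd (f p))) \<and>
        (\<forall>i\<in>fst (f p). fst p \<le> fst (snd (f p)) i \<and> snd (snd (f p)) i \<le> snd p) \<and>
        pos_variation F (snd p) - pos_variation F (fst p) \<le> (\<Sum>i\<in>fst (f p). \<bar>F (snd (snd (f p)) i) - F (fst (snd (f p)) i)\<bar>) + e" ..
    define S where "S p = fst (f p)" for p
    define l where "l p = fst (snd (f p))" for p
    define r where "r p = snd (snd (f p))" for p
    have S: "\<And>p. p \<in> T \<Longrightarrow> nonoverlapping (S p) (l p) (r p)"
      and sub: "\<And>p i. p \<in> T \<Longrightarrow> i \<in> S p \<Longrightarrow> fst p \<le> l p i \<and> r p i \<le> snd p"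
      and inc: "\<And>p. p \<in> T \<Longrightarrow> pos_variation F (snd p) - pos_variation F (fst p) \<le> (\<Sum>i\<in>S p. \<bar>F (r p i) - F (l p i)\<bar>) + e"
      using f by (auto simp: S_def l_def r_def)
    have finS: "finite (S p)" if "p \<in> T" for p using S[OF that] by (simp add: nonoverlapping_def)
    define l' where "l' = (\<lambda>(p, i). l p i)"
    define r' where "r' = (\<lambda>(p, i). r p i)"
    have no: "nonoverlapping (Sigma T S) l' r'"
      unfolding nonoverlapping_def disjoint_family_on_def
    proof (intro conjI ballI impI)
      show "finite (Sigma T S)" using finT finS by blast
      show "l' x \<le> r' x" if "x \<in> Sigma T S" for x
        using that S by (auto simp: nonoverlapping_def l'_def r'_def)
      show "{l' x<..<r' x} \<inter> {l' y<..<r' y} = {}" if "x \<in> Sigma T S" "y \<in> Sigma T S" "x \<noteq> y" for x y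
      proof -
        obtain p i q j where xy: "x = (p, i)" "y = (q, j)" by (cases x, cases y) blast
        with that have *: "p \<in> T" "q \<in> T" "i \<in> S p" "j \<in> S q" by auto
        show ?thesis
        proof (cases "p = q")
          case True
          then have "i \<noteq> j" using that xy by auto
          then show ?thesis
            using S[OF \<open>p \<in> T\<close>] * True xy unfolding nonoverlapping_def disjoint_family_on_def
            by (simp add: l'_def r'_def)
        next
          case False
          have "{l' x<..<r' x} \<subseteq> {fst p<..<snd p}" "{l' y<..<r' y} \<subseteq> {fst q<..<snd q}"
            using sub[OF *(1,3)] sub[OF *(2,4)] xy by (auto simp: l'_def r'_def)
          then show ?thesis using disjT[OF *(1,2) False] by blast
        qed
      qed
    qed
    have "(\<Sum>x\<in>Sigma T S. r' x - l' x) = (\<Sum>p\<in>T. \<Sum>i\<in>S p. r p i - l p i)"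
      using finT finS by (subst sum.Sigma) (auto simp: l'_def r'_def intro!: sum.cong)
    also have "\<dots> \<le> (\<Sum>p\<in>T. snd p - fst p)"
      using S sub leT by (intro sum_mono nonoverlapping_sum_length_le) auto
    finally have "(\<Sum>x\<in>Sigma T S. r' x - l' x) < \<rho>" using len by simp
    from \<rho>(2)[rule_format, OF conjI[OF no this]] have small: "(\<Sum>p\<in>T. \<Sum>i\<in>S p. \<bar>F (r p i) - F (l p i)\<bar>) < \<epsilon> / 2"
      using finT finS by (subst sum.Sigma) (auto simp: l'_def r'_def case_prod_beta)
    have "(\<Sum>p\<in>T. \<bar>pos_variation F (snd p) - pos_variation F (fst p)\<bar>)
        \<le> (\<Sum>p\<in>T. (\<Sum>i\<in>S p. \<bar>F (r p i) - F (l p i)\<bar>) + e)"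
      using pos_variation_mono leT inc by (intro sum_mono) force
    also have "\<dots> = (\<Sum>p\<in>T. \<Sum>i\<in>S p. \<bar>F (r p i) - F (l p i)\<bar>) + real (card T) * e"
      by (simp add: sum.distrib)
    also have "real (card T) * e \<le> \<epsilon> / 2"
      using \<epsilon> by (simp add: e_def divide_simps)
    finally show ?thesis using small by simp
  qed
  then show "\<exists>\<rho>>0. \<forall>S :: (real \<times> real) set. nonoverlapping S fst snd \<and> (\<Sum>p\<in>S. snd p - fst p) < \<rho> \<longrightarrow>
     (\<Sum>p\<in>S. \<bar>pos_variation F (snd p) - pos_variation F (fst p)\<bar>) < \<epsilon>"
    using \<rho>(1) by blast
qed

end

lemma abs_cont_diff:
  assumes "abs_cont F" "abs_cont G"
  shows "abs_cont (\<lambda>x. F x - G x)"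
  unfolding abs_cont_def
proof (intro allI impI)
  fix \<epsilon> :: real assume \<epsilon>: "\<epsilon> > 0"
  obtain \<rho> where \<rho>: "\<rho> > 0" "\<forall>S :: (real \<times> real) set. nonoverlapping S fst snd \<and>
     (\<Sum>p\<in>S. snd p - fst p) < \<rho> \<longrightarrow> (\<Sum>p\<in>S. \<bar>F (snd p) - F (fst p)\<bar>) < \<epsilon> / 2"
    using assms(1) half_gt_zero[OF \<epsilon>] unfolding abs_cont_def by blast
  obtain \<sigma> where \<sigma>: "\<sigma> > 0" "\<forall>S :: (real \<times> real) set. nonoverlapping S fst snd \<and>
     (\<Sum>p\<in>S. snd p - fst p) < \<sigma> \<longrightarrow> (\<Sum>p\<in>S. \<bar>G (snd p) - G (fst p)\<bar>) < \<epsilon> / 2"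
    using assms(2) half_gt_zero[OF \<epsilon>] unfolding abs_cont_def by blast
  have "(\<Sum>p\<in>S. \<bar>F (snd p) - G (snd p) - (F (fst p) - G (fst p))\<bar>) < \<epsilon>"
    if "nonoverlapping S fst snd" "(\<Sum>p\<in>S. snd p - fst p) < min \<rho> \<sigma>" for S :: "(real \<times> real) set"
  proof -
    have "(\<Sum>p\<in>S. \<bar>F (snd p) - G (snd p) - (F (fst p) - G (fst p))\<bar>) \<le>
        (\<Sum>p\<in>S. \<bar>F (snd p) - F (fst p)\<bar>) + (\<Sum>p\<in>S. \<bar>G (snd p) - G (fst p)\<bar>)"
      unfolding sum.distrib[symmetric] by (intro sum_mono) linarith
    then show ?thesis using \<rho>(2)[rule_format, of S] \<sigma>(2)[rule_format, of S] that by simp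
  qed
  then show "\<exists>\<rho>>0. \<forall>S :: (real \<times> real) set. nonoverlapping S fst snd \<and> (\<Sum>p\<in>S. snd p - fst p) < \<rho> \<longrightarrow>
     (\<Sum>p\<in>S. \<bar>F (snd p) - G (snd p) - (F (fst p) - G (fst p))\<bar>) < \<epsilon>"
    using \<rho>(1) \<sigma>(1) by (intro exI[of _ "min \<rho> \<sigma>"]) auto
qed

subsection \<open>Densities of monotone functions\<close>

text \<open>Only increments are prescribed, so an additive constant is free and no base point has to
  be chosen on the line.\<close>

definition indef_integral :: "(real \<Rightarrow> 'a::euclidean_space) \<Rightarrow> (real \<Rightarrow> 'a) \<Rightarrow> bool" where
  "indef_integral F g \<longleftrightarrow>
     (\<forall>x y. x \<le> y \<longrightarrow> g absolutely_integrable_on {x..y} \<and> F y - F x = integral {x..y} g)"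

text \<open>Half-open cells tile the line and match the intervals on which
  \<open>interval_measure\<close> is computed. The bound \<open>4 ^ n\<close> makes each level
  finite, yet the region it permits, of radius about 2^n, exhausts the line.\<close>

definition dyadic_cells :: "real set \<Rightarrow> nat \<Rightarrow> int set" where
  "dyadic_cells U n = {k. \<bar>k\<bar> \<le> 4 ^ n \<and> {real_of_int k / 2 ^ n<..(of_int k + 1) / 2 ^ n} \<subseteq> U}"

lemma finite_dyadic_cells: "finite (dyadic_cells U n)"
proof (rule finite_subset)
  show "dyadic_cells U n \<subseteq> {- (4 ^ n)..4 ^ n}"
  proof
    fix k assume "k \<in> dyadic_cells U n"
    then have "\<bar>k\<bar> \<le> 4 ^ n" unfolding dyadic_cells_def by blast
    then show "k \<in> {- (4 ^ n)..4 ^ n}" unfolding atLeastAtMost_iff by linarith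
  qed
qed (rule finite_atLeastAtMost_int)

lemma mem_dyadic_interval_iff:
  "t \<in> {real_of_int k / 2 ^ n<..(of_int k + 1) / 2 ^ n} \<longleftrightarrow> k = \<lceil>t * 2 ^ n\<rceil> - 1"
proof -
  have "t \<in> {real_of_int k / 2 ^ n<..(of_int k + 1) / 2 ^ n} \<longleftrightarrow> of_int k < t * 2 ^ n \<and> t * 2 ^ n \<le> of_int k + 1"
    by (simp add: field_simps)
  also have "\<dots> \<longleftrightarrow> k = \<lceil>t * 2 ^ n\<rceil> - 1" by linarith
  finally show ?thesis .
qed

text \<open>A cell with index k splits into the cells with indices 2k and 2k + 1 of the next
  level.\<close>

lemma incseq_dyadic_cells:
  "incseq (\<lambda>n. \<Union>k\<in>dyadic_cells U n. {real_of_int k / 2 ^ n<..(of_int k + 1) / 2 ^ n})"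
proof (rule incseq_SucI, rule subsetI)
  fix n t assume "t \<in> (\<Union>k\<in>dyadic_cells U n. {real_of_int k / 2 ^ n<..(of_int k + 1) / 2 ^ n})"
  then obtain k where k: "\<bar>k\<bar> \<le> 4 ^ n" "{real_of_int k / 2 ^ n<..(of_int k + 1) / 2 ^ n} \<subseteq> U"
    and t: "t \<in> {real_of_int k / 2 ^ n<..(of_int k + 1) / 2 ^ n}"
    by (auto simp: dyadic_cells_def)
  define j where "j = \<lceil>t * 2 ^ Suc n\<rceil> - 1"
  have tj: "t \<in> {real_of_int j / 2 ^ Suc n<..(real_of_int j + 1) / 2 ^ Suc n}"
    unfolding mem_dyadic_interval_iff j_def ..
  have "real_of_int k < t * 2 ^ n" "t * 2 ^ n \<le> of_int k + 1" using t by (simp_all add: field_simps)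
  then have "of_int (2 * k) < t * 2 ^ Suc n" "t * 2 ^ Suc n \<le> of_int (2 * k + 2)" by simp_all
  then have jk: "2 * k \<le> j" "j \<le> 2 * k + 1" unfolding j_def by linarith+
  \<comment> \<open>Doubling the index may add 1; raising the bound by the factor 4 rather than 2
    leaves room for it.\<close>
  have "(1 :: int) \<le> 4 ^ n" by simp
  then have "\<bar>j\<bar> \<le> 4 ^ Suc n" using jk k(1) unfolding power_Suc by linarith
  moreover have "{real_of_int j / 2 ^ Suc n<..(real_of_int j + 1) / 2 ^ Suc n} \<subseteq> {real_of_int k / 2 ^ n<..(of_int k + (1::real)) / 2 ^ n}"
  proof -
    have "of_int (2 * k) \<le> (of_int j :: real)" "of_int j \<le> (of_int (2 * k + 1) :: real)"
      using jk unfolding of_int_le_iff by simp_all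
    then have "real_of_int k / 2 ^ n \<le> real_of_int j / 2 ^ Suc n"
      "(real_of_int j + 1) / 2 ^ Suc n \<le> (real_of_int k + 1) / 2 ^ n"
      using divide_right_mono[of "of_int (2 * k)" "real_of_int j" "2 ^ Suc n"]
        divide_right_mono[of "real_of_int j + 1" "of_int (2 * k + 2)" "2 ^ Suc n"]
      by (simp_all add: add_divide_distrib)
    then show ?thesis by fastforce
  qed
  ultimately have "j \<in> dyadic_cells U (Suc n)" using k(2) by (auto simp: dyadic_cells_def)
  then show "t \<in> (\<Union>k\<in>dyadic_cells U (Suc n). {real_of_int k / 2 ^ Suc n<..(of_int k + 1) / 2 ^ Suc n})"
    using tj by blast
qed

lemma UN_dyadic_cells:
  assumes "open U"
  shows "(\<Union>n. \<Union>k\<in>dyadic_cells U n. {real_of_int k / 2 ^ n<..(of_int k + 1) / 2 ^ n}) = U"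
proof
  show "U \<subseteq> (\<Union>n. \<Union>k\<in>dyadic_cells U n. {real_of_int k / 2 ^ n<..(of_int k + 1) / 2 ^ n})"
  proof
    fix t assume "t \<in> U"
    then obtain e where e: "e > 0" "ball t e \<subseteq> U" using assms openE by blast
    \<comment> \<open>\<open>n1\<close> makes the mesh smaller than the radius of the ball around
      \<open>t\<close>, and \<open>n2\<close> keeps the index of the cell containing
      \<open>t\<close> below \<open>4 ^ n\<close>.\<close>
    obtain n1 where n1: "1 / e < 2 ^ n1" using real_arch_pow[of 2 "1 / e"] by auto
    obtain n2 where n2: "\<bar>t\<bar> + 1 < 2 ^ n2" using real_arch_pow[of 2 "\<bar>t\<bar> + 1"] by auto
    define n where "n = max n1 n2"
    have "(2 :: real) ^ n1 \<le> 2 ^ n" "(2 :: real) ^ n2 \<le> 2 ^ n"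
      unfolding n_def by (intro power_increasing; simp)+
    then have n: "1 / e < 2 ^ n" "\<bar>t\<bar> + 1 < 2 ^ n" using n1 n2 by linarith+
    define k where "k = \<lceil>t * 2 ^ n\<rceil> - 1"
    have tk: "t \<in> {real_of_int k / 2 ^ n<..(of_int k + 1) / 2 ^ n}"
      unfolding mem_dyadic_interval_iff k_def ..
    have "\<bar>of_int k\<bar> \<le> \<bar>t\<bar> * 2 ^ n + 1"
    proof -
      have "\<bar>t\<bar> * 2 ^ n = \<bar>t * 2 ^ n\<bar>" by (simp add: abs_mult)
      then show ?thesis unfolding k_def by linarith
    qed
    also have "\<dots> \<le> \<bar>t\<bar> * 2 ^ n + 1 * 2 ^ n" by simp
    also have "\<dots> = (\<bar>t\<bar> + 1) * 2 ^ n" by (simp add: algebra_simps)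
    also have "\<dots> \<le> 2 ^ n * 2 ^ n" using n by (intro mult_right_mono) auto
    also have "\<dots> = 4 ^ n" by (simp flip: power_mult_distrib)
    finally have "real_of_int \<bar>k\<bar> \<le> real_of_int (4 ^ n)" by simp
    then have "\<bar>k\<bar> \<le> 4 ^ n" by linarith
    moreover have "{real_of_int k / 2 ^ n<..(of_int k + 1) / 2 ^ n} \<subseteq> U"
    proof
      fix s assume s: "s \<in> {real_of_int k / 2 ^ n<..(of_int k + 1) / 2 ^ n}"
      have "\<bar>s - t\<bar> < 1 / 2 ^ n"
        using s tk by (auto simp: add_divide_distrib)
      also have "\<dots> < e" using n(1) e(1) by (simp add: field_simps)
      finally show "s \<in> U" using e(2) by (auto simp: dist_real_def abs_minus_commute)
    qed
    ultimately show "t \<in> (\<Union>n. \<Union>k\<in>dyadic_cells U n. {real_of_int k / 2 ^ n<..(of_int k + 1) / 2 ^ n})"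
      using tk by (auto simp: dyadic_cells_def)
  qed
qed (auto simp: dyadic_cells_def)

lemma emeasure_open_le_if_dyadic_le:
  assumes sets: "sets M = sets borel" and U: "open U"
    and le: "\<And>n. emeasure M (\<Union>k\<in>dyadic_cells U n. {real_of_int k / 2 ^ n<..(of_int k + 1) / 2 ^ n}) \<le> e"
  shows "emeasure M U \<le> e"
proof -
  let ?V = "\<lambda>n. \<Union>k\<in>dyadic_cells U n. {real_of_int k / 2 ^ n<..(of_int k + 1) / 2 ^ n} :: real set"
  have "?V n \<in> sets M" for n
    unfolding sets by (intro sets.finite_UN finite_dyadic_cells) simp
  then have "range ?V \<subseteq> sets M" by blast
  then have "(\<lambda>n. emeasure M (?V n)) \<longlonglongrightarrow> emeasure M (\<Union>n. ?V n)"
    by (rule Lim_emeasure_incseq[OF _ incseq_dyadic_cells])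
  then have "(\<lambda>n. emeasure M (?V n)) \<longlonglongrightarrow> emeasure M U"
    by (simp only: UN_dyadic_cells[OF U])
  then show ?thesis
    by (rule LIMSEQ_le_const2) (intro exI allI impI le)
qed

text \<open>Cover a null set by an open set of small length. Absolute continuity concerns finite
  families only, so it is applied to the cells of one dyadic level inside the open set, and
  continuity from below passes the bound to the whole open set.\<close>

lemma absolutely_continuous_interval_measure:
  assumes mono: "\<And>x y. x \<le> y \<Longrightarrow> P x \<le> P y" and P: "abs_cont P"
  shows "absolutely_continuous lborel (interval_measure P)"
  unfolding absolutely_continuous_def
proof
  have cont: "continuous (at_right x) P" for x
    using abs_cont_continuous[OF P] by (simp add: continuous_on_eq_continuous_at continuous_at_imp_continuous_within)
  fix N :: "real set" assume N: "N \<in> null_sets lborel"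
  then have Nb: "N \<in> sets borel" and N0: "emeasure lborel N = 0" by auto
  have "emeasure (interval_measure P) N \<le> ennreal e" if e: "0 < e" for e
  proof -
    obtain \<rho> where \<rho>: "\<rho> > 0" "\<forall>(I :: int set) l r. nonoverlapping I l r \<and>
       (\<Sum>i\<in>I. r i - l i) < \<rho> \<longrightarrow> (\<Sum>i\<in>I. \<bar>P (r i) - P (l i)\<bar>) < e"
      using abs_contD[OF P e] by blast
    obtain U where U: "open U" "N \<subseteq> U" "emeasure lborel (U - N) < \<rho>"
      using outer_regular_lborel[OF Nb \<rho>(1)] by blast
    have lU: "emeasure lborel U < \<rho>"
      using U(1,3) emeasure_Diff_null_set[OF N, of U] by simp
    have "emeasure (interval_measure P) U \<le> ennreal e"
    proof (rule emeasure_open_le_if_dyadic_le[OF _ U(1)])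
      fix n
      define l where "l k = real_of_int k / 2 ^ n" for k
      define r where "r k = (real_of_int k + 1) / 2 ^ n" for k
      have lr: "l k \<le> r k" for k by (simp add: l_def r_def divide_right_mono)
      have disj: "disjoint_family_on (\<lambda>k. {l k<..r k}) (dyadic_cells U n)"
        unfolding disjoint_family_on_def
      proof (intro ballI impI)
        fix j k :: int assume "j \<noteq> k"
        show "{l j<..r j} \<inter> {l k<..r k} = {}"
        proof (rule ccontr)
          assume "{l j<..r j} \<inter> {l k<..r k} \<noteq> {}"
          then obtain t where "t \<in> {l j<..r j}" "t \<in> {l k<..r k}" by blast
          then show False
            using \<open>j \<noteq> k\<close> unfolding l_def r_def mem_dyadic_interval_iff by simp
        qed
      qed
      have "disjoint_family_on (\<lambda>k. {l k<..<r k}) (dyadic_cells U n)"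
        unfolding disjoint_family_on_def
      proof (intro ballI impI)
        fix i j assume *: "i \<in> dyadic_cells U n" "j \<in> dyadic_cells U n" "i \<noteq> j"
        have "{l i<..<r i} \<subseteq> {l i<..r i}" "{l j<..<r j} \<subseteq> {l j<..r j}" by auto
        moreover have "{l i<..r i} \<inter> {l j<..r j} = {}"
          using disj * unfolding disjoint_family_on_def by blast
        ultimately show "{l i<..<r i} \<inter> {l j<..<r j} = {}" by blast
      qed
      then have no: "nonoverlapping (dyadic_cells U n) l r"
        using lr finite_dyadic_cells by (simp add: nonoverlapping_def)
      have "ennreal (\<Sum>k\<in>dyadic_cells U n. r k - l k) = (\<Sum>k\<in>dyadic_cells U n. emeasure lborel {l k<..r k})"
        using lr by (simp flip: sum_ennreal)
      also have "\<dots> = emeasure lborel (\<Union>k\<in>dyadic_cells U n. {l k<..r k})"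
        by (rule sum_emeasure[OF _ disj finite_dyadic_cells]) auto
      also have "\<dots> \<le> emeasure lborel U"
      proof (rule emeasure_mono)
        show "(\<Union>k\<in>dyadic_cells U n. {l k<..r k}) \<subseteq> U"
          unfolding l_def r_def dyadic_cells_def by blast
      qed (use U(1) in simp)
      also note lU
      finally have "(\<Sum>k\<in>dyadic_cells U n. r k - l k) < \<rho>"
        using \<rho>(1) by (simp add: ennreal_less_iff sum_nonneg lr)
      then have small: "(\<Sum>k\<in>dyadic_cells U n. \<bar>P (r k) - P (l k)\<bar>) < e" using \<rho>(2)[rule_format, OF conjI[OF no]] by simp
      have "emeasure (interval_measure P) (\<Union>k\<in>dyadic_cells U n. {l k<..r k})
          = (\<Sum>k\<in>dyadic_cells U n. emeasure (interval_measure P) {l k<..r k})"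
        by (rule sum_emeasure[OF _ disj finite_dyadic_cells, symmetric]) auto
      also have "\<dots> = (\<Sum>k\<in>dyadic_cells U n. ennreal \<bar>P (r k) - P (l k)\<bar>)"
      proof (rule sum.cong[OF refl])
        fix k
        show "emeasure (interval_measure P) {l k<..r k} = ennreal \<bar>P (r k) - P (l k)\<bar>"
          using emeasure_interval_measure_Ioc[OF lr mono cont, of k] mono[OF lr, of k] by simp
      qed
      also have "\<dots> \<le> ennreal e" using small by (simp add: ennreal_leI)
      finally show "emeasure (interval_measure P) (\<Union>k\<in>dyadic_cells U n. {real_of_int k / 2 ^ n<..(of_int k + 1) / 2 ^ n}) \<le> ennreal e"
        by (simp add: l_def r_def)
    qed simp
    moreover have "emeasure (interval_measure P) N \<le> emeasure (interval_measure P) U"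
      using U by (intro emeasure_mono) auto
    ultimately show ?thesis by (rule order_trans[rotated])
  qed
  note * = this
  have "emeasure (interval_measure P) N \<le> 0"
  proof (rule ennreal_le_epsilon)
    fix e :: real assume "0 < e"
    from *[OF this] show "emeasure (interval_measure P) N \<le> 0 + ennreal e" by simp
  qed
  then show "N \<in> null_sets (interval_measure P)" using Nb by auto
qed

text \<open>The density is the Radon-Nikodym derivative of the Stieltjes measure of \<open>P\<close>
  with respect to Lebesgue measure.\<close>

lemma indef_integral_mono_abs_cont:
  assumes mono: "\<And>x y. x \<le> y \<Longrightarrow> P x \<le> P y" and P: "abs_cont P"
  shows "\<exists>p. indef_integral P p"
proof -
  have cont: "continuous (at_right x) P" for x
    using abs_cont_continuous[OF P] by (simp add: continuous_on_eq_continuous_at continuous_at_imp_continuous_within)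
  obtain f where f: "f \<in> borel_measurable lborel" "density lborel f = interval_measure P"
    using sigma_finite_measure.Radon_Nikodym[OF sigma_finite_lborel absolutely_continuous_interval_measure[OF mono P]]
    by auto
  have *: "((\<lambda>t. enn2real (f t)) has_integral P y - P x) {x..y}" if "x \<le> y" for x y
  proof -
    have "(\<integral>\<^sup>+t. f t * indicator {x<..y} t \<partial>lborel) = emeasure (interval_measure P) {x<..y}"
      using f by (simp flip: f(2) add: emeasure_density)
    also have "\<dots> = ennreal (P y - P x)"
      using that by (simp add: emeasure_interval_measure_Ioc[OF _ mono cont])
    finally have eq: "(\<integral>\<^sup>+t. f t * indicator {x<..y} t \<partial>lborel) = ennreal (P y - P x)" .
    \<comment> \<open>A finite integral forces the density to be finite almost everywhere on the
      interval, so \<open>enn2real\<close> alters nothing that matters; its default value at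
      infinity is met only on a null set.\<close>
    have "AE t in lborel. f t * indicator {x<..y} t \<noteq> \<infinity>"
      using f(1) eq by (intro nn_integral_PInf_AE) auto
    then have "(\<integral>\<^sup>+t. f t * indicator {x<..y} t \<partial>lborel) = (\<integral>\<^sup>+t. ennreal (enn2real (f t) * indicator {x<..y} t) \<partial>lborel)"
      by (intro nn_integral_cong_AE) (elim eventually_mono, auto simp: indicator_def less_top)
    then have "((\<lambda>t. enn2real (f t) * indicator {x<..y} t) has_integral P y - P x) UNIV"
      using f(1) eq mono[OF that] by (intro nn_integral_has_integral) (auto simp: sets_lborel)
    moreover have "(\<lambda>t. enn2real (f t) * indicator {x<..y} t) = (\<lambda>t. if t \<in> {x<..y} then enn2real (f t) else 0)"
      by (auto simp: fun_eq_iff)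
    ultimately have "((\<lambda>t. enn2real (f t)) has_integral P y - P x) {x<..y}"
      by (simp only: has_integral_restrict_UNIV)
    then show ?thesis
    proof (rule has_integral_spike_set_eq[THEN iffD1, rotated 2])
      show "negligible {t \<in> {x<..y} - {x..y}. enn2real (f t) \<noteq> 0}"
        by (rule negligible_subset[of "{x}"]) auto
      show "negligible {t \<in> {x..y} - {x<..y}. enn2real (f t) \<noteq> 0}"
        by (rule negligible_subset[of "{x}"]) auto
    qed
  qed
  have "indef_integral P (\<lambda>t. enn2real (f t))"
    unfolding indef_integral_def
  proof (intro allI impI conjI)
    fix x y :: real assume xy: "x \<le> y"
    have "(\<lambda>t. enn2real (f t)) integrable_on {x..y}" using *[OF xy] by (rule has_integral_integrable)
    then show "(\<lambda>t. enn2real (f t)) absolutely_integrable_on {x..y}"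
      by (rule nonnegative_absolutely_integrable_1) simp
    show "P y - P x = integral {x..y} (\<lambda>t. enn2real (f t))"
      using *[OF xy] by (rule integral_unique[symmetric])
  qed
  then show ?thesis by blast
qed

lemma indef_integral_diff:
  assumes "indef_integral F f" "indef_integral G g"
  shows "indef_integral (\<lambda>t. F t - G t) (\<lambda>t. f t - g t)"
  unfolding indef_integral_def
proof (intro allI impI conjI)
  fix x y :: real assume "x \<le> y"
  then have *: "f absolutely_integrable_on {x..y}" "F y - F x = integral {x..y} f"
    "g absolutely_integrable_on {x..y}" "G y - G x = integral {x..y} g"
    using assms unfolding indef_integral_def by blast+
  then show "(\<lambda>t. f t - g t) absolutely_integrable_on {x..y}" by (intro set_integral_diff(1))
  have "integral {x..y} (\<lambda>t. f t - g t) = integral {x..y} f - integral {x..y} g"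
    using *(1,3) by (intro Henstock_Kurzweil_Integration.integral_diff set_lebesgue_integral_eq_integral(1))
  then show "F y - G y - (F x - G x) = integral {x..y} (\<lambda>t. f t - g t)"
    using *(2,4) by (simp add: algebra_simps)
qed

text \<open>\<open>F\<close> is the difference of the increasing absolutely continuous functions P
  and P - F, where P is the positive variation.\<close>

lemma indef_integral_abs_cont_clamped:
  assumes F: "abs_cont F" and cd: "c \<le> d"
    and left: "\<And>x. x \<le> c \<Longrightarrow> F x = F c" and right: "\<And>x. d \<le> x \<Longrightarrow> F x = F d"
  shows "\<exists>f. indef_integral F f"
proof -
  let ?P = "pos_variation F"
  note AC = abs_cont_pos_variation[OF F cd left right]
  have mono_diff: "?P x - F x \<le> ?P y - F y" if "x \<le> y" for x y
    using pos_variation_add[OF F cd left right that] by simp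
  from indef_integral_mono_abs_cont[OF pos_variation_mono[OF F cd left right] AC]
  obtain p where p: "indef_integral ?P p" ..
  from indef_integral_mono_abs_cont[OF mono_diff abs_cont_diff[OF AC F]]
  obtain q where q: "indef_integral (\<lambda>x. ?P x - F x) q" ..
  from indef_integral_diff[OF p q] show ?thesis by auto
qed

section \<open>Null sets and indefinite integrals\<close>

lemma AE_lebesgue_negligible:
  "(AE t in lebesgue. Q t) \<longleftrightarrow> (\<exists>N. negligible N \<and> (\<forall>t. t \<notin> N \<longrightarrow> Q t))"
proof -
  have "{t \<in> space lebesgue. \<not> Q t} \<subseteq> N \<longleftrightarrow> (\<forall>t. t \<notin> N \<longrightarrow> Q t)" for N :: "'a set"
    by auto
  then show ?thesis unfolding eventually_ae_filter negligible_iff_null_sets by blast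
qed

lemma indef_integralD:
  assumes "indef_integral F f" "x \<le> y"
  shows "f absolutely_integrable_on {x..y}" "integral {x..y} f = F y - F x"
proof -
  have "f absolutely_integrable_on {x..y} \<and> F y - F x = integral {x..y} f"
    using assms unfolding indef_integral_def by blast
  then show "f absolutely_integrable_on {x..y}" "integral {x..y} f = F y - F x" by (rule conjunct1, metis)
qed

lemma indef_integral_cong_AE:
  assumes F: "indef_integral F f" and fg: "AE t in lebesgue. f t = g t"
  shows "indef_integral F g"
  unfolding indef_integral_def
proof (intro allI impI conjI)
  fix x y :: real assume "x \<le> y"
  note f = indef_integralD[OF F this]
  obtain N where N: "negligible N" "\<And>t. t \<notin> N \<Longrightarrow> f t = g t"
    using fg unfolding AE_lebesgue_negligible by blast
  show "g absolutely_integrable_on {x..y}"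
    by (rule absolutely_integrable_spike[OF f(1) N(1)]) (use N in auto)
  have "integral {x..y} g = integral {x..y} f"
    by (rule integral_spike[OF N(1)]) (use N in auto)
  then show "F y - F x = integral {x..y} g" using f(2) by simp
qed

lemma indef_integral_continuous:
  assumes F: "indef_integral F f"
  shows "continuous_on UNIV F"
proof -
  have "continuous_on {c..d} F" for c d
  proof (cases "c \<le> d")
    case True
    have "continuous_on {c..d} (\<lambda>x. F c + integral {c..x} f)"
      using indef_integralD(1)[OF F True]
      by (intro continuous_intros indefinite_integral_continuous_1 set_lebesgue_integral_eq_integral(1))
    moreover have "F c + integral {c..x} f = F x" if "x \<in> {c..d}" for x
      using indef_integralD(2)[OF F, of c x] that by simp
    ultimately show ?thesis by (rule continuous_on_eq)
  qed simp
  then have "continuous (at x) F" for x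
    by (rule continuous_on_interior[of "{x - 1..x + 1}"]) simp
  then show ?thesis by (simp add: continuous_on_eq_continuous_at)
qed

subsection \<open>Lebesgue differentiation\<close>

text \<open>The differentiation theorem invoked here averages over boxes with lower corner
  \<open>x\<close>, so on the line it controls right-hand difference quotients only.\<close>

lemma indef_integral_AE_right_deriv:
  assumes F: "indef_integral F f"
  shows "AE t in lebesgue. \<forall>e>0. \<exists>d>0. \<forall>h. 0 < h \<and> h < d \<longrightarrow> norm ((F (t + h) - F t) /\<^sub>R h - f t) < e"
proof -
  have "f integrable_on cbox a b" for a b
    using indef_integralD(1)[OF F, of a b] by (cases "a \<le> b") (auto intro: set_lebesgue_integral_eq_integral(1))
  then show ?thesis
  proof (rule integrable_ccontinuous_explicit)
    fix N assume N: "negligible N"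
      "\<And>x e. \<lbrakk>x \<notin> N; 0 < e\<rbrakk> \<Longrightarrow> \<exists>d>0. \<forall>h. 0 < h \<and> h < d \<longrightarrow>
        norm (integral (cbox x (x + h *\<^sub>R One)) f /\<^sub>R h ^ DIM(real) - f x) < e"
    have "integral {x..x + h} f = F (x + h) - F x" if "0 < h" for x h
      using indef_integralD(2)[OF F, of x "x + h"] that by simp
    then have "\<forall>e>0. \<exists>d>0. \<forall>h. 0 < h \<and> h < d \<longrightarrow> norm ((F (t + h) - F t) /\<^sub>R h - f t) < e" if "t \<notin> N" for t
      using N(2)[OF that] by simp
    then show ?thesis unfolding AE_lebesgue_negligible using N(1) by blast
  qed
qed

text \<open>Reflection turns left-hand difference quotients into right-hand ones, which supplies the
  missing half of differentiability.\<close>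

lemma indef_integral_reflect:
  assumes F: "indef_integral F f"
  shows "indef_integral (\<lambda>t. - F (- t)) (\<lambda>t. f (- t))"
  unfolding indef_integral_def
proof (intro allI impI conjI)
  fix x y :: real assume xy: "x \<le> y"
  then have "- y \<le> - x" by simp
  note f = indef_integralD[OF F this]
  show "(\<lambda>t. f (- t)) absolutely_integrable_on {x..y}"
    using f(1) absolutely_integrable_reflect_real[where a = "- y" and b = "- x" and f = f] by simp
  show "- F (- y) - - F (- x) = integral {x..y} (\<lambda>t. f (- t))"
    using f(2) Henstock_Kurzweil_Integration.integral_reflect_real[where a = "- y" and b = "- x" and f = f] by simp
qed

lemma AE_lebesgue_reflect:
  assumes "AE t in lebesgue. Q (t :: real)"
  shows "AE t in lebesgue. Q (- t)"
proof -
  obtain N where N: "negligible N" "\<And>t. t \<notin> N \<Longrightarrow> Q t"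
    using assms unfolding AE_lebesgue_negligible by blast
  have "negligible (uminus ` N)"
    by (rule negligible_differentiable_image_negligible[OF _ N(1)]) (auto intro!: derivative_intros)
  moreover have "Q (- t)" if "t \<notin> uminus ` N" for t
    using N(2)[of "- t"] that by force
  ultimately show ?thesis unfolding AE_lebesgue_negligible by blast
qed

lemma indef_integral_AE_deriv:
  assumes F: "indef_integral F f"
  shows "AE t in lebesgue. (F has_vector_derivative f t) (at t)"
  using indef_integral_AE_right_deriv[OF F]
    AE_lebesgue_reflect[OF indef_integral_AE_right_deriv[OF indef_integral_reflect[OF F]]]
proof eventually_elim
  case (elim t)
  show ?case
    unfolding has_vector_derivative_def has_derivative_at_alt
  proof (intro conjI allI impI bounded_linear_scaleR_left)
    fix e :: real assume e: "e > 0"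
    obtain d1 where d1: "d1 > 0" "\<And>h. 0 < h \<Longrightarrow> h < d1 \<Longrightarrow> norm ((F (t + h) - F t) /\<^sub>R h - f t) < e"
      using elim(1) e by blast
    obtain d2 where d2: "d2 > 0" "\<And>h. 0 < h \<Longrightarrow> h < d2 \<Longrightarrow> norm ((F t - F (t - h)) /\<^sub>R h - f t) < e"
      using elim(2) e by (simp add: algebra_simps) blast
    \<comment> \<open>Rewrites a bound on a difference quotient as the bound on increments that the
      definition of the derivative asks for.\<close>
    have scale: "norm (u - h *\<^sub>R v) \<le> e * h" if "norm (u /\<^sub>R h - v) < e" "0 < h" for u v :: 'a and h
    proof -
      have "u - h *\<^sub>R v = h *\<^sub>R (u /\<^sub>R h - v)" using that by (simp add: algebra_simps)
      then have "norm (u - h *\<^sub>R v) = h * norm (u /\<^sub>R h - v)" using that by simp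
      also have "\<dots> \<le> h * e" using that by (intro mult_left_mono) auto
      finally show ?thesis by (simp add: mult.commute)
    qed
    have "norm (F y - F t - (y - t) *\<^sub>R f t) \<le> e * norm (y - t)" if "norm (y - t) < min d1 d2" for y
    proof -
      consider "y = t" | "t < y" | "y < t" by linarith
      then show ?thesis
      proof cases
        case 2
        then show ?thesis using scale[OF d1(2)[of "y - t"]] that by simp
      next
        case 3
        then have "norm (F t - F y - (t - y) *\<^sub>R f t) \<le> e * (t - y)"
          using scale[OF d2(2)[of "t - y"]] that by simp
        moreover have "F y - F t - (y - t) *\<^sub>R f t = - (F t - F y - (t - y) *\<^sub>R f t)"
          by (simp add: algebra_simps)
        ultimately have "norm (F y - F t - (y - t) *\<^sub>R f t) \<le> e * (t - y)"
          by (metis norm_minus_cancel)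
        then show ?thesis using 3 by simp
      qed simp
    qed
    then show "\<exists>d>0. \<forall>y. norm (y - t) < d \<longrightarrow> norm (F y - F t - (y - t) *\<^sub>R f t) \<le> e * norm (y - t)"
      using d1(1) d2(1) by (intro exI[of _ "min d1 d2"]) auto
  qed
qed

lemma indef_integral_unique:
  assumes "indef_integral F f" "indef_integral F g"
  shows "AE t in lebesgue. f t = g t"
  using indef_integral_AE_deriv[OF assms(1)] indef_integral_AE_deriv[OF assms(2)]
  by eventually_elim (rule vector_derivative_unique_at)

subsection \<open>Absolutely continuous functions are indefinite integrals\<close>

definition short_family :: "real \<Rightarrow> real \<Rightarrow> real \<Rightarrow> (real \<times> real) set \<Rightarrow> bool" where
  "short_family c d r S \<longleftrightarrow> finite S \<and> (\<forall>(x, y)\<in>S. c \<le> x \<and> x \<le> y \<and> y \<le> d) \<and>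
     pairwise (\<lambda>(x, y) (u, v). {x<..<y} \<inter> {u<..<v} = {}) S \<and> (\<Sum>(x, y)\<in>S. y - x) < r"

lemma loc_abs_cont_iff:
  "loc_abs_cont F \<longleftrightarrow> (\<forall>c d. \<forall>\<epsilon>>0. \<exists>r>0. \<forall>S. short_family c d r S \<longrightarrow> (\<Sum>(x, y)\<in>S. norm (F y - F x)) < \<epsilon>)"
  unfolding loc_abs_cont_def short_family_def ..

lemma short_family_mono: "short_family c d r S \<Longrightarrow> r \<le> r' \<Longrightarrow> short_family c d r' S"
  by (auto simp: short_family_def)

lemma loc_abs_cont_nonoverlapping:
  assumes F: "loc_abs_cont F" and e: "0 < \<epsilon>"
  shows "\<exists>\<rho>>0. \<forall>(I :: 'i set) l r. nonoverlapping I l r \<and> (\<forall>i\<in>I. c \<le> l i \<and> r i \<le> d) \<and>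
     (\<Sum>i\<in>I. r i - l i) < \<rho> \<longrightarrow> (\<Sum>i\<in>I. norm (F (r i) - F (l i))) < \<epsilon>"
proof -
  obtain \<rho> where \<rho>: "\<rho> > 0" and *: "\<forall>S. short_family c d \<rho> S \<longrightarrow> (\<Sum>(x, y)\<in>S. norm (F y - F x)) < \<epsilon>"
    using F e unfolding loc_abs_cont_iff by blast
  show ?thesis
  proof (intro exI[of _ \<rho>] conjI allI impI \<rho>)
    fix I :: "'i set" and l r
    assume I: "nonoverlapping I l r \<and> (\<forall>i\<in>I. c \<le> l i \<and> r i \<le> d) \<and> (\<Sum>i\<in>I. r i - l i) < \<rho>"
    obtain S where S: "finite S" "\<And>x y. (x, y) \<in> S \<Longrightarrow> \<exists>i\<in>I. x = l i \<and> y = r i \<and> x < y"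
    "pairwise (\<lambda>(x, y) (u, v). {x<..<y} \<inter> {u<..<v} = {}) S"
    "\<And>h :: real \<Rightarrow> real \<Rightarrow> real. (\<And>x. h x x = 0) \<Longrightarrow> (\<Sum>(x, y)\<in>S. h x y) = (\<Sum>i\<in>I. h (l i) (r i))"
    "nonoverlapping S fst snd"
      using nonoverlapping_as_set[OF conjunct1[OF I]] by blast
    have "\<forall>(x, y)\<in>S. c \<le> x \<and> x \<le> y \<and> y \<le> d" using S(2) I by fastforce
    moreover have "(\<Sum>(x, y)\<in>S. y - x) < \<rho>" using S(4)[of "\<lambda>x y. y - x"] I by simp
    ultimately have "short_family c d \<rho> S"
      unfolding short_family_def by (intro conjI S(1,3))
    then have "(\<Sum>(x, y)\<in>S. norm (F y - F x)) < \<epsilon>" using * by blast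
    then show "(\<Sum>i\<in>I. norm (F (r i) - F (l i))) < \<epsilon>"
      using S(4)[of "\<lambda>x y. norm (F y - F x)"] by simp
  qed
qed

text \<open>Clamping is increasing and does not expand distances, so it keeps families
  nonoverlapping and short while moving them into \<open>{c..d}\<close>, where the local condition
  applies.\<close>

lemma loc_abs_cont_clamped:
  assumes F: "loc_abs_cont (F :: real \<Rightarrow> real)" and cd: "c \<le> d"
  shows "abs_cont (\<lambda>t. F (max c (min d t)))"
  unfolding abs_cont_def
proof (intro allI impI)
  fix \<epsilon> :: real assume "\<epsilon> > 0"
  from loc_abs_cont_nonoverlapping[OF F this, of c d]
  obtain \<rho> where \<rho>': "\<rho> > 0 \<and> (\<forall>(I :: (real \<times> real) set) l r. nonoverlapping I l r \<and> (\<forall>i\<in>I. c \<le> l i \<and> r i \<le> d) \<and>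
     (\<Sum>i\<in>I. r i - l i) < \<rho> \<longrightarrow> (\<Sum>i\<in>I. norm (F (r i) - F (l i))) < \<epsilon>)" ..
  note \<rho> = conjunct1[OF \<rho>'] and * = conjunct2[OF \<rho>']
  have "(\<Sum>p\<in>S. \<bar>F (max c (min d (snd p))) - F (max c (min d (fst p)))\<bar>) < \<epsilon>"
    if S: "nonoverlapping S fst snd" and len: "(\<Sum>p\<in>S. snd p - fst p) < \<rho>" for S :: "(real \<times> real) set"
  proof -
    have no: "nonoverlapping S (\<lambda>p. max c (min d (fst p))) (\<lambda>p. max c (min d (snd p)))"
      using nonoverlapping_max[OF nonoverlapping_min[OF S]] by (simp only: min.commute[of d] max.commute[of c])
    have "max c (min d (snd p)) - max c (min d (fst p)) \<le> snd p - fst p" if "p \<in> S" for p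
      using nonoverlapping_le[OF S that] cd by (auto simp: max_def min_def)
    then have "(\<Sum>p\<in>S. max c (min d (snd p)) - max c (min d (fst p))) < \<rho>"
      using len by (rule le_less_trans[OF sum_mono])
    then have "nonoverlapping S (\<lambda>p. max c (min d (fst p))) (\<lambda>p. max c (min d (snd p))) \<and>
        (\<forall>p\<in>S. c \<le> max c (min d (fst p)) \<and> max c (min d (snd p)) \<le> d) \<and>
        (\<Sum>p\<in>S. max c (min d (snd p)) - max c (min d (fst p))) < \<rho>"
      using no cd by simp
    then have "(\<Sum>p\<in>S. norm (F (max c (min d (snd p))) - F (max c (min d (fst p))))) < \<epsilon>"
      by (rule *[THEN spec, THEN spec, THEN spec, THEN mp])
    then show ?thesis by simp
  qed
  then show "\<exists>\<rho>>0. \<forall>S :: (real \<times> real) set. nonoverlapping S fst snd \<and> (\<Sum>p\<in>S. snd p - fst p) < \<rho> \<longrightarrow>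
     (\<Sum>p\<in>S. \<bar>F (max c (min d (snd p))) - F (max c (min d (fst p)))\<bar>) < \<epsilon>"
    by (intro exI[of _ \<rho>] conjI \<rho>) simp
qed

text \<open>The clamped functions have densities. Near a point of the open interval from -n to n the
  n-th clamped function coincides with \<open>F\<close>, so all these densities agree a.e. with the
  classical derivative.\<close>

lemma loc_abs_cont_indef_integral_real:
  fixes F :: "real \<Rightarrow> real"
  assumes F: "loc_abs_cont F"
  shows "\<exists>f. indef_integral F f"
proof -
  define G where "G n t = F (max (- real n) (min (real n) t))" for n t
  have "\<exists>g. indef_integral (G n) g" for n
  proof -
    have "abs_cont (G n)" unfolding G_def by (rule loc_abs_cont_clamped[OF F]) simp
    then show ?thesis
      by (rule indef_integral_abs_cont_clamped[where c = "- real n" and d = "real n"]) (simp_all add: G_def)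
  qed
  then have "\<forall>n. \<exists>g. indef_integral (G n) g" ..
  from choice[OF this] obtain g where g: "\<forall>n. indef_integral (G n) (g n)" ..
  \<comment> \<open>One function independent of \<open>n\<close>. Where \<open>F\<close> is not
    differentiable the value is an arbitrary default, which is confined to a null set.\<close>
  define f where "f t = vector_derivative F (at t)" for t
  have AE: "AE t in lebesgue. \<forall>n. \<bar>t\<bar> < real n \<longrightarrow> g n t = f t"
    unfolding AE_all_countable
  proof
    fix n
    from indef_integral_AE_deriv[OF spec[OF g, of n]]
    show "AE t in lebesgue. \<bar>t\<bar> < real n \<longrightarrow> g n t = f t"
    proof eventually_elim
      case (elim t)
      show ?case
      proof
        assume t: "\<bar>t\<bar> < real n"
        have "(F has_vector_derivative g n t) (at t)"
          by (rule has_vector_derivative_transform_within_open[OF elim, of "{- real n<..<real n}"])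
            (use t in \<open>simp_all add: G_def abs_less_iff\<close>)
        then show "g n t = f t" unfolding f_def by (rule vector_derivative_at[symmetric])
      qed
    qed
  qed
  then obtain N where N': "negligible N \<and> (\<forall>t. t \<notin> N \<longrightarrow> (\<forall>n. \<bar>t\<bar> < real n \<longrightarrow> g n t = f t))"
    unfolding AE_lebesgue_negligible ..
  then have N: "negligible N" "\<And>t n. t \<notin> N \<Longrightarrow> \<bar>t\<bar> < real n \<Longrightarrow> g n t = f t" by simp_all
  have "indef_integral F f"
    unfolding indef_integral_def
  proof (intro allI impI conjI)
    fix x y :: real assume xy: "x \<le> y"
    obtain n where n: "\<bar>x\<bar> + \<bar>y\<bar> < real n" using reals_Archimedean2 by blast
    have eq: "g n t = f t" if "t \<in> {x..y} - N" for t
      using that n by (intro N(2)) auto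
    note gn = indef_integralD[OF spec[OF g, of n] xy]
    show "f absolutely_integrable_on {x..y}"
      by (rule absolutely_integrable_spike[OF gn(1) N(1)]) (use eq in auto)
    have "integral {x..y} f = integral {x..y} (g n)"
      by (rule integral_spike[OF N(1)]) (use eq in auto)
    moreover have "G n x = F x" "G n y = F y" using n by (simp_all add: G_def)
    ultimately show "F y - F x = integral {x..y} f" using gn(2) by simp
  qed
  then show ?thesis by blast
qed

text \<open>The common source of the closure rules that follow for linear maps, sums, products and
  compositions: each of them only has to supply a Lipschitz-type bound on compact intervals. Unary
  rules take \<open>F\<close> for \<open>G\<close> as well.\<close>

lemma loc_abs_cont_dominated:
  assumes F: "loc_abs_cont F" and G: "loc_abs_cont G"
    and dom: "\<And>c d. \<exists>L. \<forall>x\<in>{c..d}. \<forall>y\<in>{c..d}. norm (H y - H x) \<le> L * (norm (F y - F x) + norm (G y - G x))"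
  shows "loc_abs_cont H"
  unfolding loc_abs_cont_iff
proof (intro allI impI)
  fix c d \<epsilon> :: real assume \<epsilon>: "\<epsilon> > 0"
  obtain L where L0: "\<And>x y. x \<in> {c..d} \<Longrightarrow> y \<in> {c..d} \<Longrightarrow> norm (H y - H x) \<le> L * (norm (F y - F x) + norm (G y - G x))"
    using dom[of c d] by blast
  have L: "norm (H y - H x) \<le> max L 1 * (norm (F y - F x) + norm (G y - G x))" if "x \<in> {c..d}" "y \<in> {c..d}" for x y
    by (rule order_trans[OF L0[OF that]], rule mult_right_mono) simp_all
  \<comment> \<open>Two sums smaller than \<open>e\<close> are multiplied by the constant
    \<open>max L 1\<close>, which unlike \<open>L\<close> is certainly positive.\<close>
  define e where "e = \<epsilon> / (2 * max L 1)"
  have e: "e > 0" using \<epsilon> by (simp add: e_def)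
  obtain r where r: "r > 0" "\<forall>S. short_family c d r S \<longrightarrow> (\<Sum>(x, y)\<in>S. norm (F y - F x)) < e"
    using F e unfolding loc_abs_cont_iff by blast
  obtain s where s: "s > 0" "\<forall>S. short_family c d s S \<longrightarrow> (\<Sum>(x, y)\<in>S. norm (G y - G x)) < e"
    using G e unfolding loc_abs_cont_iff by blast
  have "(\<Sum>(x, y)\<in>S. norm (H y - H x)) < \<epsilon>"
    if short: "short_family c d (min r s) S" for S
  proof -
    have S: "\<forall>(x, y)\<in>S. c \<le> x \<and> x \<le> y \<and> y \<le> d" using short unfolding short_family_def by blast
    have "(\<Sum>(x, y)\<in>S. norm (H y - H x)) \<le> (\<Sum>(x, y)\<in>S. max L 1 * (norm (F y - F x) + norm (G y - G x)))"
      using S by (intro sum_mono) (auto intro!: L)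
    also have "\<dots> = max L 1 * ((\<Sum>(x, y)\<in>S. norm (F y - F x)) + (\<Sum>(x, y)\<in>S. norm (G y - G x)))"
      by (simp add: sum_distrib_left sum.distrib case_prod_beta distrib_left)
    also have "\<dots> < max L 1 * (e + e)"
    proof (intro mult_strict_left_mono add_strict_mono)
      show "(\<Sum>(x, y)\<in>S. norm (F y - F x)) < e"
        by (rule r(2)[THEN spec, THEN mp], rule short_family_mono[OF short]) simp
      show "(\<Sum>(x, y)\<in>S. norm (G y - G x)) < e"
        by (rule s(2)[THEN spec, THEN mp], rule short_family_mono[OF short]) simp
    qed simp
    also have "\<dots> = \<epsilon>" by (simp add: e_def field_simps)
    finally show ?thesis .
  qed
  then show "\<exists>r>0. \<forall>S. short_family c d r S \<longrightarrow> (\<Sum>(x, y)\<in>S. norm (H y - H x)) < \<epsilon>"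
    using r(1) s(1) by (intro exI[of _ "min r s"]) simp
qed

lemma loc_abs_cont_bounded_linear:
  assumes F: "loc_abs_cont F" and h: "bounded_linear h"
  shows "loc_abs_cont (\<lambda>t. h (F t))"
proof (rule loc_abs_cont_dominated[OF F F])
  interpret bounded_linear h by (rule h)
  obtain K where K: "\<And>x. norm (h x) \<le> norm x * K" "K > 0" using pos_bounded by blast
  have "norm (h (F y) - h (F x)) \<le> K * (norm (F y - F x) + norm (F y - F x))" for x y
  proof -
    have "norm (h (F y) - h (F x)) \<le> norm (F y - F x) * K" using K(1)[of "F y - F x"] by (simp add: diff)
    also have "\<dots> \<le> K * (norm (F y - F x) + norm (F y - F x))" using K(2) by (simp add: distrib_left mult.commute)
    finally show ?thesis .
  qed
  then show "\<exists>L. \<forall>x\<in>{c..d}. \<forall>y\<in>{c..d}. norm (h (F y) - h (F x)) \<le> L * (norm (F y - F x) + norm (F y - F x))" for c d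
    by blast
qed

lemma loc_abs_cont_add:
  assumes F: "loc_abs_cont F" and G: "loc_abs_cont G"
  shows "loc_abs_cont (\<lambda>t. F t + G t)"
proof (rule loc_abs_cont_dominated[OF F G])
  have "norm (F y + G y - (F x + G x)) \<le> 1 * (norm (F y - F x) + norm (G y - G x))" for x y
    by (simp add: norm_diff_triangle_ineq)
  then show "\<exists>L. \<forall>x\<in>{c..d}. \<forall>y\<in>{c..d}. norm (F y + G y - (F x + G x)) \<le> L * (norm (F y - F x) + norm (G y - G x))" for c d
    by blast
qed

lemma loc_abs_cont_const: "loc_abs_cont (\<lambda>_. k)"
  unfolding loc_abs_cont_iff by (auto simp: case_prod_beta intro!: exI[of _ 1])

lemma loc_abs_cont_continuous:
  assumes F: "loc_abs_cont F"
  shows "continuous_on UNIV F"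
  unfolding continuous_on_iff
proof (intro ballI allI impI)
  fix x e :: real assume "0 < e"
  then obtain r where r: "r > 0" "\<forall>S. short_family (x - 1) (x + 1) r S \<longrightarrow> (\<Sum>(x, y)\<in>S. norm (F y - F x)) < e"
    using F unfolding loc_abs_cont_iff by blast
  have "dist (F y) (F x) < e" if y: "dist y x < min r 1" for y
  proof -
    have "y - x < r \<and> x - y < r" "y - x < 1 \<and> x - y < 1"
      using y by (simp_all add: dist_real_def abs_less_iff)
    then show ?thesis
      using r(2)[THEN spec, THEN mp, of "{(min x y, max x y)}"]
      by (cases "x \<le> y") (auto simp: short_family_def dist_norm min_def max_def norm_minus_commute)
  qed
  then show "\<exists>d>0. \<forall>x'\<in>UNIV. dist x' x < d \<longrightarrow> dist (F x') (F x) < e"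
    using r(1) by (intro exI[of _ "min r 1"]) auto
qed

lemma continuous_bounded_Icc:
  fixes f :: "real \<Rightarrow> 'a::real_normed_vector"
  assumes "continuous_on UNIV f"
  shows "\<exists>K>0. \<forall>x\<in>{c..d}. norm (f x) \<le> K"
proof -
  have "bounded (f ` {c..d})"
    by (intro compact_imp_bounded compact_continuous_image continuous_on_subset[OF assms]) auto
  then show ?thesis unfolding bounded_pos by blast
qed

text \<open>The increment of the product telescopes into one increment of each factor, and both
  factors are bounded on \<open>{c..d}\<close> by continuity.\<close>

lemma loc_abs_cont_bilinear:
  assumes F: "loc_abs_cont F" and G: "loc_abs_cont G" and "bounded_bilinear pr"
  shows "loc_abs_cont (\<lambda>t. pr (F t) (G t))"
proof (rule loc_abs_cont_dominated[OF F G])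
  fix c d
  interpret bounded_bilinear pr by fact
  obtain K where K: "\<And>a b. norm (pr a b) \<le> norm a * norm b * K" "K > 0" using pos_bounded by blast
  obtain A where A': "A > 0" "\<forall>x\<in>{c..d}. norm (F x) \<le> A"
    using continuous_bounded_Icc[OF loc_abs_cont_continuous[OF F]] by blast
  note A = less_imp_le[OF A'(1)] A'(2)
  obtain B where B': "B > 0" "\<forall>x\<in>{c..d}. norm (G x) \<le> B"
    using continuous_bounded_Icc[OF loc_abs_cont_continuous[OF G]] by blast
  note B = less_imp_le[OF B'(1)] B'(2)
  have "norm (pr (F y) (G y) - pr (F x) (G x)) \<le> (A + B) * K * (norm (F y - F x) + norm (G y - G x))"
    if "x \<in> {c..d}" "y \<in> {c..d}" for x y
  proof -
    have "pr (F y) (G y) - pr (F x) (G x) = pr (F y) (G y - G x) + pr (F y - F x) (G x)"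
      by (simp add: diff_left diff_right)
    also have "norm \<dots> \<le> norm (F y) * norm (G y - G x) * K + norm (F y - F x) * norm (G x) * K"
      by (intro order_trans[OF norm_triangle_ineq] add_mono K)
    also have "\<dots> \<le> A * norm (G y - G x) * K + norm (F y - F x) * B * K"
      using A B that K(2) by (intro add_mono mult_right_mono mult_left_mono) auto
    also have "\<dots> \<le> (A + B) * K * (norm (F y - F x) + norm (G y - G x))"
      using A(1) B(1) K(2) by (simp add: algebra_simps)
    finally show ?thesis .
  qed
  then show "\<exists>L. \<forall>x\<in>{c..d}. \<forall>y\<in>{c..d}. norm (pr (F y) (G y) - pr (F x) (G x)) \<le> L * (norm (F y - F x) + norm (G y - G x))"
    by blast
qed

text \<open>On \<open>{c..d}\<close> the function \<open>F\<close> stays in a compact interval, and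
  there \<Phi> is Lipschitz because its derivative is bounded.\<close>

lemma loc_abs_cont_compose:
  fixes F :: "real \<Rightarrow> real" and \<Phi> :: "real \<Rightarrow> real"
  assumes F: "loc_abs_cont F" and der: "\<And>x. (\<Phi> has_real_derivative \<Phi>' x) (at x)" and cont: "continuous_on UNIV \<Phi>'"
  shows "loc_abs_cont (\<lambda>t. \<Phi> (F t))"
proof (rule loc_abs_cont_dominated[OF F F])
  fix c d
  obtain A where A': "A > 0" "\<forall>x\<in>{c..d}. norm (F x) \<le> A"
    using continuous_bounded_Icc[OF loc_abs_cont_continuous[OF F]] by blast
  note A = less_imp_le[OF A'(1)] A'(2)
  obtain K where K: "K > 0" "\<forall>x\<in>{-A..A}. norm (\<Phi>' x) \<le> K"
    using continuous_bounded_Icc[OF cont] by blast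
  have "norm (\<Phi> (F y) - \<Phi> (F x)) \<le> K * (norm (F y - F x) + norm (F y - F x))" if "x \<in> {c..d}" "y \<in> {c..d}" for x y
  proof -
    have "norm (\<Phi> (F y) - \<Phi> (F x)) \<le> K * norm (F y - F x)"
    proof (rule field_differentiable_bound[of "{-A..A}" \<Phi> \<Phi>'])
      show "norm (\<Phi>' z) \<le> K" if "z \<in> {-A..A}" for z using K(2) that by blast
      show "F y \<in> {-A..A}" "F x \<in> {-A..A}"
        using bspec[OF A(2) that(1)] bspec[OF A(2) that(2)] by (simp_all add: abs_le_iff)
    qed (auto intro: DERIV_subset[OF der])
    then show ?thesis using K(1) by (simp add: distrib_left add_increasing)
  qed
  then show "\<exists>L. \<forall>x\<in>{c..d}. \<forall>y\<in>{c..d}. norm (\<Phi> (F y) - \<Phi> (F x)) \<le> L * (norm (F y - F x) + norm (F y - F x))"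
    by blast
qed

lemma loc_abs_cont_indef_integral:
  fixes F :: "real \<Rightarrow> 'a::euclidean_space"
  assumes F: "loc_abs_cont F"
  shows "\<exists>f. indef_integral F f"
proof -
  have "\<exists>g. indef_integral (\<lambda>t. F t \<bullet> b) g" for b
    by (rule loc_abs_cont_indef_integral_real[OF loc_abs_cont_bounded_linear[OF F bounded_linear_inner_left]])
  then have "\<forall>b. \<exists>g. indef_integral (\<lambda>t. F t \<bullet> b) g" ..
  from choice[OF this] obtain g where g: "\<forall>b. indef_integral (\<lambda>t. F t \<bullet> b) (g b)" ..
  define f where "f t = (\<Sum>b\<in>Basis. g b t *\<^sub>R b)" for t
  have fb: "(\<lambda>t. f t \<bullet> b) = g b" if "b \<in> Basis" for b
    unfolding f_def using inner_sum_left_Basis[OF that] by (intro ext)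
  have "indef_integral F f"
    unfolding indef_integral_def
  proof (intro allI impI conjI)
    fix x y :: real assume xy: "x \<le> y"
    note gb = indef_integralD[OF g[THEN spec] xy]
    show "f absolutely_integrable_on {x..y}"
      by (rule absolutely_integrable_componentwise) (use gb(1) fb in simp)
    have "(f has_integral (F y - F x)) {x..y}"
    proof (rule has_integral_componentwise_iff[THEN iffD2], rule ballI)
      fix b :: 'a assume b: "b \<in> Basis"
      have "(g b has_integral integral {x..y} (g b)) {x..y}"
        using gb(1) by (intro integrable_integral set_lebesgue_integral_eq_integral(1))
      then show "((\<lambda>t. f t \<bullet> b) has_integral (F y - F x) \<bullet> b) {x..y}"
        using gb(2)[of b] fb[OF b] by (simp add: inner_diff_left)
    qed
    then show "F y - F x = integral {x..y} f" by (rule integral_unique[symmetric])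
  qed
  then show ?thesis by blast
qed

text \<open>How product and chain rules are used later: local absolute continuity provides some
  density, and the classical derivative computed a.e. identifies it.\<close>

lemma indef_integral_loc_abs_contI:
  assumes F: "loc_abs_cont F" and f: "AE t in lebesgue. (F has_vector_derivative f t) (at t)"
  shows "indef_integral F f"
proof -
  obtain g where g: "indef_integral F g" using loc_abs_cont_indef_integral[OF F] ..
  have "AE t in lebesgue. g t = f t"
    using indef_integral_AE_deriv[OF g] f by eventually_elim (rule vector_derivative_unique_at)
  with g show ?thesis by (rule indef_integral_cong_AE)
qed

text \<open>Split the norm of \<open>f\<close> at a height n. The part below contributes at most n
  times the total length, and the integral of the excess tends to 0 by dominated
  convergence.\<close>

lemma indef_integral_loc_abs_cont:
  assumes F: "indef_integral F f"
  shows "loc_abs_cont F"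
  unfolding loc_abs_cont_iff
proof (intro allI impI)
  fix c d \<epsilon> :: real assume \<epsilon>: "\<epsilon> > 0"
  define h where "h t = indicator {c..d} t * norm (f t)" for t
  have "set_integrable lebesgue {c..d} f"
    using indef_integralD(1)[OF F, of c d] by (cases "c \<le> d") (auto simp: set_integrable_def)
  from integrable_norm[OF this[unfolded set_integrable_def]]
  have h: "integrable lebesgue h" by (simp add: h_def[abs_def])
  have nn: "h t \<ge> 0" for t by (simp add: h_def)
  define k where "k n t = h t - min (h t) (real n)" for n t
  have k_meas: "k n \<in> borel_measurable lebesgue" for n
    using h unfolding k_def[abs_def] by measurable
  have k_int: "integrable lebesgue (k n)" for n
    by (rule Bochner_Integration.integrable_bound[OF h k_meas]) (use nn in \<open>auto simp: k_def min_def\<close>)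
  have "(\<lambda>n. LINT t|lebesgue. k n t) \<longlonglongrightarrow> (LINT t|(lebesgue :: real measure). (0 :: real))"
  proof (rule Bochner_Integration.integral_dominated_convergence[where w = h])
    show "AE t in lebesgue. (\<lambda>n. k n t) \<longlonglongrightarrow> 0"
    proof (rule AE_I2)
      fix t
      obtain N where "h t < real N" using reals_Archimedean2 by blast
      then have "h t \<le> real n" if "n \<ge> N" for n
        using that by (metis less_imp_le of_nat_mono order_trans)
      then have "k n t = 0" if "n \<ge> N" for n using that by (simp add: k_def min_def)
      then show "(\<lambda>n. k n t) \<longlonglongrightarrow> 0"
        by (intro tendsto_eventually) (auto simp: eventually_sequentially)
    qed
    show "AE t in lebesgue. norm (k n t) \<le> h t" for n
      using nn by (auto simp: k_def min_def)
  qed (use h k_meas in auto)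
  then have "(\<lambda>n. LINT t|lebesgue. k n t) \<longlonglongrightarrow> 0" by simp
  from order_tendstoD(2)[OF this, of "\<epsilon> / 2"] \<epsilon>
  obtain n where n: "(LINT t|lebesgue. k n t) < \<epsilon> / 2"
    by (auto simp: eventually_sequentially)
  \<comment> \<open>Chosen so that n times \<open>r\<close> is at most \<epsilon>/2; the added 1
    covers n = 0.\<close>
  define r where "r = \<epsilon> / (2 * (real n + 1))"
  have r: "r > 0" using \<epsilon> by (simp add: r_def add_nonneg_pos)
  have "(\<Sum>(x, y)\<in>S. norm (F y - F x)) < \<epsilon>"
    if short: "short_family c d r S" for S
  proof -
    have S: "finite S" "\<forall>(x, y)\<in>S. c \<le> x \<and> x \<le> y \<and> y \<le> d"
        "pairwise (\<lambda>(x, y) (u, v). {x<..<y} \<inter> {u<..<v} = {}) S" "(\<Sum>(x, y)\<in>S. y - x) < r"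
      using short unfolding short_family_def by blast+
    have no: "nonoverlapping S fst snd"
      unfolding nonoverlapping_def disjoint_family_on_def
    proof (intro conjI ballI impI)
      show "fst p \<le> snd p" if "p \<in> S" for p
        using S(2) that by auto
      show "{fst p<..<snd p} \<inter> {fst q<..<snd q} = {}" if "p \<in> S" "q \<in> S" "p \<noteq> q" for p q
        using pairwiseD[OF S(3) that] by (simp add: case_prod_beta)
    qed (rule S(1))
    have est: "norm (F y - F x) \<le> real n * (y - x) + integral {x..y} (k n)" if "(x, y) \<in> S" for x y
    proof -
      have xy: "c \<le> x" "x \<le> y" "y \<le> d" using S(2) that by auto
      note f = indef_integralD[OF F xy(2)]
      have kxy: "k n integrable_on {x..y}"
        unfolding set_integrable_def
        by (intro set_lebesgue_integral_eq_integral(1)) (simp only: set_integrable_def, intro integrable_mult_indicator k_int, simp)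
      have "norm (F y - F x) = norm (integral {x..y} f)" using f(2) by simp
      also have "\<dots> \<le> integral {x..y} (\<lambda>t. real n + k n t)"
      proof (rule Henstock_Kurzweil_Integration.integral_norm_bound_integral)
        show "f integrable_on {x..y}" using f(1) by (rule set_lebesgue_integral_eq_integral(1))
        show "(\<lambda>t. real n + k n t) integrable_on {x..y}" using kxy by (intro integrable_add) auto
        show "norm (f t) \<le> real n + k n t" if "t \<in> {x..y}" for t
          using that xy by (auto simp: k_def h_def min_def)
      qed
      also have "\<dots> = real n * (y - x) + integral {x..y} (k n)"
        using kxy xy by (subst Henstock_Kurzweil_Integration.integral_add) auto
      finally show ?thesis .
    qed
    have "(\<Sum>(x, y)\<in>S. norm (F y - F x)) \<le> (\<Sum>(x, y)\<in>S. real n * (y - x) + integral {x..y} (k n))"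
      by (intro sum_mono) (use est in auto)
    also have "\<dots> = real n * (\<Sum>(x, y)\<in>S. y - x) + (\<Sum>p\<in>S. integral {fst p..snd p} (k n))"
      by (simp add: sum.distrib sum_distrib_left case_prod_beta)
    also have "(\<Sum>p\<in>S. integral {fst p..snd p} (k n)) \<le> (LINT t|lebesgue. k n t)"
      by (rule nonoverlapping_sum_integral_le[OF no k_int]) (simp add: k_def)
    also have "real n * (\<Sum>(x, y)\<in>S. y - x) \<le> real n * r"
      using S(4) by (intro mult_left_mono) auto
    also have "real n * r \<le> \<epsilon> / 2"
      using \<epsilon> by (simp add: r_def field_simps)
    finally show ?thesis using n by simp
  qed
  then show "\<exists>r>0. \<forall>S. short_family c d r S \<longrightarrow> (\<Sum>(x, y)\<in>S. norm (F y - F x)) < \<epsilon>"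
    using r by blast
qed

subsection \<open>Smooth functions\<close>

definition smooth :: "(real \<Rightarrow> real) \<Rightarrow> bool" where
  "smooth f \<longleftrightarrow> (\<forall>k t. ((deriv ^^ k) f) differentiable (at t))"

lemma test_function_iff: "test_function \<phi> \<longleftrightarrow> smooth \<phi> \<and> compactly_supported \<phi>"
  by (simp add: test_function_def smooth_def)

lemma smooth_has_deriv:
  assumes "smooth f"
  shows "(f has_real_derivative deriv f t) (at t)"
proof -
  have "((deriv ^^ 0) f) differentiable (at t)" using assms unfolding smooth_def by blast
  then show ?thesis by (simp add: DERIV_deriv_iff_real_differentiable)
qed

lemma smooth_deriv:
  assumes "smooth f"
  shows "smooth (deriv f)"
proof -
  have "((deriv ^^ Suc k) f) differentiable (at t)" for k t using assms unfolding smooth_def by blast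
  then show ?thesis by (simp add: smooth_def funpow_swap1)
qed

text \<open>A set of functions closed under differentiation contains smooth functions only. This
  replaces formulas for higher derivatives by the choice of a suitable invariant set.\<close>

lemma smooth_coinduct:
  assumes "f \<in> X" and step: "\<And>g. g \<in> X \<Longrightarrow> \<exists>g'\<in>X. \<forall>t. (g has_real_derivative g' t) (at t)"
  shows "smooth f"
proof -
  have "\<forall>g\<in>X. \<forall>t. ((deriv ^^ k) g) differentiable (at t)" for k
  proof (induction k)
    case 0
    then show ?case using step by (fastforce simp: real_differentiable_def)
  next
    case (Suc k)
    show ?case
    proof (intro ballI allI)
      fix g t assume "g \<in> X"
      then obtain g' where g': "g' \<in> X" "\<forall>t. (g has_real_derivative g' t) (at t)" using step by blast
      then have "deriv g = g'" by (intro ext DERIV_imp_deriv) blast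
      then show "((deriv ^^ Suc k) g) differentiable (at t)"
        using Suc.IH g'(1) by (simp add: funpow_swap1)
    qed
  qed
  then show ?thesis using assms(1) by (simp add: smooth_def)
qed

lemma smooth_cmult:
  assumes "smooth f" shows "smooth (\<lambda>t. c * f t)"
proof (rule smooth_coinduct)
  show "(\<lambda>t. c * f t) \<in> {(\<lambda>t. c * f t) | f. smooth f}" using assms by blast
next
  fix g assume "g \<in> {(\<lambda>t. c * f t) | f. smooth f}"
  then obtain f where f: "smooth f" "g = (\<lambda>t. c * f t)" by blast
  then show "\<exists>g'\<in>{(\<lambda>t. c * f t) | f. smooth f}. \<forall>t. (g has_real_derivative g' t) (at t)"
    using smooth_deriv[OF f(1)]
    by (intro bexI[of _ "\<lambda>t. c * deriv f t"]) (auto intro!: DERIV_cmult smooth_has_deriv)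
qed

lemma smooth_add:
  assumes "smooth f" "smooth g" shows "smooth (\<lambda>t. f t + g t)"
proof (rule smooth_coinduct)
  show "(\<lambda>t. f t + g t) \<in> {(\<lambda>t. f t + g t) | f g. smooth f \<and> smooth g}" using assms by blast
next
  fix h assume "h \<in> {(\<lambda>t. f t + g t) | f g. smooth f \<and> smooth g}"
  then obtain f g where f: "smooth f" "smooth g" "h = (\<lambda>t. f t + g t)" by blast
  then show "\<exists>h'\<in>{(\<lambda>t. f t + g t) | f g. smooth f \<and> smooth g}. \<forall>t. (h has_real_derivative h' t) (at t)"
    using smooth_deriv[OF f(1)] smooth_deriv[OF f(2)]
    by (intro bexI[of _ "\<lambda>t. deriv f t + deriv g t"]) (auto intro!: DERIV_add smooth_has_deriv)
qed

text \<open>By the Leibniz rule products alone are not closed under differentiation, but their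
  finite sums are.\<close>

inductive_set smooth_products :: "(real \<Rightarrow> real) set" where
  prod: "smooth f \<Longrightarrow> smooth g \<Longrightarrow> (\<lambda>t. f t * g t) \<in> smooth_products"
| add: "f \<in> smooth_products \<Longrightarrow> g \<in> smooth_products \<Longrightarrow> (\<lambda>t. f t + g t) \<in> smooth_products"

lemma smooth_mult:
  assumes "smooth f" "smooth g" shows "smooth (\<lambda>t. f t * g t)"
proof (rule smooth_coinduct[where X = smooth_products])
  show "(\<lambda>t. f t * g t) \<in> smooth_products" using assms by (rule smooth_products.prod)
next
  fix h assume "h \<in> smooth_products"
  then show "\<exists>h'\<in>smooth_products. \<forall>t. (h has_real_derivative h' t) (at t)"
  proof induction
    case (prod f g)
    have "(\<lambda>t. deriv f t * g t + deriv g t * f t) \<in> smooth_products"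
      using prod by (intro smooth_products.intros smooth_deriv)
    moreover have "\<forall>t. ((\<lambda>t. f t * g t) has_real_derivative deriv f t * g t + deriv g t * f t) (at t)"
      using prod by (intro allI DERIV_mult smooth_has_deriv)
    ultimately show ?case by (intro bexI[of _ "\<lambda>t. deriv f t * g t + deriv g t * f t"])
  next
    case (add f g)
    then obtain f' g' where "f' \<in> smooth_products" "g' \<in> smooth_products"
      "\<forall>t. (f has_real_derivative f' t) (at t)" "\<forall>t. (g has_real_derivative g' t) (at t)" by blast
    then show ?case
      by (intro bexI[of _ "\<lambda>t. f' t + g' t"] allI DERIV_add smooth_products.add) auto
  qed
qed

lemma smooth_affine:
  assumes "smooth f" shows "smooth (\<lambda>t. f (a * t + b))"
proof (rule smooth_coinduct)
  show "(\<lambda>t. f (a * t + b)) \<in> {(\<lambda>t. c * f (a * t + b)) | c f. smooth f}"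
    using assms by (auto intro!: exI[of _ 1] exI[of _ f])
next
  fix h assume "h \<in> {(\<lambda>t. c * f (a * t + b)) | c f. smooth f}"
  then obtain c f where f: "smooth f" "h = (\<lambda>t. c * f (a * t + b))" by blast
  have "((\<lambda>t. c * f (a * t + b)) has_real_derivative (c * a) * deriv f (a * t + b)) (at t)" for t
    by (auto intro!: derivative_eq_intros DERIV_chain2[OF smooth_has_deriv[OF f(1)]])
  then show "\<exists>h'\<in>{(\<lambda>t. c * f (a * t + b)) | c f. smooth f}. \<forall>t. (h has_real_derivative h' t) (at t)"
    using smooth_deriv[OF f(1)] f(2) by (intro bexI[of _ "\<lambda>t. (c * a) * deriv f (a * t + b)"]) auto
qed

text \<open>Adding \<open>F\<close> to the set of smooth functions keeps the set closed under
  differentiation.\<close>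

lemma smooth_antideriv:
  assumes "\<And>t. (F has_real_derivative f t) (at t)" "smooth f"
  shows "smooth F"
proof (rule smooth_coinduct)
  show "F \<in> insert F {f. smooth f}" by simp
next
  fix g assume "g \<in> insert F {f. smooth f}"
  then show "\<exists>g'\<in>insert F {f. smooth f}. \<forall>t. (g has_real_derivative g' t) (at t)"
    using assms smooth_deriv smooth_has_deriv by blast
qed

subsection \<open>Bump functions\<close>

text \<open>\<open>flat 0\<close> is the classical function exp(-1/x) extended by 0. The powers of
  1/x are the factors produced by differentiating it, and they make the span of the family closed
  under differentiation.\<close>

definition flat :: "nat \<Rightarrow> real \<Rightarrow> real" where
  "flat k x = (if x > 0 then (1 / x) ^ k * exp (- (1 / x)) else 0)"

lemma flat_at_0: "(flat k \<longlongrightarrow> 0) (at 0)"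
proof -
  have "((\<lambda>y::real. y ^ k / exp y) \<longlongrightarrow> 0) at_top" by (rule tendsto_power_div_exp_0)
  then have "((\<lambda>x. (1 / x) ^ k / exp (1 / x)) \<longlongrightarrow> (0::real)) (at_right 0)"
    by (rule filterlim_compose) (simp add: divide_inverse filterlim_inverse_at_top_right)
  moreover have "\<forall>\<^sub>F x in at_right 0. (1 / x) ^ k / exp (1 / x) = flat k (x::real)"
    unfolding eventually_at_right_field by (intro exI[of _ 1]) (simp add: flat_def exp_minus divide_inverse)
  ultimately have "(flat k \<longlongrightarrow> 0) (at_right 0)" by (rule Lim_transform_eventually)
  moreover have "(flat k \<longlongrightarrow> 0) (at_left 0)"
    by (rule tendsto_eventually) (auto simp: eventually_at_left_field flat_def intro!: exI[of _ "-1"])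
  ultimately show ?thesis by (simp add: filterlim_split_at)
qed

lemma flat_has_deriv: "(flat k has_real_derivative - real k * flat (k + 1) x + flat (k + 2) x) (at x)"
proof -
  consider "x < 0" | "x = 0" | "0 < x" by linarith
  then show ?thesis
  proof cases
    case 1
    have "((\<lambda>_. 0) has_real_derivative 0) (at x)" by simp
    then have "(flat k has_real_derivative 0) (at x)"
      by (rule has_field_derivative_transform_within_open[of _ _ _ "{..<0}"]) (use 1 in \<open>auto simp: flat_def\<close>)
    then show ?thesis using 1 by (simp add: flat_def)
  next
    case 2
    \<comment> \<open>At the origin the difference quotient of \<open>flat k\<close> is
      \<open>flat (k + 1)\<close>, which tends to 0.\<close>
    have "((\<lambda>h. (flat k (0 + h) - flat k 0) / h) \<longlongrightarrow> 0) (at 0)"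
      by (rule Lim_transform_eventually[OF flat_at_0[of "k + 1"]])
        (auto simp: flat_def eventually_at_filter)
    then have "(flat k has_real_derivative 0) (at 0)" unfolding DERIV_def .
    then show ?thesis using 2 by (simp add: flat_def)
  next
    case 3
    have d1: "((\<lambda>x. 1 / x) has_real_derivative - ((1 / x)\<^sup>2)) (at x)"
      using 3 by (auto intro!: derivative_eq_intros simp: power2_eq_square)
    have d2: "((\<lambda>x. exp (- (1 / x))) has_real_derivative exp (- (1 / x)) * (1 / x)\<^sup>2) (at x)"
      using DERIV_fun_exp[OF DERIV_minus[OF d1]] by simp
    have "real k * (- ((1 / x)\<^sup>2) * (1 / x) ^ (k - Suc 0)) = - real k * (1 / x) ^ (k + 1)"
      by (cases k) (simp_all add: power2_eq_square algebra_simps diff_divide_distrib add_divide_distrib)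
    with DERIV_power[OF d1, of k]
    have "((\<lambda>x. (1 / x) ^ k) has_real_derivative - real k * (1 / x) ^ (k + 1)) (at x)"
      by (simp only:)
    from DERIV_mult[OF this d2]
    have "((\<lambda>x. (1 / x) ^ k * exp (- (1 / x))) has_real_derivative
        - real k * ((1 / x) ^ (k + 1) * exp (- (1 / x))) + (1 / x) ^ (k + 2) * exp (- (1 / x))) (at x)"
      by (simp only: power_add mult_ac)
    then have "(flat k has_real_derivative
        - real k * ((1 / x) ^ (k + 1) * exp (- (1 / x))) + (1 / x) ^ (k + 2) * exp (- (1 / x))) (at x)"
      by (rule has_field_derivative_transform_within_open[of _ _ _ "{0<..}"]) (use 3 in \<open>auto simp: flat_def\<close>)
    then show ?thesis using 3 unfolding flat_def by (simp only: if_True)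
  qed
qed

inductive_set flat_span :: "(real \<Rightarrow> real) set" where
  base: "(\<lambda>x. c * flat k x) \<in> flat_span"
| add: "f \<in> flat_span \<Longrightarrow> g \<in> flat_span \<Longrightarrow> (\<lambda>x. f x + g x) \<in> flat_span"

lemma smooth_flat: "smooth (flat 0)"
proof (rule smooth_coinduct[where X = flat_span])
  show "flat 0 \<in> flat_span" using flat_span.base[of 1 0] by simp
next
  fix h assume "h \<in> flat_span"
  then show "\<exists>h'\<in>flat_span. \<forall>t. (h has_real_derivative h' t) (at t)"
  proof induction
    case (base c k)
    have "(\<lambda>x. (c * - real k) * flat (k + 1) x + c * flat (k + 2) x) \<in> flat_span"
      by (intro flat_span.intros)
    moreover have "\<forall>x. ((\<lambda>x. c * flat k x) has_real_derivative (c * - real k) * flat (k + 1) x + c * flat (k + 2) x) (at x)"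
    proof
      fix x
      from DERIV_cmult[OF flat_has_deriv[of k x], of c]
      show "((\<lambda>x. c * flat k x) has_real_derivative (c * - real k) * flat (k + 1) x + c * flat (k + 2) x) (at x)"
        by (simp add: algebra_simps)
    qed
    ultimately show ?case by (intro bexI[of _ "\<lambda>x. (c * - real k) * flat (k + 1) x + c * flat (k + 2) x"])
  next
    case (add f g)
    then obtain f' g' where "f' \<in> flat_span" "g' \<in> flat_span"
      "\<forall>t. (f has_real_derivative f' t) (at t)" "\<forall>t. (g has_real_derivative g' t) (at t)" by blast
    then show ?case
      by (intro bexI[of _ "\<lambda>t. f' t + g' t"] allI DERIV_add flat_span.add) auto
  qed
qed

text \<open>The parameter \<open>n\<close> sharpens the profile: as it grows, the values tend to 1
  inside the interval, while the support stays in \<open>{c..d}\<close>.\<close>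

definition bump :: "real \<Rightarrow> real \<Rightarrow> real \<Rightarrow> real \<Rightarrow> real" where
  "bump n c d t = flat 0 (n * t + (- n * c)) * flat 0 (- n * t + n * d)"

lemma smooth_bump: "smooth (bump n c d)"
  unfolding bump_def by (intro smooth_mult smooth_affine smooth_flat)

lemma bump_nonneg: "0 \<le> bump n c d t"
  and bump_le_1: "bump n c d t \<le> 1"
  by (auto simp: bump_def flat_def mult_le_one)

lemma bump_eq:
  assumes "n > 0"
  shows "bump n c d t = (if c < t \<and> t < d then exp (- (1 / (n * (t - c)))) * exp (- (1 / (n * (d - t)))) else 0)"
proof -
  have "0 < n * t + (- n * c) \<longleftrightarrow> c < t" "0 < - n * t + n * d \<longleftrightarrow> t < d"
    using assms by (auto simp: algebra_simps)
  then show ?thesis by (simp add: bump_def flat_def algebra_simps)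
qed

lemma bump_tendsto_indicator: "(\<lambda>n. bump (real (Suc n)) c d t) \<longlonglongrightarrow> indicator {c<..<d} t"
proof (cases "c < t \<and> t < d")
  case True
  have "(\<lambda>n. 1 / (real (Suc n) * x)) \<longlonglongrightarrow> 0" for x
    using tendsto_mult[OF LIMSEQ_inverse_real_of_nat tendsto_const[of "inverse x"]]
    by (simp add: divide_inverse)
  then have "(\<lambda>n. exp (- (1 / (real (Suc n) * (t - c)))) * exp (- (1 / (real (Suc n) * (d - t))))) \<longlonglongrightarrow> exp (- 0) * exp (- 0)"
    by (intro tendsto_intros)
  then show ?thesis using True by (simp add: bump_eq)
qed (auto simp: bump_eq)

text \<open>No order between \<open>c\<close> and \<open>d\<close> is demanded, so later proofs pass
  to \<open>min c d\<close> and \<open>max c d\<close> when they need points beyond the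
  support.\<close>

lemma compactly_supported_iff: "compactly_supported \<phi> \<longleftrightarrow> (\<exists>c d. \<forall>t. t \<notin> {c..d} \<longrightarrow> \<phi> t = 0)"
proof
  assume "compactly_supported \<phi>"
  then have "bounded {t. \<phi> t \<noteq> 0}"
    unfolding compactly_supported_def by (meson bounded_closure_image bounded_subset closure_subset compact_imp_bounded)
  then obtain B where "\<forall>t\<in>{t. \<phi> t \<noteq> 0}. norm t \<le> B" unfolding bounded_pos by blast
  then have "\<forall>t. t \<notin> {-B..B} \<longrightarrow> \<phi> t = 0" by (auto simp: abs_le_iff)
  then show "\<exists>c d. \<forall>t. t \<notin> {c..d} \<longrightarrow> \<phi> t = 0" by blast
next
  assume "\<exists>c d. \<forall>t. t \<notin> {c..d} \<longrightarrow> \<phi> t = 0"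
  then obtain c d where "{t. \<phi> t \<noteq> 0} \<subseteq> {c..d}" by blast
  then have "bounded {t. \<phi> t \<noteq> 0}" by (rule bounded_subset[rotated]) simp
  then show "compactly_supported \<phi>" by (simp add: compactly_supported_def compact_closure)
qed

lemma test_function_bump: "n > 0 \<Longrightarrow> test_function (bump n c d)"
  unfolding test_function_iff compactly_supported_iff
  by (intro conjI smooth_bump exI[of _ c] exI[of _ d]) (simp add: bump_eq)

lemma smooth_loc_abs_cont:
  assumes "smooth \<phi>"
  shows "loc_abs_cont \<phi>"
proof (rule loc_abs_cont_compose[where F = "\<lambda>t. t" and \<Phi>' = "deriv \<phi>"])
  show "loc_abs_cont (\<lambda>t :: real. t)"
    unfolding loc_abs_cont_iff
  proof (intro allI impI)
    fix c d \<epsilon> :: real assume "\<epsilon> > 0"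
    moreover have "(\<Sum>(x, y)\<in>S. norm (y - x)) < \<epsilon>" if "short_family c d \<epsilon> S" for S
    proof -
      have "(\<Sum>(x, y)\<in>S. norm (y - x)) = (\<Sum>(x, y)\<in>S. y - x)"
        using that by (intro sum.cong) (auto simp: short_family_def)
      then show ?thesis using that by (simp add: short_family_def)
    qed
    ultimately show "\<exists>r>0. \<forall>S. short_family c d r S \<longrightarrow> (\<Sum>(x, y)\<in>S. norm (y - x)) < \<epsilon>" by blast
  qed
  show "continuous_on UNIV (deriv \<phi>)"
    using smooth_has_deriv[OF smooth_deriv[OF assms]] by (intro DERIV_continuous_on) 
qed (rule smooth_has_deriv[OF assms])

lemma smooth_indef_integral:
  assumes "smooth \<phi>"
  shows "indef_integral \<phi> (deriv \<phi>)"
  by (rule indef_integral_loc_abs_contI[OF smooth_loc_abs_cont[OF assms]])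
    (simp add: smooth_has_deriv[OF assms] flip: has_real_derivative_iff_has_vector_derivative)

subsection \<open>Locally integrable functions\<close>

lemma loc_integrableI:
  assumes "\<And>x y. x \<le> y \<Longrightarrow> f absolutely_integrable_on {x..y}"
  shows "loc_integrable f"
  unfolding loc_integrable_def
proof (intro allI)
  fix c d show "f absolutely_integrable_on {c..d}"
    using assms[of c d] by (cases "c \<le> d") (auto simp: set_integrable_def)
qed

lemma loc_integrable_cong_AE:
  assumes "loc_integrable f" "AE t in lebesgue. f t = g t"
  shows "loc_integrable g"
proof -
  obtain N where N: "negligible N" "\<And>t. t \<notin> N \<Longrightarrow> f t = g t"
    using assms(2) unfolding AE_lebesgue_negligible by blast
  show ?thesis
  proof (rule loc_integrableI)
    fix x y
    have "f absolutely_integrable_on {x..y}" using assms(1) unfolding loc_integrable_def by blast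
    then show "g absolutely_integrable_on {x..y}"
      by (rule absolutely_integrable_spike[OF _ N(1)]) (use N(2) in auto)
  qed
qed

lemma loc_integrable_indef_integral:
  "indef_integral F f \<Longrightarrow> loc_integrable f"
  using indef_integralD(1) by (intro loc_integrableI) blast

lemma loc_integrable_continuous:
  assumes "continuous_on UNIV f"
  shows "loc_integrable f"
  by (intro loc_integrableI absolutely_integrable_continuous_real continuous_on_subset[OF assms]) simp

lemma loc_integrable_add:
  "loc_integrable f \<Longrightarrow> loc_integrable g \<Longrightarrow> loc_integrable (\<lambda>t. f t + g t)"
  unfolding loc_integrable_def by (intro allI set_integral_add(1)) blast+

lemma loc_integrable_diff:
  "loc_integrable f \<Longrightarrow> loc_integrable g \<Longrightarrow> loc_integrable (\<lambda>t. f t - g t)"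
  unfolding loc_integrable_def by (intro allI set_integral_diff(1)) blast+

text \<open>The function is the pointwise limit of its truncations to the intervals from -n to n,
  each of which is integrable.\<close>

lemma loc_integrable_measurable:
  assumes "loc_integrable f"
  shows "f \<in> borel_measurable lebesgue"
proof (rule borel_measurable_LIMSEQ_metric)
  fix n :: nat
  have "set_integrable lebesgue {- real n..real n} f" using assms unfolding loc_integrable_def by blast
  then show "(\<lambda>t. indicator {- real n..real n} t *\<^sub>R f t) \<in> borel_measurable lebesgue"
    unfolding set_integrable_def by (rule borel_measurable_integrable)
next
  fix t :: real
  obtain N where N: "\<bar>t\<bar> \<le> real N" using real_arch_simple by blast
  have "indicator {- real n..real n} t *\<^sub>R f t = f t" if "n \<ge> N" for n
  proof -
    have "real N \<le> real n" using that by simp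
    then have "\<bar>t\<bar> \<le> real n" using N by linarith
    then show ?thesis by (simp add: abs_le_iff)
  qed
  then show "(\<lambda>n. indicator {- real n..real n} t *\<^sub>R f t) \<longlonglongrightarrow> f t"
    by (intro tendsto_eventually) (auto simp: eventually_sequentially)
qed

lemma loc_integrable_bilinear:
  fixes h :: "'a::euclidean_space \<Rightarrow> 'b::euclidean_space \<Rightarrow> 'c::euclidean_space"
  assumes h: "bounded_bilinear h" and k: "continuous_on UNIV k" and f: "loc_integrable f"
  shows "loc_integrable (\<lambda>t. h (k t) (f t))"
proof (rule loc_integrableI)
  fix x y :: real
  show "(\<lambda>t. h (k t) (f t)) absolutely_integrable_on {x..y}"
  proof (rule absolutely_integrable_bounded_measurable_product[of h k _ f])
    show "bilinear h" using h by (simp add: bilinear_conv_bounded_bilinear)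
    show "k \<in> borel_measurable (lebesgue_on {x..y})"
      by (intro continuous_imp_measurable_on_sets_lebesgue continuous_on_subset[OF k]) auto
    show "bounded (k ` {x..y})"
      by (intro compact_imp_bounded compact_continuous_image continuous_on_subset[OF k]) auto
    show "f absolutely_integrable_on {x..y}" using f unfolding loc_integrable_def by blast
  qed simp
qed

lemma loc_integrable_support:
  fixes f :: "real \<Rightarrow> 'a::euclidean_space"
  assumes f: "loc_integrable f" and supp: "AE t in lebesgue. t \<notin> {c..d} \<longrightarrow> f t = 0"
  shows "integrable lebesgue f"
proof (rule integrable_cong_AE_imp)
  show "integrable lebesgue (\<lambda>t. indicator {c..d} t *\<^sub>R f t)"
    using f unfolding loc_integrable_def set_integrable_def by blast
  show "AE t in lebesgue. indicator {c..d} t *\<^sub>R f t = f t"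
    using supp by (rule eventually_mono) (auto simp: indicator_def)
qed (rule loc_integrable_measurable[OF f])

lemma LINT_support:
  fixes f :: "real \<Rightarrow> 'a::euclidean_space"
  assumes f: "integrable lebesgue f" and supp: "AE t in lebesgue. t \<notin> {c..d} \<longrightarrow> f t = 0"
  shows "(LINT t|lebesgue. f t) = integral {c..d} f"
proof -
  have si: "set_integrable lebesgue {c..d} f"
    unfolding set_integrable_def using f by (intro integrable_mult_indicator) auto
  have "(LINT t|lebesgue. f t) = (LINT t|lebesgue. indicator {c..d} t *\<^sub>R f t)"
    using f si supp unfolding set_integrable_def
    by (intro integral_cong_AE) (auto elim!: eventually_mono simp: indicator_def)
  also have "\<dots> = integral {c..d} f"
    using set_lebesgue_integral_eq_integral(2)[OF si] by (simp add: set_lebesgue_integral_def)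
  finally show ?thesis .
qed

lemma borel_measurable_continuous_lebesgue:
  fixes f :: "real \<Rightarrow> 'a::euclidean_space"
  assumes "continuous_on UNIV f"
  shows "f \<in> borel_measurable lebesgue"
  by (rule loc_integrable_measurable[OF loc_integrable_continuous[OF assms]])

lemma test_function_support:
  assumes "test_function \<phi>"
  obtains c d where "\<forall>t. t \<notin> {c..d} \<longrightarrow> \<phi> t = 0"
  using assms unfolding test_function_iff compactly_supported_iff by blast

lemma test_function_integrable:
  assumes g: "loc_integrable g" and \<phi>: "test_function \<phi>"
  shows "integrable lebesgue (\<lambda>t. \<phi> t *\<^sub>R g t)"
proof -
  obtain c d where supp: "\<forall>t. t \<notin> {c..d} \<longrightarrow> \<phi> t = 0" by (rule test_function_support[OF \<phi>])
  have "continuous_on UNIV \<phi>"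
    using \<phi> by (intro loc_abs_cont_continuous smooth_loc_abs_cont) (simp add: test_function_iff)
  from loc_integrable_bilinear[OF bounded_bilinear_scaleR this g] show ?thesis
    by (rule loc_integrable_support[of _ c d]) (use supp in simp)
qed

lemma test_function_deriv:
  assumes \<phi>: "test_function \<phi>"
  shows "test_function (deriv \<phi>)"
proof -
  obtain c d where cd: "\<forall>t. t \<notin> {c..d} \<longrightarrow> \<phi> t = 0" by (rule test_function_support[OF \<phi>])
  have "deriv \<phi> t = 0" if "t \<notin> {c..d}" for t
  proof (rule DERIV_imp_deriv)
    have "((\<lambda>_. 0) has_real_derivative 0) (at t)" by simp
    then show "(\<phi> has_real_derivative 0) (at t)"
      by (rule has_field_derivative_transform_within_open[of _ _ _ "- {c..d}"]) (use that cd in auto)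
  qed
  then show ?thesis
    using \<phi> smooth_deriv unfolding test_function_iff compactly_supported_iff by blast
qed

text \<open>The product of \<Phi> and \<open>F\<close> is an indefinite integral that vanishes at
  both ends. \<Phi> need not be smooth, so the rule serves test functions and compactly supported
  \<open>H1_loc\<close> directions alike.\<close>

lemma indef_integral_by_parts:
  fixes F :: "real \<Rightarrow> 'a::euclidean_space"
  assumes \<Phi>: "indef_integral \<Phi> \<psi>" and supp: "\<And>t. t \<notin> {c..d} \<Longrightarrow> \<Phi> t = 0" and F: "indef_integral F f"
  shows "integrable lebesgue (\<lambda>t. \<psi> t *\<^sub>R F t)" "integrable lebesgue (\<lambda>t. \<Phi> t *\<^sub>R f t)"
    "(LINT t|lebesgue. \<psi> t *\<^sub>R F t) = - (LINT t|lebesgue. \<Phi> t *\<^sub>R f t)"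
    "AE t in lebesgue. t \<notin> {c..d} \<longrightarrow> \<psi> t = 0"
proof -
  show psi0: "AE t in lebesgue. t \<notin> {c..d} \<longrightarrow> \<psi> t = 0"
    using indef_integral_AE_deriv[OF \<Phi>]
  proof eventually_elim
    case (elim t)
    show ?case
    proof
      assume t: "t \<notin> {c..d}"
      have "((\<lambda>_. 0) has_vector_derivative 0) (at t)" by simp
      then have "(\<Phi> has_vector_derivative 0) (at t)"
        by (rule has_vector_derivative_transform_within_open[of _ _ _ "- {c..d}"]) (use t supp in auto)
      with elim show "\<psi> t = 0" by (rule vector_derivative_unique_at)
    qed
  qed
  have contF: "continuous_on UNIV F" and cont\<Phi>: "continuous_on UNIV \<Phi>"
    using \<Phi> F by (auto intro: indef_integral_continuous)
  show i2: "integrable lebesgue (\<lambda>t. \<Phi> t *\<^sub>R f t)"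
    by (rule loc_integrable_support[OF loc_integrable_bilinear[OF bounded_bilinear_scaleR cont\<Phi>
          loc_integrable_indef_integral[OF F]], of c d]) (use supp in simp)
  show i1: "integrable lebesgue (\<lambda>t. \<psi> t *\<^sub>R F t)"
    by (rule loc_integrable_support[OF loc_integrable_bilinear[OF bounded_bilinear.flip[OF bounded_bilinear_scaleR]
          contF loc_integrable_indef_integral[OF \<Phi>]], of c d]) (use psi0 in \<open>auto elim: eventually_mono\<close>)
  have "indef_integral (\<lambda>t. \<Phi> t *\<^sub>R F t) (\<lambda>t. \<Phi> t *\<^sub>R f t + \<psi> t *\<^sub>R F t)"
  proof (rule indef_integral_loc_abs_contI)
    show "loc_abs_cont (\<lambda>t. \<Phi> t *\<^sub>R F t)"
      by (rule loc_abs_cont_bilinear[OF indef_integral_loc_abs_cont[OF \<Phi>] indef_integral_loc_abs_cont[OF F] bounded_bilinear_scaleR])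
    show "AE t in lebesgue. ((\<lambda>t. \<Phi> t *\<^sub>R F t) has_vector_derivative \<Phi> t *\<^sub>R f t + \<psi> t *\<^sub>R F t) (at t)"
      using indef_integral_AE_deriv[OF \<Phi>] indef_integral_AE_deriv[OF F]
      by eventually_elim (auto intro!: has_vector_derivative_scaleR simp: has_real_derivative_iff_has_vector_derivative)
  qed
  \<comment> \<open>The interval is enlarged by 1 on each side so that its endpoints lie strictly
    outside \<open>{c..d}\<close>, where \<Phi> vanishes.\<close>
  note I = indef_integralD(2)[OF this, of "min c d - 1" "max c d + 1"]
  have "(LINT t|lebesgue. \<Phi> t *\<^sub>R f t + \<psi> t *\<^sub>R F t) = integral {min c d - 1..max c d + 1} (\<lambda>t. \<Phi> t *\<^sub>R f t + \<psi> t *\<^sub>R F t)"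
  proof (rule LINT_support)
    show "AE t in lebesgue. t \<notin> {min c d - 1..max c d + 1} \<longrightarrow> \<Phi> t *\<^sub>R f t + \<psi> t *\<^sub>R F t = 0"
      using psi0
    proof eventually_elim
      case (elim t)
      show ?case
      proof
        assume "t \<notin> {min c d - 1..max c d + 1}"
        then have "t \<notin> {c..d}" by auto
        then show "\<Phi> t *\<^sub>R f t + \<psi> t *\<^sub>R F t = 0" using elim supp by simp
      qed
    qed
  qed (use i1 i2 in simp)
  also have "\<dots> = 0"
  proof -
    have "\<Phi> (min c d - 1) = 0" "\<Phi> (max c d + 1) = 0" by (auto intro!: supp)
    then show ?thesis using I by simp
  qed
  finally show "(LINT t|lebesgue. \<psi> t *\<^sub>R F t) = - (LINT t|lebesgue. \<Phi> t *\<^sub>R f t)"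
    using i1 i2 by (simp add: eq_neg_iff_add_eq_0 add.commute)
qed

subsection \<open>Weak derivatives\<close>

text \<open>Bumps converge boundedly to the indicator of an open interval, so \<open>g\<close> has
  integral 0 over every interval.\<close>

lemma fundamental_lemma:
  fixes g :: "real \<Rightarrow> 'a::euclidean_space"
  assumes g: "loc_integrable g" and zero: "\<And>\<phi>. test_function \<phi> \<Longrightarrow> (LINT t|lebesgue. \<phi> t *\<^sub>R g t) = 0"
  shows "AE t in lebesgue. g t = 0"
proof -
  have "integral {c..d} g = 0" if "c \<le> d" for c d
  proof -
    have si: "set_integrable lebesgue {c..d} g" using g unfolding loc_integrable_def by blast
    have "(\<lambda>n. LINT t|lebesgue. bump (real (Suc n)) c d t *\<^sub>R g t) \<longlonglongrightarrow> (LINT t|lebesgue. indicator {c<..<d} t *\<^sub>R g t)"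
    proof (rule Bochner_Integration.integral_dominated_convergence[where w = "\<lambda>t. norm (indicator {c..d} t *\<^sub>R g t)"])
      show "integrable lebesgue (\<lambda>t. norm (indicator {c..d} t *\<^sub>R g t))"
        using si unfolding set_integrable_def by (rule integrable_norm)
      show "(\<lambda>t. indicator {c<..<d} t *\<^sub>R g t) \<in> borel_measurable lebesgue"
        by (intro borel_measurable_scaleR borel_measurable_indicator loc_integrable_measurable[OF g]) simp
      show "(\<lambda>t. bump (real (Suc n)) c d t *\<^sub>R g t) \<in> borel_measurable lebesgue" for n
        by (rule borel_measurable_integrable[OF test_function_integrable[OF g test_function_bump]]) simp
      show "AE t in lebesgue. (\<lambda>n. bump (real (Suc n)) c d t *\<^sub>R g t) \<longlonglongrightarrow> indicator {c<..<d} t *\<^sub>R g t"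
        by (intro AE_I2 tendsto_scaleR tendsto_const bump_tendsto_indicator)
      show "AE t in lebesgue. norm (bump (real (Suc n)) c d t *\<^sub>R g t) \<le> norm (indicator {c..d} t *\<^sub>R g t)" for n
      proof (rule AE_I2)
        fix t
        have "\<bar>bump (real (Suc n)) c d t\<bar> \<le> indicator {c..d} t"
          using bump_nonneg[of "real (Suc n)" c d t] bump_le_1[of "real (Suc n)" c d t]
          by (cases "t \<in> {c..d}") (auto simp: bump_eq)
        then show "norm (bump (real (Suc n)) c d t *\<^sub>R g t) \<le> norm (indicator {c..d} t *\<^sub>R g t)"
          by (simp add: mult_right_mono)
      qed
    qed
    moreover have "(LINT t|lebesgue. bump (real (Suc n)) c d t *\<^sub>R g t) = 0" for n
      by (intro zero test_function_bump) simp
    ultimately have "(LINT t|lebesgue. indicator {c<..<d} t *\<^sub>R g t) = 0"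
      by (simp add: LIMSEQ_const_iff)
    moreover have "set_integrable lebesgue {c<..<d} g" by (rule set_integrable_subset[OF si]) auto
    ultimately have "integral {c<..<d} g = 0"
      using set_lebesgue_integral_eq_integral(2) by (metis set_lebesgue_integral_def)
    then show ?thesis by (simp add: integral_open_interval_real)
  qed
  \<comment> \<open>Now \<open>g\<close> and 0 are two densities of the same constant function, so
    they agree a.e.\<close>
  then have "indef_integral (\<lambda>_. 0) g"
    using g unfolding indef_integral_def loc_integrable_def by simp
  moreover have "indef_integral (\<lambda>_ :: real. 0 :: 'a) (\<lambda>_. 0)"
    unfolding indef_integral_def by simp
  ultimately show ?thesis by (rule indef_integral_unique)
qed

lemma indef_integral_exists:
  assumes "loc_integrable f"
  shows "\<exists>F. indef_integral F f"
proof -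
  define F where "F t = (if 0 \<le> t then integral {0..t} f else - integral {t..0} f)" for t
  have int: "f integrable_on {x..y}" for x y
    using assms unfolding loc_integrable_def by (blast intro: set_lebesgue_integral_eq_integral(1))
  have "F y - F x = integral {x..y} f" if "x \<le> y" for x y
  proof -
    consider "0 \<le> x" | "x < 0" "0 \<le> y" | "y < 0" by linarith
    then show ?thesis
    proof cases
      case 1
      then show ?thesis using Henstock_Kurzweil_Integration.integral_combine[OF 1 that int] that
        by (simp add: F_def algebra_simps)
    next
      case 2
      then show ?thesis using Henstock_Kurzweil_Integration.integral_combine[of x 0 y f] int
        by (simp add: F_def algebra_simps)
    next
      case 3
      then show ?thesis using Henstock_Kurzweil_Integration.integral_combine[of x y 0 f] int that
        by (simp add: F_def algebra_simps)
    qed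
  qed
  then have "indef_integral F f"
    using assms unfolding indef_integral_def loc_integrable_def by blast
  then show ?thesis by blast
qed

text \<open>The primitive that vanishes to the left of the support also vanishes to the right of it,
  since its value there is the full integral.\<close>

lemma test_function_antiderivative:
  assumes \<zeta>: "test_function \<zeta>" and zero: "(LINT t|lebesgue. \<zeta> t) = 0"
  shows "\<exists>\<phi>. test_function \<phi> \<and> deriv \<phi> = \<zeta>"
proof -
  obtain c d where supp: "\<forall>t. t \<notin> {c..d} \<longrightarrow> \<zeta> t = 0" by (rule test_function_support[OF \<zeta>])
  have sm: "smooth \<zeta>" using \<zeta> by (simp add: test_function_iff)
  have cont: "continuous_on UNIV \<zeta>" by (rule loc_abs_cont_continuous[OF smooth_loc_abs_cont[OF sm]])
  obtain \<phi>0 where \<phi>0: "indef_integral \<phi>0 \<zeta>" using indef_integral_exists[OF loc_integrable_continuous[OF cont]] ..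
  \<comment> \<open>The subtracted value is taken at a point left of the support, so \<phi> vanishes
    there.\<close>
  define \<phi> where "\<phi> t = \<phi>0 t - \<phi>0 (min c d - 1)" for t
  have int: "integral {x..y} \<zeta> = \<phi> y - \<phi> x" if "x \<le> y" for x y
    using indef_integralD(2)[OF \<phi>0 that] by (simp add: \<phi>_def)
  have der: "(\<phi> has_real_derivative \<zeta> t) (at t)" for t
  proof -
    have "((\<lambda>u. integral {t - 1..u} \<zeta>) has_real_derivative \<zeta> t) (at t within {t - 1..t + 1})"
      by (rule integral_has_real_derivative[OF continuous_on_subset[OF cont]]) auto
    then have "((\<lambda>u. integral {t - 1..u} \<zeta>) has_real_derivative \<zeta> t) (at t)"
      by (simp add: at_within_Icc_at)
    then have "((\<lambda>u. \<phi> u - \<phi> (t - 1)) has_real_derivative \<zeta> t) (at t)"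
      by (rule has_field_derivative_transform_within_open[of _ _ _ "{t - 1<..}"]) (auto simp: int)
    from DERIV_add[OF this DERIV_const[of "\<phi> (t - 1)"]] show ?thesis by simp
  qed
  have supp': "\<zeta> t = 0" if "t < min c d \<or> max c d < t" for t
    using supp that by auto
  have "\<phi> t = 0" if t: "t \<notin> {min c d - 1..max c d + 1}" for t
  proof (cases "t < min c d - 1")
    case True
    have "integral {t..min c d - 1} \<zeta> = integral {t..min c d - 1} (\<lambda>_. 0)"
      by (intro integral_cong supp') auto
    then show ?thesis using int[of t "min c d - 1"] True by (simp add: \<phi>_def)
  next
    case False
    have "integrable lebesgue \<zeta>"
      using test_function_integrable[OF loc_integrable_continuous[OF continuous_on_const[of _ "1 :: real"]] \<zeta>] by simp
    then have "(LINT t|lebesgue. \<zeta> t) = integral {min c d - 1..t} \<zeta>"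
      by (rule LINT_support) (use t False in \<open>auto intro!: AE_I2 supp'\<close>)
    then show ?thesis using int[of "min c d - 1" t] False zero by (simp add: \<phi>_def)
  qed
  then have "compactly_supported \<phi>" unfolding compactly_supported_iff by blast
  moreover have "smooth \<phi>" by (rule smooth_antideriv[OF der sm])
  moreover have "deriv \<phi> = \<zeta>" using der by (intro ext DERIV_imp_deriv)
  ultimately show ?thesis unfolding test_function_iff by blast
qed

text \<open>A test function minus the right multiple of a fixed bump \<open>b\<close> has mean zero,
  hence is the derivative of a test function. Thus \<open>u\<close> minus a constant is orthogonal
  to every test function.\<close>

lemma du_Bois_Reymond:
  fixes u :: "real \<Rightarrow> 'a::euclidean_space"
  assumes u: "loc_integrable u" and zero: "\<And>\<phi>. test_function \<phi> \<Longrightarrow> (LINT t|lebesgue. deriv \<phi> t *\<^sub>R u t) = 0"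
  shows "\<exists>k. AE t in lebesgue. u t = k"
proof -
  have one: "loc_integrable (\<lambda>_ :: real. 1 :: real)" by (rule loc_integrable_continuous) simp
  have const: "loc_integrable (\<lambda>_ :: real. k)" for k :: 'a by (rule loc_integrable_continuous) simp
  define b where "b = bump 1 0 1"
  have b: "test_function b" unfolding b_def by (rule test_function_bump) simp
  have int1: "integrable lebesgue \<psi>" if "test_function \<psi>" for \<psi>
    using test_function_integrable[OF one that] by simp
  \<comment> \<open>\<open>b\<close> is nonnegative and strictly positive on the unit interval,
    which is not a null set.\<close>
  have I: "(LINT t|lebesgue. b t) \<noteq> 0"
  proof
    assume "(LINT t|lebesgue. b t) = 0"
    then have "AE t in lebesgue. b t = 0"
      using integral_nonneg_eq_0_iff_AE[OF int1[OF b]] by (simp add: b_def bump_nonneg)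
    then have "AE t in lebesgue. t \<notin> {0<..<1::real}"
      by (elim eventually_mono) (auto simp: b_def bump_eq split: if_splits)
    then have "{0<..<1::real} \<in> null_sets lebesgue"
      by (subst (asm) AE_iff_null_sets[symmetric]) auto
    then show False by (simp add: null_sets_def)
  qed
  \<comment> \<open>The mean of \<open>u\<close> with weight \<open>b\<close>, the only candidate
    for the constant.\<close>
  define k where "k = (1 / (LINT t|lebesgue. b t)) *\<^sub>R (LINT t|lebesgue. b t *\<^sub>R u t)"
  have "AE t in lebesgue. u t - k = 0"
  proof (rule fundamental_lemma)
    show "loc_integrable (\<lambda>t. u t - k)" by (intro loc_integrable_diff u const)
    fix \<psi> assume \<psi>: "test_function \<psi>"
    \<comment> \<open>The multiple of \<open>b\<close> that has the same integral as \<psi>.\<close>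
    define K where "K = (LINT t|lebesgue. \<psi> t) / (LINT t|lebesgue. b t)"
    obtain c d where cd: "\<forall>t. t \<notin> {c..d} \<longrightarrow> \<psi> t = 0" by (rule test_function_support[OF \<psi>])
    obtain c' d' where cd': "\<forall>t. t \<notin> {c'..d'} \<longrightarrow> b t = 0" by (rule test_function_support[OF b])
    have "\<psi> t + - K * b t = 0" if "t \<notin> {min c c'..max d d'}" for t
    proof -
      have "t \<notin> {c..d}" "t \<notin> {c'..d'}" using that by auto
      then show ?thesis using cd cd' by simp
    qed
    then have "compactly_supported (\<lambda>t. \<psi> t + - K * b t)"
      unfolding compactly_supported_iff by blast
    moreover have "smooth (\<lambda>t. \<psi> t + - K * b t)"
      using \<psi> b unfolding test_function_iff by (intro smooth_add smooth_cmult) blast+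
    ultimately have "test_function (\<lambda>t. \<psi> t + - K * b t)"
      unfolding test_function_iff by blast
    moreover have "(LINT t|lebesgue. \<psi> t + - K * b t) = 0"
      using int1[OF \<psi>] int1[OF b] I by (simp add: K_def)
    ultimately obtain \<phi> where \<phi>: "test_function \<phi>" "deriv \<phi> = (\<lambda>t. \<psi> t + - K * b t)"
      using test_function_antiderivative by blast
    note iu = test_function_integrable[OF u \<psi>] test_function_integrable[OF u b] test_function_integrable[OF const \<psi>]
    have "(LINT t|lebesgue. (\<psi> t + - K * b t) *\<^sub>R u t) = (LINT t|lebesgue. \<psi> t *\<^sub>R u t) - K *\<^sub>R (LINT t|lebesgue. b t *\<^sub>R u t)"
      using iu by (simp add: scaleR_left_distrib scaleR_left_diff_distrib flip: scaleR_scaleR)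
    then have "(LINT t|lebesgue. \<psi> t *\<^sub>R u t) = K *\<^sub>R (LINT t|lebesgue. b t *\<^sub>R u t)"
      using zero[OF \<phi>(1)] \<phi>(2) by simp
    also have "\<dots> = (LINT t|lebesgue. \<psi> t) *\<^sub>R k" by (simp add: K_def k_def)
    finally show "(LINT t|lebesgue. \<psi> t *\<^sub>R (u t - k)) = 0"
      using iu by (simp add: scaleR_diff_right int1[OF \<psi>])
  qed
  then have "AE t in lebesgue. u t = k" by simp
  then show ?thesis by blast
qed

text \<open>If \<open>f\<close> has weak derivative \<open>g\<close>, then \<open>f\<close> minus an
  indefinite integral of \<open>g\<close> has weak derivative 0 and is constant a.e.; the constant
  is absorbed into the indefinite integral. The converse is integration by parts.\<close>

lemma has_weak_deriv_iff:
  fixes f :: "real \<Rightarrow> 'a::euclidean_space"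
  shows "has_weak_deriv f g \<longleftrightarrow> (\<exists>F. indef_integral F g \<and> (AE t in lebesgue. f t = F t))"
proof
  have parts: "(LINT t|lebesgue. deriv \<phi> t *\<^sub>R F t) = - (LINT t|lebesgue. \<phi> t *\<^sub>R g t)"
    "integrable lebesgue (\<lambda>t. deriv \<phi> t *\<^sub>R F t)"
    if F: "indef_integral F g" and \<phi>: "test_function \<phi>" for F :: "real \<Rightarrow> 'a" and \<phi>
  proof -
    obtain c d where "\<forall>t. t \<notin> {c..d} \<longrightarrow> \<phi> t = 0" by (rule test_function_support[OF \<phi>])
    moreover have "indef_integral \<phi> (deriv \<phi>)"
      using \<phi> by (intro smooth_indef_integral) (simp add: test_function_iff)
    ultimately show "(LINT t|lebesgue. deriv \<phi> t *\<^sub>R F t) = - (LINT t|lebesgue. \<phi> t *\<^sub>R g t)"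
      "integrable lebesgue (\<lambda>t. deriv \<phi> t *\<^sub>R F t)"
      using indef_integral_by_parts[of \<phi> "deriv \<phi>" c d F g] F by blast+
  qed
  show "\<exists>F. indef_integral F g \<and> (AE t in lebesgue. f t = F t)" if "has_weak_deriv f g"
  proof -
    have f: "loc_integrable f" and g: "loc_integrable g"
      and eq: "\<And>\<phi>. test_function \<phi> \<Longrightarrow> (LINT t|lebesgue. deriv \<phi> t *\<^sub>R f t) = - (LINT t|lebesgue. \<phi> t *\<^sub>R g t)"
      using that unfolding has_weak_deriv_def by blast+
    obtain F where F: "indef_integral F g" using indef_integral_exists[OF g] ..
    have lF: "loc_integrable F" by (rule loc_integrable_continuous[OF indef_integral_continuous[OF F]])
    have "\<exists>k. AE t in lebesgue. f t - F t = k"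
    proof (rule du_Bois_Reymond[OF loc_integrable_diff[OF f lF]])
      fix \<phi> assume \<phi>: "test_function \<phi>"
      from test_function_integrable[OF f test_function_deriv[OF \<phi>]]
      show "(LINT t|lebesgue. deriv \<phi> t *\<^sub>R (f t - F t)) = 0"
        using eq[OF \<phi>] parts[OF F \<phi>] by (simp add: scaleR_diff_right)
    qed
    then obtain k where "AE t in lebesgue. f t - F t = k" ..
    then have "AE t in lebesgue. f t = F t + k" by (elim eventually_mono) (simp add: algebra_simps)
    moreover have "indef_integral (\<lambda>t. F t + k) g" using F unfolding indef_integral_def by simp
    ultimately show ?thesis by (intro exI[of _ "\<lambda>t. F t + k"] conjI)
  qed
  show "has_weak_deriv f g" if ex: "\<exists>F. indef_integral F g \<and> (AE t in lebesgue. f t = F t)"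
  proof -
    obtain F where F: "indef_integral F g" and fF: "AE t in lebesgue. f t = F t" using ex by blast
    have lF: "loc_integrable F" by (rule loc_integrable_continuous[OF indef_integral_continuous[OF F]])
    have f: "loc_integrable f"
      by (rule loc_integrable_cong_AE[OF lF]) (use fF in \<open>auto elim: eventually_mono\<close>)
    have "(LINT t|lebesgue. deriv \<phi> t *\<^sub>R f t) = - (LINT t|lebesgue. \<phi> t *\<^sub>R g t)" if \<phi>: "test_function \<phi>" for \<phi>
    proof -
      have m: "deriv \<phi> \<in> borel_measurable lebesgue"
        using \<phi> by (intro loc_integrable_measurable[OF loc_integrable_indef_integral[OF smooth_indef_integral]]) (simp add: test_function_iff)
      have "(LINT t|lebesgue. deriv \<phi> t *\<^sub>R f t) = (LINT t|lebesgue. deriv \<phi> t *\<^sub>R F t)"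
        using fF by (intro integral_cong_AE borel_measurable_scaleR m loc_integrable_measurable f lF) (auto elim: eventually_mono)
      then show ?thesis using parts(1)[OF F \<phi>] by simp
    qed
    then show ?thesis
      using f loc_integrable_indef_integral[OF F] unfolding has_weak_deriv_def by blast
  qed
qed

text \<open>The set where the functions differ is open, and a nonempty open set is not negligible.
  This promotes a.e. identities to every point.\<close>

lemma continuous_AE_eq:
  fixes F G :: "real \<Rightarrow> 'a::euclidean_space"
  assumes F: "continuous_on UNIV F" and G: "continuous_on UNIV G" and eq: "AE t in lebesgue. F t = G t"
  shows "F = G"
proof (rule ccontr)
  assume "F \<noteq> G"
  then have "{t. F t \<noteq> G t} \<noteq> {}" by auto
  moreover have "open {t. F t \<noteq> G t}" by (rule open_Collect_neq[OF F G])
  moreover have "negligible {t. F t \<noteq> G t}"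
    using eq unfolding AE_lebesgue_negligible by (blast intro: negligible_subset)
  ultimately show False using open_not_negligible by blast
qed

lemma has_weak_deriv_unique:
  fixes f :: "real \<Rightarrow> 'a::euclidean_space"
  assumes "has_weak_deriv f g" "has_weak_deriv f h"
  shows "AE t in lebesgue. g t = h t"
proof -
  obtain F G where F: "indef_integral F g" "AE t in lebesgue. f t = F t"
    and G: "indef_integral G h" "AE t in lebesgue. f t = G t"
    using assms unfolding has_weak_deriv_iff by blast
  have "AE t in lebesgue. F t = G t" using F(2) G(2) by eventually_elim simp
  then have "F = G"
    by (rule continuous_AE_eq[OF indef_integral_continuous[OF F(1)] indef_integral_continuous[OF G(1)]])
  then show ?thesis using indef_integral_unique F(1) G(1) by blast
qed

lemma has_weak_deriv_wderiv:
  assumes "has_weak_deriv f g"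
  shows "has_weak_deriv f (wderiv f)"
  unfolding wderiv_def by (rule someI[of "has_weak_deriv f", OF assms])

lemma wderiv_AE:
  fixes f :: "real \<Rightarrow> 'a::euclidean_space"
  assumes "has_weak_deriv f g"
  shows "AE t in lebesgue. wderiv f t = g t"
  by (rule has_weak_deriv_unique[OF has_weak_deriv_wderiv[OF assms] assms])

subsection \<open>Two by two matrices\<close>

definition mat2 :: "complex \<Rightarrow> complex \<Rightarrow> complex \<Rightarrow> complex \<Rightarrow> cmat2" where
  "mat2 a b c d = vector [vector [a, b], vector [c, d]]"

lemma mat2_nth [simp]:
  "mat2 a b c d $ 1 $ 1 = a" "mat2 a b c d $ 1 $ 2 = b" "mat2 a b c d $ 2 $ 1 = c" "mat2 a b c d $ 2 $ 2 = d"
  by (simp_all add: mat2_def)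

lemma cmat2_eq_iff: "A = (B :: cmat2) \<longleftrightarrow> A $ 1 $ 1 = B $ 1 $ 1 \<and> A $ 1 $ 2 = B $ 1 $ 2 \<and> A $ 2 $ 1 = B $ 2 $ 1 \<and> A $ 2 $ 2 = B $ 2 $ 2"
  by (auto simp: vec_eq_iff forall_2)

lemma mat2_cases: obtains a b c d where "A = mat2 a b c d"
proof
  show "A = mat2 (A $ 1 $ 1) (A $ 1 $ 2) (A $ 2 $ 1) (A $ 2 $ 2)" by (simp add: cmat2_eq_iff)
qed

lemma mat2_eq_iff [simp]: "mat2 a b c d = mat2 a' b' c' d' \<longleftrightarrow> a = a' \<and> b = b' \<and> c = c' \<and> d = d'"
  by (simp add: cmat2_eq_iff)

lemma mat2_mult: "mat2 a b c d ** mat2 a' b' c' d' = mat2 (a * a' + b * c') (a * b' + b * d') (c * a' + d * c') (c * b' + d * d')"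
  by (simp add: cmat2_eq_iff matrix_matrix_mult_def sum_2)

lemma mat2_add: "mat2 a b c d + mat2 a' b' c' d' = mat2 (a + a') (b + b') (c + c') (d + d')"
  by (simp add: cmat2_eq_iff)

lemma mat2_diff: "mat2 a b c d - mat2 a' b' c' d' = mat2 (a - a') (b - b') (c - c') (d - d')"
  by (simp add: cmat2_eq_iff)

lemma mat2_scaleR: "r *\<^sub>R mat2 a b c d = mat2 (of_real r * a) (of_real r * b) (of_real r * c) (of_real r * d)"
proof -
  have "r *\<^sub>R z = of_real r * z" for z :: complex by (rule scaleR_conv_of_real)
  then show ?thesis by (simp add: cmat2_eq_iff)
qed

lemma mat2_mat: "mat z = mat2 z 0 0 z"
  by (simp add: cmat2_eq_iff mat_def)

lemma mat2_J: "Jmat = mat2 1 0 0 (-1)" and mat2_B: "Bmat = mat2 0 1 1 0"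
  by (simp_all add: Jmat_def Bmat_def mat2_def)

lemma mat2_cadj: "cadj (mat2 a b c d) = mat2 (cnj a) (cnj c) (cnj b) (cnj d)"
  by (simp add: cmat2_eq_iff cadj_def)

lemma mat2_trace: "trace (mat2 a b c d) = a + d"
  by (simp add: trace_def sum_2)

lemmas mat2_simps = mat2_mult mat2_add mat2_diff mat2_scaleR mat2_mat mat2_J mat2_B mat2_cadj mat2_trace

lemma hs_norm_sq_mat2: "hs_norm_sq (mat2 a b c d) = (cmod a)\<^sup>2 + (cmod b)\<^sup>2 + (cmod c)\<^sup>2 + (cmod d)\<^sup>2"
  unfolding cmod_power2 by (simp add: hs_norm_sq_def mat2_simps power2_eq_square)

lemma complex_scaleR_of_real: "r *\<^sub>R (z :: complex) = of_real r * z"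
  by (rule scaleR_conv_of_real)

lemma bounded_linear_mat2:
  "bounded_linear (\<lambda>z. mat2 z 0 0 0)" "bounded_linear (\<lambda>z. mat2 0 z 0 0)"
  "bounded_linear (\<lambda>z. mat2 0 0 z 0)" "bounded_linear (\<lambda>z. mat2 0 0 0 z)"
  unfolding linear_conv_bounded_linear[symmetric]
  by (auto intro!: linearI simp: mat2_add mat2_scaleR complex_scaleR_of_real)

lemma bounded_linear_mat2_nth: "bounded_linear (\<lambda>A :: cmat2. A $ i $ j)"
  by (rule bounded_linear_compose[OF bounded_linear_vec_nth bounded_linear_vec_nth])

lemma mat2_split: "mat2 a b c d = mat2 a 0 0 0 + mat2 0 b 0 0 + mat2 0 0 c 0 + mat2 0 0 0 d"
  by (simp add: mat2_add)

lemma loc_abs_cont_mat2: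
  assumes "loc_abs_cont a" "loc_abs_cont b" "loc_abs_cont c" "loc_abs_cont d"
  shows "loc_abs_cont (\<lambda>t. mat2 (a t) (b t) (c t) (d t))"
proof -
  have "(\<lambda>t. mat2 (a t) (b t) (c t) (d t)) =
      (\<lambda>t. mat2 (a t) 0 0 0 + mat2 0 (b t) 0 0 + mat2 0 0 (c t) 0 + mat2 0 0 0 (d t))"
    by (rule ext) (rule mat2_split)
  then show ?thesis
    using loc_abs_cont_add[OF loc_abs_cont_add[OF loc_abs_cont_add[OF
        loc_abs_cont_bounded_linear[OF assms(1) bounded_linear_mat2(1)]
        loc_abs_cont_bounded_linear[OF assms(2) bounded_linear_mat2(2)]]
        loc_abs_cont_bounded_linear[OF assms(3) bounded_linear_mat2(3)]]
        loc_abs_cont_bounded_linear[OF assms(4) bounded_linear_mat2(4)]] by simp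
qed

lemma has_vector_derivative_mat2:
  assumes "(a has_vector_derivative a') F" "(b has_vector_derivative b') F"
    "(c has_vector_derivative c') F" "(d has_vector_derivative d') F"
  shows "((\<lambda>t. mat2 (a t) (b t) (c t) (d t)) has_vector_derivative mat2 a' b' c' d') F"
proof -
  have "(\<lambda>t. mat2 (a t) (b t) (c t) (d t)) =
      (\<lambda>t. mat2 (a t) 0 0 0 + mat2 0 (b t) 0 0 + mat2 0 0 (c t) 0 + mat2 0 0 0 (d t))"
    by (rule ext) (rule mat2_split)
  moreover have "mat2 a' b' c' d' = mat2 a' 0 0 0 + mat2 0 b' 0 0 + mat2 0 0 c' 0 + mat2 0 0 0 d'"
    by (rule mat2_split)
  ultimately show ?thesis
    using has_vector_derivative_add[OF has_vector_derivative_add[OF has_vector_derivative_add[OF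
        bounded_linear.has_vector_derivative[OF bounded_linear_mat2(1) assms(1)]
        bounded_linear.has_vector_derivative[OF bounded_linear_mat2(2) assms(2)]]
        bounded_linear.has_vector_derivative[OF bounded_linear_mat2(3) assms(3)]]
        bounded_linear.has_vector_derivative[OF bounded_linear_mat2(4) assms(4)]] by simp
qed

subsection \<open>Hyperbolic rotations\<close>

text \<open>The closed form of e^(xB): since B squares to the identity, even powers sum to cosh and
  odd powers to sinh.\<close>

definition hrot :: "real \<Rightarrow> cmat2" where
  "hrot x = mat2 (of_real (cosh x)) (of_real (sinh x)) (of_real (sinh x)) (of_real (cosh x))"

lemma hrot_eq: "hrot x = cosh x *\<^sub>R mat 1 + sinh x *\<^sub>R Bmat"
  by (simp add: hrot_def mat2_simps)

lemma mexp_Bmat: "mexp (x *\<^sub>R Bmat) = hrot x"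
proof -
  have pow: "(((**) (x *\<^sub>R Bmat) ^^ k) (mat 1)) = (if even k then x ^ k *\<^sub>R mat 1 else x ^ k *\<^sub>R Bmat)" for k
    by (induction k) (auto simp: mat2_simps)
  have "(\<lambda>k. (if even k then x ^ k /\<^sub>R fact k else 0) *\<^sub>R (mat 1 :: cmat2) + (if even k then 0 else x ^ k /\<^sub>R fact k) *\<^sub>R Bmat)
      sums (cosh x *\<^sub>R mat 1 + sinh x *\<^sub>R Bmat)"
    by (intro sums_add sums_scaleR_left cosh_converges sinh_converges)
  also have "(\<lambda>k. (if even k then x ^ k /\<^sub>R fact k else 0) *\<^sub>R (mat 1 :: cmat2) + (if even k then 0 else x ^ k /\<^sub>R fact k) *\<^sub>R Bmat)
      = (\<lambda>k. (1 / fact k) *\<^sub>R (((**) (x *\<^sub>R Bmat) ^^ k) (mat 1)))"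
    unfolding pow by (auto simp: fun_eq_iff divide_inverse)
  finally show ?thesis unfolding mexp_def hrot_eq by (rule sums_unique[symmetric])
qed

lemma hrot_mult: "hrot x ** hrot y = hrot (x + y)"
  by (simp add: hrot_def mat2_simps cosh_add sinh_add algebra_simps)

lemma hrot_0: "hrot 0 = mat 1"
  by (simp add: hrot_def mat2_simps)

lemma hrot_cancel: "hrot x ** (hrot (- x) ** A) = A" "hrot (- x) ** (hrot x ** A) = A"
  by (simp_all add: matrix_mul_assoc hrot_mult hrot_0)

lemma matrix_inv_eqI:
  fixes A :: cmat2
  assumes "A ** B = mat 1" "B ** A = mat 1"
  shows "matrix_inv A = B"
proof -
  have "A ** matrix_inv A = mat 1 \<and> matrix_inv A ** A = mat 1"
    unfolding matrix_inv_def by (rule someI[of _ B]) (use assms in simp)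
  then have "matrix_inv A ** A = mat 1" ..
  then show ?thesis by (metis assms(1) matrix_mul_assoc matrix_mul_lid matrix_mul_rid)
qed

lemma Ham_eq: "Ham a t = hrot (- 2 * a t)"
  unfolding Ham_def by (rule mexp_Bmat)

lemma matrix_inv_Ham: "matrix_inv (Ham a t) = hrot (2 * a t)"
  unfolding Ham_eq by (rule matrix_inv_eqI) (simp_all add: hrot_mult hrot_0)

section \<open>The positive square root of a hyperbolic rotation\<close>

lemma abs_sinh_less_cosh: "\<bar>sinh x\<bar> < cosh (x :: real)"
proof -
  have "(sinh x)\<^sup>2 < (cosh x)\<^sup>2" using cosh_square_eq[of x] by simp
  then show ?thesis by (intro power2_less_imp_less[of "\<bar>sinh x\<bar>"]) (simp_all add: cosh_real_nonneg)
qed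

lemma quadratic_form_mat2:
  "Re (\<Sum>i\<in>UNIV. cnj (x $ i) * (mat2 a b c d *v x) $ i)
    = Re (cnj (x $ 1) * (a * x $ 1 + b * x $ 2) + cnj (x $ 2) * (c * x $ 1 + d * x $ 2))"
  by (simp add: sum_2 matrix_vector_mult_def)

lemma positive_definite_hrot: "positive_definite (hrot x)"
  unfolding positive_definite_def
proof (intro conjI allI impI)
  show "cadj (hrot x) = hrot x" by (simp add: hrot_def mat2_cadj)
  fix z :: "complex ^ 2" assume "z \<noteq> 0"
  then have z: "0 < (cmod (z $ 1))\<^sup>2 + (cmod (z $ 2))\<^sup>2"
    by (auto simp: vec_eq_iff forall_2 sum_power2_gt_zero_iff)
  define R where "R = Re (z $ 1) * Re (z $ 2) + Im (z $ 1) * Im (z $ 2)"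
  have "Re (\<Sum>i\<in>UNIV. cnj (z $ i) * (hrot x *v z) $ i)
      = cosh x * ((cmod (z $ 1))\<^sup>2 + (cmod (z $ 2))\<^sup>2) + sinh x * (2 * R)"
    unfolding hrot_def quadratic_form_mat2 R_def cmod_power2 by (simp add: power2_eq_square algebra_simps)
  moreover have "\<bar>sinh x * (2 * R)\<bar> < cosh x * ((cmod (z $ 1))\<^sup>2 + (cmod (z $ 2))\<^sup>2)"
  proof -
    have "0 \<le> (Re (z $ 1) - Re (z $ 2))\<^sup>2 + (Im (z $ 1) - Im (z $ 2))\<^sup>2"
      "0 \<le> (Re (z $ 1) + Re (z $ 2))\<^sup>2 + (Im (z $ 1) + Im (z $ 2))\<^sup>2" by simp_all
    then have "\<bar>2 * R\<bar> \<le> (cmod (z $ 1))\<^sup>2 + (cmod (z $ 2))\<^sup>2"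
      unfolding R_def cmod_power2 by (simp add: power2_eq_square abs_le_iff algebra_simps)
    then have "\<bar>sinh x\<bar> * \<bar>2 * R\<bar> \<le> \<bar>sinh x\<bar> * ((cmod (z $ 1))\<^sup>2 + (cmod (z $ 2))\<^sup>2)"
      by (rule mult_left_mono) simp
    also have "\<dots> < cosh x * ((cmod (z $ 1))\<^sup>2 + (cmod (z $ 2))\<^sup>2)"
      by (rule mult_strict_right_mono[OF abs_sinh_less_cosh z])
    finally show ?thesis by (simp only: abs_mult)
  qed
  ultimately show "0 < Re (\<Sum>i\<in>UNIV. cnj (z $ i) * (hrot x *v z) $ i)" by linarith
qed

text \<open>Comparing entries of the square makes the diagonal of \<open>R\<close> constant and its
  off-diagonal entry real. Then (1, 1) and (1, -1) are eigenvectors, and positivity selects the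
  correct root of each eigenvalue.\<close>

lemma positive_definite_sqrt_hrot:
  assumes R: "positive_definite R" and sq: "R ** R = hrot (2 * x)"
  shows "R = hrot x"
proof -
  obtain a b c d where abcd: "R = mat2 a b c d" by (rule mat2_cases)
  have herm: "cnj a = a" "c = cnj b" "cnj d = d"
    using R unfolding positive_definite_def abcd mat2_cadj mat2_eq_iff by auto
  have pos: "0 < Re (cnj u * (a * u + b * v) + cnj v * (c * u + d * v))" if "u \<noteq> 0 \<or> v \<noteq> 0" for u v
  proof -
    have "(vector [u, v] :: complex ^ 2) \<noteq> 0" using that by (auto simp: vec_eq_iff forall_2)
    then have "0 < Re (\<Sum>i\<in>UNIV. cnj ((vector [u, v] :: complex ^ 2) $ i) * (mat2 a b c d *v vector [u, v]) $ i)"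
      using R unfolding positive_definite_def abcd by blast
    then show ?thesis unfolding quadratic_form_mat2 by simp
  qed
  obtain r s where r: "a = of_real r" and s: "d = of_real s"
    using herm(1,3) by (metis Reals_cnj_iff Reals_cases)
  have "r > 0" using pos[of 1 0] r by simp
  have "s > 0" using pos[of 0 1] s by simp
  have e: "a * a + b * cnj b = of_real (cosh (2 * x))" "a * b + b * d = of_real (sinh (2 * x))"
    "cnj b * b + d * d = of_real (cosh (2 * x))"
    using sq unfolding abcd herm(2) mat2_mult hrot_def mat2_eq_iff by auto
  have "a * a + b * cnj b = d * d + b * cnj b"
    unfolding e(1) using e(3) by (simp add: mult.commute add.commute)
  then have "a * a = d * d" by simp
  then have "of_real (r * r) = (of_real (s * s) :: complex)" using r s by simp
  then have "r * r = s * s" by (simp only: of_real_eq_iff)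
  then have rs: "s = r" using \<open>r > 0\<close> \<open>s > 0\<close> by (simp add: square_eq_iff) 
  have "b = of_real (sinh (2 * x) / (2 * r))"
    using e(2) r s rs \<open>r > 0\<close> by (simp add: field_simps)
  then obtain \<beta> where b: "b = of_real \<beta>" "2 * r * \<beta> = sinh (2 * x)"
    using \<open>r > 0\<close> by (intro that[of "sinh (2 * x) / (2 * r)"]) auto
  have "of_real (r * r + \<beta> * \<beta>) = (of_real (cosh (2 * x)) :: complex)"
    using e(1) r b by simp
  then have sum: "r * r + \<beta> * \<beta> = cosh (2 * x)" by (simp only: of_real_eq_iff)
  \<comment> \<open>Positive definiteness tested on the eigenvectors (1, 1) and (1, -1).\<close>
  have "r + \<beta> > 0" "r - \<beta> > 0"
    using pos[of 1 1] pos[of 1 "-1"] r s rs b herm(2) by simp_all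
  have "(r + \<beta>)\<^sup>2 = (cosh x + sinh x)\<^sup>2"
    using sum b(2) cosh_double[of x] sinh_double[of x] by (simp add: power2_eq_square algebra_simps)
  moreover have "(r - \<beta>)\<^sup>2 = (cosh x - sinh x)\<^sup>2"
    using sum b(2) cosh_double[of x] sinh_double[of x] by (simp add: power2_eq_square algebra_simps)
  moreover have "cosh x + sinh x > 0" "cosh x - sinh x > 0" using abs_sinh_less_cosh[of x] by linarith+
  ultimately have "r + \<beta> = cosh x + sinh x" "r - \<beta> = cosh x - sinh x"
    using \<open>r + \<beta> > 0\<close> \<open>r - \<beta> > 0\<close> by (metis less_imp_le power2_eq_imp_eq)+
  then have "r = cosh x" "\<beta> = sinh x" by linarith+
  then show ?thesis unfolding abcd herm(2) r s rs b hrot_def by simp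
qed

lemma inv_sqrt_Ham: "inv_sqrt (Ham a t) = hrot (a t)"
  unfolding inv_sqrt_def matrix_inv_Ham
proof (rule the_equality)
  show "positive_definite (hrot (a t)) \<and> hrot (a t) ** hrot (a t) = hrot (2 * a t)"
    by (simp add: positive_definite_hrot hrot_mult)
qed (use positive_definite_sqrt_hrot in blast)

lemma phase_gauge_0: "phase_gauge a (\<lambda>_. 0) (\<lambda>_. 0) t = hrot (a t)"
proof -
  have "mexp (mat (\<i> * of_real 0) ** Jmat) = mexp (0 *\<^sub>R Bmat)" by (simp add: mat2_simps)
  also have "\<dots> = mat 1" unfolding mexp_Bmat by (rule hrot_0)
  finally show ?thesis by (simp add: phase_gauge_def mexp_Bmat)
qed

subsection \<open>Gauges\<close>

text \<open>The gauge e^(aB) e^(i\<alpha>) e^(i\<delta>J) is the case of phases \<alpha> + \<delta>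
  and \<alpha> - \<delta> for \<open>u\<close> and \<open>v\<close>. Keeping two independent
  unimodular entries allows each to be lifted separately.\<close>

definition twist :: "real \<Rightarrow> complex \<Rightarrow> complex \<Rightarrow> cmat2" where
  "twist x u v = hrot x ** mat2 u 0 0 v"

lemma twist_eq: "twist x u v = mat2 (of_real (cosh x) * u) (of_real (sinh x) * v) (of_real (sinh x) * u) (of_real (cosh x) * v)"
  by (simp add: twist_def hrot_def mat2_simps)

lemma cosh_sinh_complex: "complex_of_real (cosh x) * of_real (cosh x) = 1 + of_real (sinh x) * of_real (sinh x)"
  using cosh_square_eq[of x] by (metis add.commute of_real_1 of_real_add of_real_mult power2_eq_square)

lemma cmod_eq_1_cnj: "cmod u = 1 \<Longrightarrow> u * cnj u = 1" "cmod u = 1 \<Longrightarrow> cnj u * u = 1"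
  using complex_norm_square[of u] by (simp_all add: mult.commute)

lemma J_unitary_twist:
  assumes "cmod u = 1" "cmod v = 1"
  shows "J_unitary (twist x u v)"
proof -
  have "cnj u * u = 1" "cnj v * v = 1" using assms by (simp_all only: cmod_eq_1_cnj)
  then show ?thesis
    unfolding J_unitary_def twist_eq mat2_simps mat2_eq_iff complex_cnj_mult complex_cnj_complex_of_real
    using cosh_sinh_complex[of x] by (intro conjI; (algebra | simp))
qed

lemma J_unitary_inverse:
  assumes "J_unitary \<Theta>"
  shows "matrix_inv \<Theta> = Jmat ** cadj \<Theta> ** Jmat"
proof (rule matrix_inv_eqI)
  have "Jmat ** Jmat = mat 1" by (simp add: mat2_simps)
  then show 1: "Jmat ** cadj \<Theta> ** Jmat ** \<Theta> = mat 1"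
    using assms unfolding J_unitary_def by (metis matrix_mul_assoc)
  show "\<Theta> ** (Jmat ** cadj \<Theta> ** Jmat) = mat 1"
    using 1 by (simp add: matrix_left_right_inverse)
qed

text \<open>The inverse is J times the adjoint of \<Theta> times J, so the product on the left is
  \<Theta> ** cadj \<Theta> conjugated by J; and conjugation by J reverses the sign of the argument
  of \<open>hrot\<close>.\<close>

lemma gauge_condition_iff:
  assumes "J_unitary \<Theta>"
  shows "hrot (- 2 * x) = cadj (matrix_inv \<Theta>) ** matrix_inv \<Theta> \<longleftrightarrow> \<Theta> ** cadj \<Theta> = hrot (2 * x)"
proof -
  obtain a b c d where abcd: "\<Theta> = mat2 a b c d" by (rule mat2_cases)
  show ?thesis
    unfolding J_unitary_inverse[OF assms] unfolding abcd hrot_def mat2_simps by (auto simp: algebra_simps minus_equation_iff)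
qed

lemma gauge_condition_twist:
  assumes "cmod u = 1" "cmod v = 1"
  shows "hrot (- 2 * x) = cadj (matrix_inv (twist x u v)) ** matrix_inv (twist x u v)"
proof -
  have "u * cnj u = 1" "v * cnj v = 1" using assms by (simp_all only: cmod_eq_1_cnj)
  moreover have "twist x u v ** cadj (twist x u v) = hrot x ** mat2 (u * cnj u) 0 0 (v * cnj v) ** hrot x"
    unfolding twist_def hrot_def mat2_simps by (simp add: mult_ac)
  ultimately have "twist x u v ** cadj (twist x u v) = hrot x ** mat 1 ** hrot x" by (simp add: mat2_mat)
  then have "twist x u v ** cadj (twist x u v) = hrot (2 * x)" by (simp add: hrot_mult)
  then show ?thesis using gauge_condition_iff[OF J_unitary_twist[OF assms]] by blast
qed

text \<open>The matrix e^(-xB) \<Theta> is both J-unitary and unitary, which forces it to be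
  diagonal. The explicit formulas for \<open>u\<close> and \<open>v\<close> are recorded so that
  they inherit the regularity of \<Theta>.\<close>

lemma gauge_is_twist:
  assumes J: "J_unitary \<Theta>" and H: "\<Theta> ** cadj \<Theta> = hrot (2 * x)"
  shows "\<exists>u v. cmod u = 1 \<and> cmod v = 1 \<and> \<Theta> = twist x u v \<and>
    u = (hrot (- x) ** \<Theta>) $ 1 $ 1 \<and> v = (hrot (- x) ** \<Theta>) $ 2 $ 2"
proof -
  obtain u p q v where U: "hrot (- x) ** \<Theta> = mat2 u p q v" by (rule mat2_cases)
  have \<Theta>: "\<Theta> = hrot x ** mat2 u p q v" using hrot_cancel(1)[of x \<Theta>] U by simp
  have cadj_mult: "cadj (A ** B) = cadj B ** cadj A" for A B :: cmat2
    by (cases A rule: mat2_cases; cases B rule: mat2_cases) (simp add: mat2_simps)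
  have cadj_hrot: "cadj (hrot y) = hrot y" for y by (simp add: hrot_def mat2_cadj)
  \<comment> \<open>J anticommutes with B, so moving J across e^(yB) turns it into e^(-yB).\<close>
  have hJh: "hrot y ** (Jmat ** (hrot y ** A)) = Jmat ** A" for y A
  proof -
    have "hrot y ** Jmat ** hrot y = Jmat"
      unfolding hrot_def mat2_simps using cosh_sinh_complex[of y] by simp
    then show ?thesis by (metis matrix_mul_assoc)
  qed
  have "cadj (mat2 u p q v) ** (Jmat ** mat2 u p q v) = Jmat"
    using J unfolding J_unitary_def \<Theta> cadj_mult cadj_hrot matrix_mul_assoc[symmetric] hJh .
  then have j: "cnj u * u - cnj q * q = 1" "cnj p * p - cnj v * v = - 1"
    unfolding mat2_simps by simp_all
  have "mat2 u p q v ** cadj (mat2 u p q v) = hrot (- x) ** (\<Theta> ** cadj \<Theta>) ** hrot (- x)"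
    unfolding U[symmetric] cadj_mult cadj_hrot by (simp add: matrix_mul_assoc)
  also have "\<dots> = mat 1" unfolding H by (simp add: hrot_mult hrot_0)
  finally have h: "u * cnj u + p * cnj p = 1" "q * cnj q + v * cnj v = 1"
    unfolding mat2_simps by simp_all
  have sq: "z * cnj z = of_real ((cmod z)\<^sup>2)" "cnj z * z = of_real ((cmod z)\<^sup>2)" for z
    using complex_norm_square[of z] by (simp_all add: mult.commute)
  \<comment> \<open>The four moduli satisfy real linear relations; subtracting the first from the
    third leaves a vanishing sum of the squares of |p| and |q|.\<close>
  have "complex_of_real ((cmod u)\<^sup>2 - (cmod q)\<^sup>2) = of_real 1" "complex_of_real ((cmod p)\<^sup>2 - (cmod v)\<^sup>2) = of_real (-1)"
    "complex_of_real ((cmod u)\<^sup>2 + (cmod p)\<^sup>2) = of_real 1" "complex_of_real ((cmod q)\<^sup>2 + (cmod v)\<^sup>2) = of_real 1"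
    using j h unfolding sq by simp_all
  then have r: "(cmod u)\<^sup>2 - (cmod q)\<^sup>2 = 1" "(cmod p)\<^sup>2 - (cmod v)\<^sup>2 = -1"
    "(cmod u)\<^sup>2 + (cmod p)\<^sup>2 = 1" "(cmod q)\<^sup>2 + (cmod v)\<^sup>2 = 1"
    unfolding of_real_eq_iff by blast+
  have nn: "(cmod p)\<^sup>2 \<ge> 0" "(cmod q)\<^sup>2 \<ge> 0" by simp_all
  have "(cmod p)\<^sup>2 = 0" "(cmod q)\<^sup>2 = 0" "(cmod u)\<^sup>2 = 1" "(cmod v)\<^sup>2 = 1"
    using r nn by linarith+
  then have "p = 0" "q = 0" "cmod u = 1" "cmod v = 1" by (simp_all add: power2_eq_1_iff) (smt (verit) norm_ge_zero)+
  then show ?thesis using \<Theta> U by (auto simp: twist_def)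
qed

text \<open>The values \<open>x'\<close>, \<open>p\<close>, \<open>q\<close> stand for the derivatives of \<open>x\<close> and of the arguments of \<open>u\<close> and \<open>v\<close>.\<close>

lemma potential_twist:
  fixes x x' p q m :: real and u v :: complex
  assumes "cmod u = 1" "cmod v = 1"
  defines "w \<equiv> - \<i> * of_real x' * (cnj u * v) + of_real m * (of_real (cosh (2 * x)) * (cnj u * v) - 1)"
  shows "mat (- \<i>) ** cadj (twist x u v) ** Jmat **
      mat2 (of_real (x' * sinh x) * u + of_real (cosh x) * (\<i> * of_real p * u))
           (of_real (x' * cosh x) * v + of_real (sinh x) * (\<i> * of_real q * v))
           (of_real (x' * cosh x) * u + of_real (sinh x) * (\<i> * of_real p * u))
           (of_real (x' * sinh x) * v + of_real (cosh x) * (\<i> * of_real q * v))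
      + m *\<^sub>R (cadj (twist x u v) ** Bmat ** twist x u v - Bmat)
    = mat2 (of_real (p + m * sinh (2 * x))) w (cnj w) (of_real (m * sinh (2 * x) - q))"
proof -
  have uv: "cnj u * u = 1" "cnj v * v = 1" using assms by (simp_all only: cmod_eq_1_cnj)
  have d: "complex_of_real (cosh (2 * x)) = of_real (cosh x) * of_real (cosh x) + of_real (sinh x) * of_real (sinh x)"
    "complex_of_real (sinh (2 * x)) = 2 * (of_real (sinh x) * of_real (cosh x))"
    by (simp_all add: cosh_double sinh_double power2_eq_square)
  note cs = cosh_sinh_complex[of x]
  have ii: "\<i> * \<i> = - 1" by simp
  show ?thesis
    unfolding twist_eq mat2_simps mat2_eq_iff w_def
    apply (simp only: complex_cnj_mult complex_cnj_complex_of_real complex_cnj_cnj complex_cnj_i complex_cnj_minus complex_cnj_add complex_cnj_diff complex_cnj_one of_real_add of_real_diff of_real_mult d)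
    using uv cs ii by (intro conjI; algebra)
qed

subsection \<open>Sobolev functions on the line\<close>

lemma L2_loc_iff: "f \<in> L2_loc \<longleftrightarrow> f \<in> borel_measurable lebesgue \<and> loc_integrable (\<lambda>t. (f t)\<^sup>2)"
  by (simp add: L2_loc_def loc_integrable_def)

lemma L2_subset_L2_loc: "f \<in> L2 \<Longrightarrow> f \<in> L2_loc"
  unfolding L2_def L2_loc_def set_integrable_def mem_Collect_eq
  by (intro conjI allI integrable_mult_indicator) auto

lemma L2_loc_cong_AE:
  assumes "f \<in> L2_loc" "AE t in lebesgue. f t = g t"
  shows "g \<in> L2_loc"
proof -
  have "AE t in lebesgue. (f t)\<^sup>2 = (g t)\<^sup>2" using assms(2) by (rule eventually_mono) simp
  then show ?thesis
    using assms unfolding L2_loc_iff by (blast intro: borel_measurable_AE loc_integrable_cong_AE)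
qed

lemma L2_loc_continuous: "continuous_on UNIV f \<Longrightarrow> f \<in> L2_loc"
  unfolding L2_loc_iff
  by (intro conjI borel_measurable_continuous_lebesgue loc_integrable_continuous continuous_on_power)

lemma H1_loc_weak_deriv:
  assumes "f \<in> H1_loc"
  shows "has_weak_deriv f (wderiv f)" "wderiv f \<in> L2_loc"
proof -
  obtain g where g: "g \<in> L2_loc" "has_weak_deriv f g" using assms unfolding H1_loc_def by blast
  show "has_weak_deriv f (wderiv f)" by (rule has_weak_deriv_wderiv[OF g(2)])
  have "AE t in lebesgue. g t = wderiv f t"
    by (rule has_weak_deriv_unique[OF g(2) has_weak_deriv_wderiv[OF g(2)]])
  then show "wderiv f \<in> L2_loc" by (rule L2_loc_cong_AE[OF g(1)])
qed

lemma H1_loc_indef_integral: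
  assumes "f \<in> H1_loc"
  obtains F where "indef_integral F (wderiv f)" "AE t in lebesgue. f t = F t"
  using H1_loc_weak_deriv(1)[OF assms] unfolding has_weak_deriv_iff by blast

lemma H1_locI:
  assumes F: "indef_integral F g" and g: "g \<in> L2_loc" and eq: "AE t in lebesgue. F t = f t"
  shows "f \<in> H1_loc"
proof -
  have "f \<in> L2_loc"
    by (rule L2_loc_cong_AE[OF L2_loc_continuous[OF indef_integral_continuous[OF F]] eq])
  moreover have "AE t in lebesgue. f t = F t" using eq by (rule eventually_mono) simp
  then have "has_weak_deriv f g" unfolding has_weak_deriv_iff using F by blast
  ultimately show ?thesis using g unfolding H1_loc_def by blast
qed

lemma H1_subset_H1_loc: "f \<in> H1 \<Longrightarrow> f \<in> H1_loc"
  unfolding H1_def H1_loc_def using L2_subset_L2_loc by blast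

lemma H1_wderiv_L2:
  assumes "f \<in> H1"
  shows "wderiv f \<in> L2"
proof -
  obtain g where g: "g \<in> L2" "has_weak_deriv f g" using assms unfolding H1_def by blast
  have eq: "AE t in lebesgue. g t = wderiv f t"
    by (rule has_weak_deriv_unique[OF g(2) has_weak_deriv_wderiv[OF g(2)]])
  have m: "wderiv f \<in> borel_measurable lebesgue"
    using g(1) eq unfolding L2_def by (blast intro: borel_measurable_AE)
  have "integrable lebesgue (\<lambda>t. (wderiv f t)\<^sup>2)"
  proof (rule integrable_cong_AE_imp)
    show "integrable lebesgue (\<lambda>t. (g t)\<^sup>2)" using g(1) by (simp add: L2_def)
    show "(\<lambda>t. (wderiv f t)\<^sup>2) \<in> borel_measurable lebesgue" using m by simp
    show "AE t in lebesgue. (g t)\<^sup>2 = (wderiv f t)\<^sup>2" using eq by (rule eventually_mono) simp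
  qed
  with m show ?thesis by (simp add: L2_def)
qed

lemma wderiv_const: "AE t in lebesgue. wderiv (\<lambda>_. k :: real) t = 0"
proof (rule wderiv_AE)
  have "indef_integral (\<lambda>_. k) (\<lambda>_. 0)" by (simp add: indef_integral_def)
  then show "has_weak_deriv (\<lambda>_. k) (\<lambda>_. 0)" unfolding has_weak_deriv_iff by auto
qed

subsection \<open>Energy of a twisted gauge\<close>

text \<open>The integrand of the phase integral at \<open>a = x\<close>, \<open>a' = x'\<close>, \<open>\<delta> = d\<close>, \<open>\<delta>' = d'\<close>.\<close>

definition phase_density :: "real \<Rightarrow> real \<Rightarrow> real \<Rightarrow> real \<Rightarrow> real \<Rightarrow> real" where
  "phase_density m x x' d d' = (d' + m * sinh (2 * x))\<^sup>2
     + (m * cosh (2 * x) * cos (2 * d) - x' * sin (2 * d) - m)\<^sup>2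
     + (m * cosh (2 * x) * sin (2 * d) + x' * cos (2 * d))\<^sup>2"

lemma phase_density_nonneg: "0 \<le> phase_density m x x' d d'"
  by (simp add: phase_density_def)

lemma phase_integral_eq: "phase_integral m a \<delta> = (\<integral>\<^sup>+t. ennreal (phase_density m (a t) (wderiv a t) (\<delta> t) (wderiv \<delta> t)) \<partial>lebesgue)"
  by (simp add: phase_integral_def phase_density_def)

lemma borel_measurable_sinh_cosh [measurable]:
  "(sinh :: real \<Rightarrow> real) \<in> borel_measurable borel" "(cosh :: real \<Rightarrow> real) \<in> borel_measurable borel"
  by (intro borel_measurable_continuous_onI continuous_intros)+

lemma phase_density_measurable:
  assumes "x \<in> borel_measurable lebesgue" "x' \<in> borel_measurable lebesgue"
    "d \<in> borel_measurable lebesgue" "d' \<in> borel_measurable lebesgue"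
  shows "(\<lambda>t. phase_density m (x t) (x' t) (d t) (d' t)) \<in> borel_measurable lebesgue"
proof -
  note [measurable] = assms
  show ?thesis unfolding phase_density_def by measurable
qed

text \<open>Put \<alpha> = (\<theta> + \<phi>)/2, \<delta> = (\<theta> - \<phi>)/2 and S = m sinh
  2x. The diagonal entries are \<delta>' + S plus and minus \<alpha>', so the cross terms cancel in
  the sum of squares. The off-diagonal entries are conjugate and supply the other two squares
  twice.\<close>

lemma hs_norm_sq_potential_twist:
  assumes w: "w = - \<i> * of_real x' * (cnj (cis \<theta>) * cis \<phi>) + of_real m * (of_real (cosh (2 * x)) * (cnj (cis \<theta>) * cis \<phi>) - 1)"
  shows "hs_norm_sq (mat2 (of_real (p + m * sinh (2 * x))) w (cnj w) (of_real (m * sinh (2 * x) - q)))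
     = 2 * phase_density m x x' ((\<theta> - \<phi>) / 2) ((p - q) / 2) + 2 * ((p + q) / 2)\<^sup>2"
proof -
  define D where "D = \<theta> - \<phi>"
  have "cnj (cis \<theta>) * cis \<phi> = cis (- D)" by (simp add: cis_cnj cis_mult D_def)
  then have w': "w = - \<i> * of_real x' * cis (- D) + of_real m * (of_real (cosh (2 * x)) * cis (- D) - 1)"
    using w by simp
  define R where "R = m * cosh (2 * x) * cos D - x' * sin D - m"
  define I where "I = m * cosh (2 * x) * sin D + x' * cos D"
  define S where "S = m * sinh (2 * x)"
  have RI: "Re w = R" "Im w = - I"
    unfolding w' R_def I_def by (simp_all add: algebra_simps)
  have "2 * ((\<theta> - \<phi>) / 2) = D" by (simp add: D_def)
  then have "phase_density m x x' ((\<theta> - \<phi>) / 2) ((p - q) / 2) = ((p - q) / 2 + S)\<^sup>2 + R\<^sup>2 + I\<^sup>2"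
    unfolding phase_density_def R_def I_def S_def by (simp only:)
  then show ?thesis
    unfolding hs_norm_sq_mat2 complex_mod_cnj norm_of_real cmod_power2 S_def[symmetric] RI
    by (simp add: power2_eq_square field_simps)
qed

section \<open>Regularity and derivatives of twisted gauges\<close>

lemma has_vector_derivative_cis:
  assumes "(\<theta> has_vector_derivative p) (at t)"
  shows "((\<lambda>t. cis (\<theta> t)) has_vector_derivative \<i> * of_real p * cis (\<theta> t)) (at t)"
proof -
  have d: "(\<theta> has_real_derivative p) (at t)"
    using assms by (simp add: has_real_derivative_iff_has_vector_derivative)
  have der: "((\<lambda>t. of_real (cos (\<theta> t)) + \<i> * of_real (sin (\<theta> t))) has_vector_derivative
      of_real (- sin (\<theta> t) * p) + \<i> * of_real (cos (\<theta> t) * p)) (at t)"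
    by (rule has_vector_derivative_add[OF has_vector_derivative_of_real[OF DERIV_fun_cos[OF d]]
        has_vector_derivative_mult_right[OF has_vector_derivative_of_real[OF DERIV_fun_sin[OF d]]]])
  have "(\<lambda>t. of_real (cos (\<theta> t)) + \<i> * of_real (sin (\<theta> t))) = (\<lambda>t. cis (\<theta> t))"
    by (simp add: fun_eq_iff complex_eq_iff)
  moreover have "of_real (- sin (\<theta> t) * p) + \<i> * of_real (cos (\<theta> t) * p) = \<i> * of_real p * cis (\<theta> t)"
    by (simp add: complex_eq_iff)
  ultimately show ?thesis using der by (simp only:)
qed

lemma loc_abs_cont_of_real_compose:
  assumes "loc_abs_cont X" "\<And>x. (\<Phi> has_real_derivative \<Phi>' x) (at x)" "continuous_on UNIV \<Phi>'"
  shows "loc_abs_cont (\<lambda>t. complex_of_real (\<Phi> (X t)))"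
  by (rule loc_abs_cont_bounded_linear[OF loc_abs_cont_compose[OF assms] bounded_linear_of_real])

lemma loc_abs_cont_complex_mult:
  fixes F G :: "real \<Rightarrow> complex"
  shows "loc_abs_cont F \<Longrightarrow> loc_abs_cont G \<Longrightarrow> loc_abs_cont (\<lambda>t. F t * G t)"
  by (rule loc_abs_cont_bilinear[OF _ _ bounded_bilinear_mult])

lemma loc_abs_cont_cis:
  assumes "loc_abs_cont \<theta>"
  shows "loc_abs_cont (\<lambda>t. cis (\<theta> t))"
proof -
  have "loc_abs_cont (\<lambda>t. complex_of_real (cos (\<theta> t)))"
    by (rule loc_abs_cont_of_real_compose[OF assms, of cos "\<lambda>x. - sin x"])
      (auto intro!: continuous_intros)
  moreover have "loc_abs_cont (\<lambda>t. complex_of_real (sin (\<theta> t)))"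
    by (rule loc_abs_cont_of_real_compose[OF assms, of sin cos]) (auto intro!: continuous_intros)
  ultimately have "loc_abs_cont (\<lambda>t. complex_of_real (cos (\<theta> t)) + \<i> * of_real (sin (\<theta> t)))"
    by (intro loc_abs_cont_add loc_abs_cont_complex_mult[OF loc_abs_cont_const])
  moreover have "(\<lambda>t. of_real (cos (\<theta> t)) + \<i> * of_real (sin (\<theta> t))) = (\<lambda>t. cis (\<theta> t))"
    by (simp add: fun_eq_iff complex_eq_iff)
  ultimately show ?thesis by (simp only:)
qed

lemma loc_abs_cont_cosh_sinh:
  assumes "loc_abs_cont X"
  shows "loc_abs_cont (\<lambda>t. complex_of_real (cosh (X t)))" "loc_abs_cont (\<lambda>t. complex_of_real (sinh (X t)))"
proof -
  show "loc_abs_cont (\<lambda>t. complex_of_real (cosh (X t)))"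
    by (rule loc_abs_cont_of_real_compose[OF assms, of cosh sinh])
      (use has_field_derivative_cosh[OF DERIV_ident] in \<open>auto intro!: continuous_intros\<close>)
  show "loc_abs_cont (\<lambda>t. complex_of_real (sinh (X t)))"
    by (rule loc_abs_cont_of_real_compose[OF assms, of sinh cosh])
      (use has_field_derivative_sinh[OF DERIV_ident] in \<open>auto intro!: continuous_intros\<close>)
qed

lemma loc_abs_cont_twist:
  assumes "loc_abs_cont X" "loc_abs_cont \<theta>" "loc_abs_cont \<phi>"
  shows "loc_abs_cont (\<lambda>t. twist (X t) (cis (\<theta> t)) (cis (\<phi> t)))"
  unfolding twist_eq
  by (intro loc_abs_cont_mat2 loc_abs_cont_complex_mult loc_abs_cont_cosh_sinh loc_abs_cont_cis assms)

lemma has_vector_derivative_twist: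
  assumes X: "(X has_vector_derivative x') (at t)"
    and \<theta>: "(\<theta> has_vector_derivative p) (at t)" and \<phi>: "(\<phi> has_vector_derivative q) (at t)"
  shows "((\<lambda>t. twist (X t) (cis (\<theta> t)) (cis (\<phi> t))) has_vector_derivative
     mat2 (of_real (x' * sinh (X t)) * cis (\<theta> t) + of_real (cosh (X t)) * (\<i> * of_real p * cis (\<theta> t)))
           (of_real (x' * cosh (X t)) * cis (\<phi> t) + of_real (sinh (X t)) * (\<i> * of_real q * cis (\<phi> t)))
           (of_real (x' * cosh (X t)) * cis (\<theta> t) + of_real (sinh (X t)) * (\<i> * of_real p * cis (\<theta> t)))
           (of_real (x' * sinh (X t)) * cis (\<phi> t) + of_real (cosh (X t)) * (\<i> * of_real q * cis (\<phi> t)))) (at t)"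
proof -
  have dX: "(X has_real_derivative x') (at t)"
    using X by (simp add: has_real_derivative_iff_has_vector_derivative)
  have c: "((\<lambda>t. complex_of_real (cosh (X t))) has_vector_derivative of_real (x' * sinh (X t))) (at t)"
    "((\<lambda>t. complex_of_real (sinh (X t))) has_vector_derivative of_real (x' * cosh (X t))) (at t)"
    by (intro has_vector_derivative_of_real; auto intro!: derivative_eq_intros dX)+
  have prod: "((\<lambda>t. f t * g t) has_vector_derivative f' * g t + f t * g') (at t)"
    if "(f has_vector_derivative f') (at t)" "(g has_vector_derivative g') (at t)" for f g :: "real \<Rightarrow> complex" and f' g'
    using has_vector_derivative_mult[OF that] by (simp add: add.commute)
  show ?thesis
    unfolding twist_eq
    by (intro has_vector_derivative_mat2 prod c has_vector_derivative_cis \<theta> \<phi>)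
qed

text \<open>The chosen \<open>wderiv\<close> of the gauge agrees a.e. with its classical derivative,
  which the product rule computes. The explicit matrix stands on the left, the direction in which
  measurability is transferred later.\<close>

lemma gauge_potential_twist:
  fixes m :: real
  assumes X: "indef_integral X x'" and \<theta>: "indef_integral \<theta> p" and \<phi>: "indef_integral \<phi> q"
  defines "\<Theta> \<equiv> \<lambda>t. twist (X t) (cis (\<theta> t)) (cis (\<phi> t))"
  defines "w \<equiv> \<lambda>t. - \<i> * of_real (x' t) * (cnj (cis (\<theta> t)) * cis (\<phi> t))
      + of_real m * (of_real (cosh (2 * X t)) * (cnj (cis (\<theta> t)) * cis (\<phi> t)) - 1)"
  shows "AE t in lebesgue. mat2 (of_real (p t + m * sinh (2 * X t))) (w t) (cnj (w t)) (of_real (m * sinh (2 * X t) - q t))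
      = gauge_potential m \<Theta> t"
proof -
  have AC: "loc_abs_cont \<Theta>"
    unfolding \<Theta>_def by (intro loc_abs_cont_twist indef_integral_loc_abs_cont[OF X]
        indef_integral_loc_abs_cont[OF \<theta>] indef_integral_loc_abs_cont[OF \<phi>])
  obtain D where D: "indef_integral \<Theta> D" using loc_abs_cont_indef_integral[OF AC] ..
  then have "has_weak_deriv \<Theta> D" unfolding has_weak_deriv_iff by auto
  from wderiv_AE[OF this] indef_integral_AE_deriv[OF D] indef_integral_AE_deriv[OF X]
    indef_integral_AE_deriv[OF \<theta>] indef_integral_AE_deriv[OF \<phi>]
  show ?thesis
  proof eventually_elim
    case (elim t)
    have "(\<Theta> has_vector_derivative wderiv \<Theta> t) (at t)" using elim(1,2) by simp
    from vector_derivative_unique_at[OF this has_vector_derivative_twist[OF elim(3-5), folded \<Theta>_def]]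
    show ?case
      unfolding gauge_potential_def w_def
      using potential_twist[of "cis (\<theta> t)" "cis (\<phi> t)" "X t" "x' t" "p t" "q t" m] by (simp only: \<Theta>_def norm_cis)
  qed
qed

lemma gauge_energy_twist:
  assumes X: "indef_integral X x'" and \<theta>: "indef_integral \<theta> p" and \<phi>: "indef_integral \<phi> q"
  defines "\<Theta> \<equiv> \<lambda>t. twist (X t) (cis (\<theta> t)) (cis (\<phi> t))"
  shows "gauge_energy m \<Theta> = (\<integral>\<^sup>+t. ennreal (2 * phase_density m (X t) (x' t) ((\<theta> t - \<phi> t) / 2) ((p t - q t) / 2)
      + 2 * ((p t + q t) / 2)\<^sup>2) \<partial>lebesgue)"
    and "gauge_potential m \<Theta> \<in> borel_measurable lebesgue"
proof -
  let ?w = "\<lambda>t. - \<i> * of_real (x' t) * (cnj (cis (\<theta> t)) * cis (\<phi> t))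
      + of_real m * (of_real (cosh (2 * X t)) * (cnj (cis (\<theta> t)) * cis (\<phi> t)) - 1)"
  note AE = gauge_potential_twist[OF X \<theta> \<phi>, of m, folded \<Theta>_def]
  show "gauge_energy m \<Theta> = (\<integral>\<^sup>+t. ennreal (2 * phase_density m (X t) (x' t) ((\<theta> t - \<phi> t) / 2) ((p t - q t) / 2)
      + 2 * ((p t + q t) / 2)\<^sup>2) \<partial>lebesgue)"
    unfolding gauge_energy_def
  proof (rule nn_integral_cong_AE)
    from AE show "AE t in lebesgue. ennreal (hs_norm_sq (gauge_potential m \<Theta> t)) =
        ennreal (2 * phase_density m (X t) (x' t) ((\<theta> t - \<phi> t) / 2) ((p t - q t) / 2) + 2 * ((p t + q t) / 2)\<^sup>2)"
    proof eventually_elim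
      case (elim t)
      show ?case unfolding elim[symmetric] by (subst hs_norm_sq_potential_twist[OF refl]) (rule refl)
    qed
  qed
  have [measurable]: "X \<in> borel_measurable lebesgue" "\<theta> \<in> borel_measurable lebesgue" "\<phi> \<in> borel_measurable lebesgue"
    by (intro borel_measurable_continuous_lebesgue indef_integral_continuous[OF X]
        indef_integral_continuous[OF \<theta>] indef_integral_continuous[OF \<phi>])+
  have [measurable]: "x' \<in> borel_measurable lebesgue" "p \<in> borel_measurable lebesgue" "q \<in> borel_measurable lebesgue"
    by (intro loc_integrable_measurable loc_integrable_indef_integral[OF X]
        loc_integrable_indef_integral[OF \<theta>] loc_integrable_indef_integral[OF \<phi>])+
  have [measurable]: "cis \<in> borel_measurable borel" "cnj \<in> borel_measurable borel"
    by (intro borel_measurable_continuous_onI continuous_intros)+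
  have lin: "(\<lambda>t. h (f t)) \<in> borel_measurable lebesgue" if "bounded_linear h" "f \<in> borel_measurable lebesgue"
    for h :: "complex \<Rightarrow> cmat2" and f :: "real \<Rightarrow> complex"
    by (rule borel_measurable_continuous_on[OF linear_continuous_on[OF that(1)] that(2)])
  have "(\<lambda>t. mat2 (of_real (p t + m * sinh (2 * X t))) 0 0 0 + mat2 0 (?w t) 0 0 + mat2 0 0 (cnj (?w t)) 0
      + mat2 0 0 0 (of_real (m * sinh (2 * X t) - q t))) \<in> borel_measurable lebesgue"
    by (intro borel_measurable_add lin[OF bounded_linear_mat2(1)] lin[OF bounded_linear_mat2(2)]
        lin[OF bounded_linear_mat2(3)] lin[OF bounded_linear_mat2(4)]; measurable)
  then have "(\<lambda>t. mat2 (of_real (p t + m * sinh (2 * X t))) (?w t) (cnj (?w t)) (of_real (m * sinh (2 * X t) - q t))) \<in> borel_measurable lebesgue"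
    by (simp only: mat2_split[symmetric])
  from borel_measurable_AE[OF this AE] show "gauge_potential m \<Theta> \<in> borel_measurable lebesgue" .
qed

subsection \<open>Lifting unimodular functions\<close>

text \<open>A function of modulus 1 satisfies u' = i p u with p real. Dividing \<open>u\<close> by
  the exponential of i times a primitive of p gives a locally absolutely continuous function with
  derivative 0 a.e., hence a constant.\<close>

lemma unimodular_lift:
  assumes u: "loc_abs_cont u" and mod: "\<And>t. cmod (u t) = 1"
  shows "\<exists>\<theta> p. indef_integral \<theta> p \<and> (\<forall>t. u t = cis (\<theta> t))"
proof -
  obtain g where g: "indef_integral u g" using loc_abs_cont_indef_integral[OF u] ..
  define p where "p t = Im (cnj (u t) * g t)" for t
  have cu: "continuous_on UNIV u" by (rule loc_abs_cont_continuous[OF u])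
  have "bounded_bilinear (\<lambda>w z. Im (cnj w * z))"
    unfolding bilinear_conv_bounded_bilinear[symmetric] bilinear_def
    by (auto intro!: linearI simp: algebra_simps)
  from loc_integrable_bilinear[OF this cu loc_integrable_indef_integral[OF g]]
  have "loc_integrable p" by (simp add: p_def[abs_def])
  then obtain \<theta>0 where \<theta>0: "indef_integral \<theta>0 p" using indef_integral_exists by blast
  \<comment> \<open>The additive constant gives \<theta> the value \<open>Arg (u 0)\<close> at 0, so
    the constant quotient equals 1.\<close>
  define \<theta> where "\<theta> t = \<theta>0 t + (Arg (u 0) - \<theta>0 0)" for t
  have \<theta>: "indef_integral \<theta> p" using \<theta>0 unfolding indef_integral_def \<theta>_def by simp
  define n\<theta> where "n\<theta> t = - \<theta> t" for t
  have AC: "loc_abs_cont (\<lambda>t. u t * cis (n\<theta> t))"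
    unfolding n\<theta>_def
    by (intro loc_abs_cont_complex_mult u loc_abs_cont_cis
        loc_abs_cont_bounded_linear[OF indef_integral_loc_abs_cont[OF \<theta>] bounded_linear_minus[OF bounded_linear_ident]])
  have "AE t in lebesgue. ((\<lambda>t. u t * cis (n\<theta> t)) has_vector_derivative 0) (at t)"
    using indef_integral_AE_deriv[OF g] indef_integral_AE_deriv[OF \<theta>]
  proof eventually_elim
    case (elim t)
    have "(n\<theta> has_vector_derivative - p t) (at t)"
      unfolding n\<theta>_def by (rule has_vector_derivative_minus[OF elim(2)])
    from has_vector_derivative_mult[OF elim(1) has_vector_derivative_cis[OF this]]
    have der: "((\<lambda>t. u t * cis (n\<theta> t)) has_vector_derivative
        u t * (\<i> * of_real (- p t) * cis (n\<theta> t)) + g t * cis (n\<theta> t)) (at t)" .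
    \<comment> \<open>Differentiating |u|^2 = 1 shows that \<open>cnj (u t) * g t\<close> is purely
      imaginary.\<close>
    have "((\<lambda>t. (Re (u t))\<^sup>2 + (Im (u t))\<^sup>2) has_real_derivative 2 * Re (u t) * Re (g t) + 2 * Im (u t) * Im (g t)) (at t)"
    proof -
      have "((\<lambda>t. Re (u t)) has_real_derivative Re (g t)) (at t)" "((\<lambda>t. Im (u t)) has_real_derivative Im (g t)) (at t)"
        using bounded_linear.has_vector_derivative[OF bounded_linear_Re elim(1)]
          bounded_linear.has_vector_derivative[OF bounded_linear_Im elim(1)]
        by (simp_all add: has_real_derivative_iff_has_vector_derivative)
      from DERIV_add[OF DERIV_power[OF this(1), of 2] DERIV_power[OF this(2), of 2]]
      show ?thesis by (simp add: mult_ac)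
    qed
    moreover have "(\<lambda>t. (Re (u t))\<^sup>2 + (Im (u t))\<^sup>2) = (\<lambda>_. 1)"
      using mod by (simp flip: cmod_power2)
    ultimately have "((\<lambda>_ :: real. 1 :: real) has_real_derivative 2 * Re (u t) * Re (g t) + 2 * Im (u t) * Im (g t)) (at t)"
      by (simp only:)
    from DERIV_unique[OF this DERIV_const]
    have "2 * Re (u t) * Re (g t) + 2 * Im (u t) * Im (g t) = 0" .
    then have re: "Re (cnj (u t) * g t) = 0" by simp
    have "cnj (u t) * g t = \<i> * of_real (p t)"
      using re by (simp add: complex_eq_iff p_def)
    then have "u t * (cnj (u t) * g t) = u t * (\<i> * of_real (p t))" by simp
    then have "g t = u t * (\<i> * of_real (p t))"
      using cmod_eq_1_cnj(1)[OF mod[of t]] by (simp add: mult.assoc[symmetric])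
    then have "u t * (\<i> * of_real (- p t) * cis (n\<theta> t)) + g t * cis (n\<theta> t) = 0"
      by (simp add: algebra_simps)
    then show ?case using der by simp
  qed
  from indef_integral_loc_abs_contI[OF AC this]
  have w: "indef_integral (\<lambda>t. u t * cis (n\<theta> t)) (\<lambda>_. 0)" .
  have const: "u t * cis (n\<theta> t) = u 0 * cis (n\<theta> 0)" for t
    using indef_integralD(2)[OF w, of 0 t] indef_integralD(2)[OF w, of t 0] by (cases "0 \<le> t") auto
  have "u 0 * cis (n\<theta> 0) = 1"
  proof -
    have "n\<theta> 0 = - Arg (u 0)" by (simp add: n\<theta>_def \<theta>_def)
    moreover have "u 0 = cis (Arg (u 0))" using rcis_cmod_Arg[of "u 0"] mod[of 0] by (simp add: rcis_def)
    moreover have "cis (Arg (u 0)) * cis (- Arg (u 0)) = 1" by (simp add: cis_mult)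
    ultimately show ?thesis by metis
  qed
  then have "u t * cis (n\<theta> t) * cis (\<theta> t) = cis (\<theta> t)" for t using const[of t] by simp
  then have "u t = cis (\<theta> t)" for t by (simp add: mult.assoc cis_mult n\<theta>_def)
  then show ?thesis using \<theta> by blast
qed

lemma indef_integral_cmult:
  fixes F :: "real \<Rightarrow> real"
  assumes "indef_integral F f"
  shows "indef_integral (\<lambda>t. c * F t) (\<lambda>t. c * f t)"
  unfolding indef_integral_def
proof (intro allI impI conjI)
  fix x y :: real assume "x \<le> y"
  note f = indef_integralD[OF assms this]
  show "(\<lambda>t. c * f t) absolutely_integrable_on {x..y}"
    using f(1) by (rule set_integrable_mult_right)
  show "c * F y - c * F x = integral {x..y} (\<lambda>t. c * f t)"
    using f(2) by (simp add: right_diff_distrib)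
qed

lemma loc_integrable_bound:
  fixes f g :: "real \<Rightarrow> real"
  assumes g: "loc_integrable g" and f: "f \<in> borel_measurable lebesgue"
    and le: "AE t in lebesgue. \<bar>f t\<bar> \<le> g t"
  shows "loc_integrable f"
proof (rule loc_integrableI)
  fix x y
  show "f absolutely_integrable_on {x..y}"
    unfolding set_integrable_def
  proof (rule Bochner_Integration.integrable_bound)
    show "integrable lebesgue (\<lambda>t. indicat_real {x..y} t *\<^sub>R g t)"
      using g unfolding loc_integrable_def set_integrable_def by blast
    show "(\<lambda>t. indicat_real {x..y} t *\<^sub>R f t) \<in> borel_measurable lebesgue"
      by (intro borel_measurable_scaleR borel_measurable_indicator f) simp
    show "AE t in lebesgue. norm (indicat_real {x..y} t *\<^sub>R f t) \<le> norm (indicat_real {x..y} t *\<^sub>R g t)"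
      using le by (rule eventually_mono) (auto simp: indicator_def)
  qed
qed

lemma H1_loc_measurable:
  assumes "f \<in> H1_loc"
  shows "f \<in> borel_measurable lebesgue" "wderiv f \<in> borel_measurable lebesgue"
  using assms H1_loc_weak_deriv(2)[OF assms] by (auto simp: H1_loc_def L2_loc_def)

subsection \<open>Phases and gauges\<close>

lemma gauge_of_phase:
  assumes a: "a \<in> H1_loc" and \<delta>: "\<delta> \<in> H1_loc"
  shows "\<exists>\<Theta>\<in>gauges (Ham a). (AE t in lebesgue. \<Theta> t = twist (a t) (cis (\<delta> t)) (cis (- \<delta> t))) \<and>
     gauge_potential m \<Theta> \<in> borel_measurable lebesgue \<and> gauge_energy m \<Theta> = phase_energy m a \<delta>"
proof -
  obtain X where X: "indef_integral X (wderiv a)" and aX: "AE t in lebesgue. a t = X t"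
    by (rule H1_loc_indef_integral[OF a])
  obtain d where d: "indef_integral d (wderiv \<delta>)" and \<delta>d: "AE t in lebesgue. \<delta> t = d t"
    by (rule H1_loc_indef_integral[OF \<delta>])
  have nd: "indef_integral (\<lambda>t. - d t) (\<lambda>t. - wderiv \<delta> t)"
    using indef_integral_cmult[OF d, of "-1"] by simp
  \<comment> \<open>The case \<alpha> = 0, built from continuous representatives because
    \<open>a\<close> and \<delta> themselves may be irregular on a null set.\<close>
  define \<Theta> where "\<Theta> t = twist (X t) (cis (d t)) (cis (- d t))" for t
  have AC: "loc_abs_cont \<Theta>"
    unfolding \<Theta>_def by (intro loc_abs_cont_twist indef_integral_loc_abs_cont[OF X]
        indef_integral_loc_abs_cont[OF d] indef_integral_loc_abs_cont[OF nd])
  have "AE t in lebesgue. Ham a t = cadj (matrix_inv (\<Theta> t)) ** matrix_inv (\<Theta> t)"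
    using aX
  proof (rule eventually_mono)
    fix t assume "a t = X t"
    then show "Ham a t = cadj (matrix_inv (\<Theta> t)) ** matrix_inv (\<Theta> t)"
      unfolding Ham_eq \<Theta>_def using gauge_condition_twist[of "cis (d t)" "cis (- d t)" "X t"] by simp
  qed
  then have "\<Theta> \<in> gauges (Ham a)"
    unfolding gauges_def using AC by (auto simp: \<Theta>_def J_unitary_twist)
  moreover have "AE t in lebesgue. \<Theta> t = twist (a t) (cis (\<delta> t)) (cis (- \<delta> t))"
    using aX \<delta>d by eventually_elim (simp add: \<Theta>_def)
  moreover have "gauge_potential m \<Theta> \<in> borel_measurable lebesgue"
    unfolding \<Theta>_def[abs_def] by (rule gauge_energy_twist(2)[OF X d nd])
  moreover have "gauge_energy m \<Theta> = phase_energy m a \<delta>"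
  proof -
    have "gauge_energy m \<Theta> = (\<integral>\<^sup>+t. 2 * ennreal (phase_density m (a t) (wderiv a t) (\<delta> t) (wderiv \<delta> t)) \<partial>lebesgue)"
      unfolding \<Theta>_def[abs_def] gauge_energy_twist(1)[OF X d nd]
    proof (rule nn_integral_cong_AE)
      show "AE t in lebesgue. ennreal (2 * phase_density m (X t) (wderiv a t) ((d t - - d t) / 2) ((wderiv \<delta> t - - wderiv \<delta> t) / 2)
          + 2 * ((wderiv \<delta> t + - wderiv \<delta> t) / 2)\<^sup>2) = 2 * ennreal (phase_density m (a t) (wderiv a t) (\<delta> t) (wderiv \<delta> t))"
        using aX \<delta>d
      proof eventually_elim
        case (elim t)
        have "ennreal (2 * phase_density m (a t) (wderiv a t) (\<delta> t) (wderiv \<delta> t))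
            = 2 * ennreal (phase_density m (a t) (wderiv a t) (\<delta> t) (wderiv \<delta> t))"
          by (simp add: ennreal_mult' phase_density_nonneg)
        then show ?case using elim by simp
      qed
    qed
    also have "\<dots> = phase_energy m a \<delta>"
      unfolding phase_energy_def phase_integral_eq
      by (intro nn_integral_cmult measurable_compose[OF _ measurable_ennreal] phase_density_measurable H1_loc_measurable a \<delta>)
    finally show ?thesis .
  qed
  ultimately show ?thesis by blast
qed

lemma gauge_lift:
  assumes a: "a \<in> H1_loc" and \<Theta>: "\<Theta> \<in> gauges (Ham a)" and X: "indef_integral X (wderiv a)"
    and aX: "AE t in lebesgue. a t = X t"
  shows "\<exists>\<theta> p \<phi> q. indef_integral \<theta> p \<and> indef_integral \<phi> q \<and>
     (\<forall>t. \<Theta> t = twist (X t) (cis (\<theta> t)) (cis (\<phi> t)))"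
proof -
  have AC: "loc_abs_cont \<Theta>" and J: "\<And>t. J_unitary (\<Theta> t)"
    and H: "AE t in lebesgue. Ham a t = cadj (matrix_inv (\<Theta> t)) ** matrix_inv (\<Theta> t)"
    using \<Theta> by (auto simp: gauges_def)
  have ACe: "loc_abs_cont (\<lambda>t. \<Theta> t $ i $ j)" for i j
    by (rule loc_abs_cont_bounded_linear[OF AC bounded_linear_mat2_nth])
  have ACX: "loc_abs_cont X" by (rule indef_integral_loc_abs_cont[OF X])
  \<comment> \<open>The gauge condition is given a.e. only, but both sides here are continuous. The
    identity is wanted at every point, since lifting needs entries of modulus 1 everywhere.\<close>
  have "(\<lambda>t. \<Theta> t ** cadj (\<Theta> t)) = (\<lambda>t. hrot (2 * X t))"
  proof (rule continuous_AE_eq)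
    have entries: "(\<lambda>t. \<Theta> t ** cadj (\<Theta> t)) = (\<lambda>t. mat2 (\<Theta> t $ 1 $ 1 * cnj (\<Theta> t $ 1 $ 1) + \<Theta> t $ 1 $ 2 * cnj (\<Theta> t $ 1 $ 2))
      (\<Theta> t $ 1 $ 1 * cnj (\<Theta> t $ 2 $ 1) + \<Theta> t $ 1 $ 2 * cnj (\<Theta> t $ 2 $ 2))
      (\<Theta> t $ 2 $ 1 * cnj (\<Theta> t $ 1 $ 1) + \<Theta> t $ 2 $ 2 * cnj (\<Theta> t $ 1 $ 2))
      (\<Theta> t $ 2 $ 1 * cnj (\<Theta> t $ 2 $ 1) + \<Theta> t $ 2 $ 2 * cnj (\<Theta> t $ 2 $ 2)))"
      by (rule ext) (simp add: cmat2_eq_iff matrix_matrix_mult_def sum_2 cadj_def)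
    show "continuous_on UNIV (\<lambda>t. \<Theta> t ** cadj (\<Theta> t))"
      unfolding entries
      by (rule loc_abs_cont_continuous[OF loc_abs_cont_mat2];
          intro loc_abs_cont_add loc_abs_cont_complex_mult ACe loc_abs_cont_bounded_linear[OF ACe bounded_linear_cnj])
    show "continuous_on UNIV (\<lambda>t. hrot (2 * X t))"
      unfolding hrot_def
      by (rule loc_abs_cont_continuous[OF loc_abs_cont_mat2];
          rule loc_abs_cont_cosh_sinh[OF indef_integral_loc_abs_cont[OF indef_integral_cmult[OF X]]])
    show "AE t in lebesgue. \<Theta> t ** cadj (\<Theta> t) = hrot (2 * X t)"
      using H aX
    proof eventually_elim
      case (elim t)
      then have "hrot (- 2 * X t) = cadj (matrix_inv (\<Theta> t)) ** matrix_inv (\<Theta> t)"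
        by (simp only: Ham_eq)
      then show ?case by (rule gauge_condition_iff[OF J, THEN iffD1])
    qed
  qed
  then have eq: "\<Theta> t ** cadj (\<Theta> t) = hrot (2 * X t)" for t by (rule fun_cong)
  define u where "u t = (hrot (- X t) ** \<Theta> t) $ 1 $ 1" for t
  define v where "v t = (hrot (- X t) ** \<Theta> t) $ 2 $ 2" for t
  have tw: "cmod (u t) = 1" "cmod (v t) = 1" "\<Theta> t = twist (X t) (u t) (v t)" for t
  proof -
    from gauge_is_twist[OF J eq, of t]
    obtain u' v' where "cmod u' = 1 \<and> cmod v' = 1 \<and> \<Theta> t = twist (X t) u' v' \<and>
      u' = (hrot (- X t) ** \<Theta> t) $ 1 $ 1 \<and> v' = (hrot (- X t) ** \<Theta> t) $ 2 $ 2"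
      by (elim exE)
    then show "cmod (u t) = 1" "cmod (v t) = 1" "\<Theta> t = twist (X t) (u t) (v t)"
      unfolding u_def[symmetric] v_def[symmetric] by auto
  qed
  have ACnX: "loc_abs_cont (\<lambda>t. - X t)"
    by (rule loc_abs_cont_bounded_linear[OF ACX bounded_linear_minus[OF bounded_linear_ident]])
  have "u = (\<lambda>t. of_real (cosh (- X t)) * \<Theta> t $ 1 $ 1 + of_real (sinh (- X t)) * \<Theta> t $ 2 $ 1)"
    by (simp add: fun_eq_iff u_def hrot_def matrix_matrix_mult_def sum_2)
  then have ACu: "loc_abs_cont u"
    using loc_abs_cont_add[OF loc_abs_cont_complex_mult[OF loc_abs_cont_cosh_sinh(1)[OF ACnX] ACe[of 1 1]]
      loc_abs_cont_complex_mult[OF loc_abs_cont_cosh_sinh(2)[OF ACnX] ACe[of 2 1]]] by (simp only:)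
  have "v = (\<lambda>t. of_real (sinh (- X t)) * \<Theta> t $ 1 $ 2 + of_real (cosh (- X t)) * \<Theta> t $ 2 $ 2)"
    by (simp add: fun_eq_iff v_def hrot_def matrix_matrix_mult_def sum_2)
  then have ACv: "loc_abs_cont v"
    using loc_abs_cont_add[OF loc_abs_cont_complex_mult[OF loc_abs_cont_cosh_sinh(2)[OF ACnX] ACe[of 1 2]]
      loc_abs_cont_complex_mult[OF loc_abs_cont_cosh_sinh(1)[OF ACnX] ACe[of 2 2]]] by (simp only:)
  obtain \<theta> p where "indef_integral \<theta> p" "\<forall>t. u t = cis (\<theta> t)" using unimodular_lift[OF ACu tw(1)] by blast
  moreover obtain \<phi> q where "indef_integral \<phi> q" "\<forall>t. v t = cis (\<phi> t)" using unimodular_lift[OF ACv tw(2)] by blast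
  ultimately show ?thesis using tw(3) by (intro exI[of _ \<theta>] exI[of _ p] exI[of _ \<phi>] exI[of _ q]) simp
qed

text \<open>The phase is half the difference of the two lifted arguments; the energy drops by the
  nonnegative contribution of \<alpha>'. What remains is to show that this phase is in
  \<open>H1_loc\<close>.\<close>

lemma phase_of_gauge:
  assumes a: "a \<in> H1_loc" and \<Theta>: "\<Theta> \<in> gauges (Ham a)" and L2: "potential_in_L2 m \<Theta>"
  shows "\<exists>\<delta>\<in>admissible_phases m a. phase_energy m a \<delta> \<le> gauge_energy m \<Theta>"
proof -
  obtain X where X: "indef_integral X (wderiv a)" and aX: "AE t in lebesgue. a t = X t"
    by (rule H1_loc_indef_integral[OF a])
  obtain \<theta> p \<phi> q where \<theta>: "indef_integral \<theta> p" and \<phi>: "indef_integral \<phi> q"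
    and tw: "\<forall>t. \<Theta> t = twist (X t) (cis (\<theta> t)) (cis (\<phi> t))"
    using gauge_lift[OF a \<Theta> X aX] by blast
  have \<Theta>_eq: "\<Theta> = (\<lambda>t. twist (X t) (cis (\<theta> t)) (cis (\<phi> t)))" using tw by (simp add: fun_eq_iff)
  define \<delta> where "\<delta> t = (\<theta> t - \<phi> t) / 2" for t
  define d where "d t = (p t - q t) / 2" for t
  have \<delta>: "indef_integral \<delta> d"
    using indef_integral_cmult[OF indef_integral_diff[OF \<theta> \<phi>], of "1/2"] by (simp add: \<delta>_def[abs_def] d_def[abs_def])
  have "has_weak_deriv \<delta> d" unfolding has_weak_deriv_iff using \<delta> by auto
  from wderiv_AE[OF this] have wd: "AE t in lebesgue. wderiv \<delta> t = d t" .
  have [measurable]: "X \<in> borel_measurable lebesgue" "\<delta> \<in> borel_measurable lebesgue"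
    by (intro borel_measurable_continuous_lebesgue indef_integral_continuous[OF X] indef_integral_continuous[OF \<delta>])+
  have [measurable]: "wderiv a \<in> borel_measurable lebesgue" "d \<in> borel_measurable lebesgue"
    by (intro loc_integrable_measurable loc_integrable_indef_integral[OF X] loc_integrable_indef_integral[OF \<delta>])+
  define D where "D t = phase_density m (X t) (wderiv a t) (\<delta> t) (d t)" for t
  have [measurable]: "D \<in> borel_measurable lebesgue"
    unfolding D_def[abs_def] by (intro phase_density_measurable) measurable
  have int: "phase_integral m a \<delta> = (\<integral>\<^sup>+t. ennreal (D t) \<partial>lebesgue)"
    unfolding phase_integral_eq
  proof (rule nn_integral_cong_AE)
    show "AE t in lebesgue. ennreal (phase_density m (a t) (wderiv a t) (\<delta> t) (wderiv \<delta> t)) = ennreal (D t)"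
      using aX wd by eventually_elim (simp add: D_def)
  qed
  have "phase_energy m a \<delta> = (\<integral>\<^sup>+t. 2 * ennreal (D t) \<partial>lebesgue)"
    unfolding phase_energy_def int by (rule nn_integral_cmult[symmetric]) measurable
  also have "\<dots> \<le> gauge_energy m \<Theta>"
    unfolding \<Theta>_eq gauge_energy_twist(1)[OF X \<theta> \<phi>]
  proof (rule nn_integral_mono)
    fix t
    have "2 * ennreal (D t) = ennreal (2 * D t)" by (simp add: ennreal_mult' D_def phase_density_nonneg)
    also have "\<dots> \<le> ennreal (2 * D t + 2 * ((p t + q t) / 2)\<^sup>2)" by (intro ennreal_leI) simp
    finally show "2 * ennreal (D t) \<le> ennreal (2 * phase_density m (X t) (wderiv a t) ((\<theta> t - \<phi> t) / 2) ((p t - q t) / 2)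
        + 2 * ((p t + q t) / 2)\<^sup>2)" by (simp only: D_def \<delta>_def d_def)
  qed
  finally have le: "phase_energy m a \<delta> \<le> gauge_energy m \<Theta>" .
  moreover have "gauge_energy m \<Theta> < \<infinity>" using L2 unfolding potential_in_L2_def by blast
  ultimately have "phase_energy m a \<delta> < \<infinity>" by (rule le_less_trans)
  then have fin: "phase_integral m a \<delta> < \<infinity>"
    unfolding phase_energy_def by (auto simp: ennreal_mult_less_top)
  \<comment> \<open>Finite energy makes \<open>d + s\<close> square integrable; as \<open>s\<close>
    is continuous, \<open>d\<close> is locally square integrable.\<close>
  define s where "s t = m * sinh (2 * X t)" for t
  have cs: "continuous_on UNIV s"
    unfolding s_def by (intro continuous_intros indef_integral_continuous[OF X])
  have [measurable]: "s \<in> borel_measurable lebesgue" by (rule borel_measurable_continuous_lebesgue[OF cs])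
  have "integrable lebesgue (\<lambda>t. (d t + s t)\<^sup>2)"
  proof (rule integrableI_bounded)
    have "(\<integral>\<^sup>+t. ennreal (norm ((d t + s t)\<^sup>2)) \<partial>lebesgue) \<le> (\<integral>\<^sup>+t. ennreal (D t) \<partial>lebesgue)"
      by (intro nn_integral_mono ennreal_leI) (simp add: D_def phase_density_def s_def)
    then show "(\<integral>\<^sup>+t. ennreal (norm ((d t + s t)\<^sup>2)) \<partial>lebesgue) < \<infinity>" using fin unfolding int by (rule order.strict_trans1)
  qed measurable
  then have "loc_integrable (\<lambda>t. (d t + s t)\<^sup>2)"
    unfolding loc_integrable_def set_integrable_def by (intro allI integrable_mult_indicator) auto
  moreover have "loc_integrable (\<lambda>t. (s t)\<^sup>2)"
    by (rule loc_integrable_continuous) (intro continuous_intros cs)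
  ultimately have "loc_integrable (\<lambda>t. ((d t + s t)\<^sup>2 + (d t + s t)\<^sup>2) + ((s t)\<^sup>2 + (s t)\<^sup>2))"
    by (intro loc_integrable_add)
  then have "loc_integrable (\<lambda>t. (d t)\<^sup>2)"
  proof (rule loc_integrable_bound)
    have "(d t)\<^sup>2 \<le> ((d t + s t)\<^sup>2 + (d t + s t)\<^sup>2) + ((s t)\<^sup>2 + (s t)\<^sup>2)" for t
      \<comment> \<open>The right side minus the left side is exactly the square of
        \<open>d t + 2 * s t\<close>.\<close>
      using zero_le_power2[of "d t + 2 * s t"] by (simp add: power2_eq_square algebra_simps)
    then show "AE t in lebesgue. \<bar>(d t)\<^sup>2\<bar> \<le> ((d t + s t)\<^sup>2 + (d t + s t)\<^sup>2) + ((s t)\<^sup>2 + (s t)\<^sup>2)" by simp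
  qed measurable
  then have "d \<in> L2_loc" unfolding L2_loc_iff by simp
  then have "\<delta> \<in> H1_loc" by (rule H1_locI[OF \<delta>]) simp
  then have "\<delta> \<in> admissible_phases m a" using fin by (simp add: admissible_phases_def)
  with le show ?thesis by blast
qed

section \<open>Equality of the gauge infimum and the phase infimum\<close>

lemma optimal_energy_eq:
  assumes a: "a \<in> H1_loc"
  shows "optimal_energy m (Ham a) = 2 * (INF \<delta>\<in>admissible_phases m a. phase_integral m a \<delta>)"
proof (rule antisym)
  show "2 * (INF \<delta>\<in>admissible_phases m a. phase_integral m a \<delta>) \<le> optimal_energy m (Ham a)"
    unfolding optimal_energy_def
  proof (rule INF_greatest)
    fix \<Theta> assume "\<Theta> \<in> {\<Theta> \<in> gauges (Ham a). potential_in_L2 m \<Theta>}"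
    then obtain \<delta> where \<delta>: "\<delta> \<in> admissible_phases m a" "phase_energy m a \<delta> \<le> gauge_energy m \<Theta>"
      using phase_of_gauge[OF a] by blast
    have "2 * (INF \<delta>\<in>admissible_phases m a. phase_integral m a \<delta>) \<le> 2 * phase_integral m a \<delta>"
      by (intro mult_left_mono INF_lower \<delta>) simp
    with \<delta>(2) show "2 * (INF \<delta>\<in>admissible_phases m a. phase_integral m a \<delta>) \<le> gauge_energy m \<Theta>"
      unfolding phase_energy_def by (rule order_trans[rotated])
  qed
  \<comment> \<open>The bound is halved first, so that \<open>INF_greatest\<close> applies without
    pulling the factor 2 through the infimum.\<close>
  have "optimal_energy m (Ham a) / 2 \<le> (INF \<delta>\<in>admissible_phases m a. phase_integral m a \<delta>)"
  proof (intro INF_greatest divide_le_posI_ennreal)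
    fix \<delta> assume "\<delta> \<in> admissible_phases m a"
    then have \<delta>: "\<delta> \<in> H1_loc" "phase_integral m a \<delta> < \<infinity>" by (auto simp: admissible_phases_def)
    obtain \<Theta> where \<Theta>: "\<Theta> \<in> gauges (Ham a)" "gauge_potential m \<Theta> \<in> borel_measurable lebesgue"
      "gauge_energy m \<Theta> = phase_energy m a \<delta>"
      using gauge_of_phase[OF a \<delta>(1)] by blast
    then have "potential_in_L2 m \<Theta>"
      using \<delta>(2) by (simp add: potential_in_L2_def phase_energy_def ennreal_mult_less_top)
    then have "optimal_energy m (Ham a) \<le> gauge_energy m \<Theta>"
      unfolding optimal_energy_def using \<Theta>(1) by (intro INF_lower) simp
    then show "optimal_energy m (Ham a) \<le> 2 * phase_integral m a \<delta>" by (simp add: \<Theta>(3) phase_energy_def)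
  qed simp
  then have "2 * (optimal_energy m (Ham a) / 2) \<le> 2 * (INF \<delta>\<in>admissible_phases m a. phase_integral m a \<delta>)"
    by (rule mult_left_mono) simp
  then show "optimal_energy m (Ham a) \<le> 2 * (INF \<delta>\<in>admissible_phases m a. phase_integral m a \<delta>)"
    by (simp add: ennreal_times_divide ennreal_mult_divide_eq mult.commute[of 2])
qed

subsection \<open>The positive lift\<close>

lemma abs_sinh_le:
  fixes x :: real
  assumes "\<bar>x\<bar> \<le> K"
  shows "\<bar>sinh x\<bar> \<le> cosh K * \<bar>x\<bar>"
proof -
  have "norm (sinh x - sinh 0) \<le> cosh K * norm (x - 0)"
  proof (rule field_differentiable_bound[of "{-K..K}" sinh cosh])
    fix z assume z: "z \<in> {-K..K}"
    show "(sinh has_field_derivative cosh z) (at z within {-K..K})"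
      by (auto intro!: derivative_eq_intros)
    have "cosh \<bar>z\<bar> \<le> cosh K" using z by (subst cosh_real_nonneg_le_iff) auto
    then show "norm (cosh z) \<le> cosh K" by simp
  qed (use assms in auto)
  then show ?thesis by simp
qed

text \<open>For nonnegative arguments cosh - sinh is exp(-x), at most 1; evenness covers the
  rest.\<close>

lemma cosh_minus_1_le_abs_sinh: "cosh x - 1 \<le> \<bar>sinh (x :: real)\<bar>"
proof -
  have "cosh \<bar>x\<bar> - sinh \<bar>x\<bar> = exp (- \<bar>x\<bar>)" by (rule cosh_minus_sinh)
  moreover have "exp (- \<bar>x\<bar>) \<le> 1" by simp
  ultimately have "cosh \<bar>x\<bar> - sinh \<bar>x\<bar> \<le> 1" by (rule ord_eq_le_trans)
  then show ?thesis by simp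
qed

text \<open>Boundedness of \<open>a\<close> enters here: for |a| at most C, sinh 2a is dominated by
  2 cosh(2C) times |a|, which is square integrable.\<close>

lemma H1_Linf_sinh:
  assumes a: "a \<in> H1" "a \<in> Linf"
  shows "integrable lebesgue (\<lambda>t. (sinh (2 * a t))\<^sup>2)"
proof -
  obtain C where C: "AE t in lebesgue. \<bar>a t\<bar> \<le> C" using a(2) unfolding Linf_def by blast
  have [measurable]: "a \<in> borel_measurable lebesgue" using a(2) unfolding Linf_def by blast
  have "integrable lebesgue (\<lambda>t. (a t)\<^sup>2)" using a(1) by (simp add: H1_def L2_def)
  then have "integrable lebesgue (\<lambda>t. (2 * cosh (2 * C))\<^sup>2 * (a t)\<^sup>2)" by simp
  then show ?thesis
  proof (rule Bochner_Integration.integrable_bound)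
    show "AE t in lebesgue. norm ((sinh (2 * a t))\<^sup>2) \<le> norm ((2 * cosh (2 * C))\<^sup>2 * (a t)\<^sup>2)"
      using C
    proof (rule eventually_mono)
      fix t assume "\<bar>a t\<bar> \<le> C"
      then have "\<bar>sinh (2 * a t)\<bar> \<le> cosh (2 * C) * \<bar>2 * a t\<bar>" by (intro abs_sinh_le) auto
      then have "\<bar>sinh (2 * a t)\<bar>\<^sup>2 \<le> (cosh (2 * C) * \<bar>2 * a t\<bar>)\<^sup>2" by (rule power_mono) simp
      then show "norm ((sinh (2 * a t))\<^sup>2) \<le> norm ((2 * cosh (2 * C))\<^sup>2 * (a t)\<^sup>2)"
        by (simp add: power_mult_distrib mult_ac)
    qed
  qed measurable
qed

lemma zero_phase_admissible:
  assumes a: "a \<in> H1" "a \<in> Linf"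
  shows "(\<lambda>_. 0) \<in> admissible_phases m a"
proof -
  have [measurable]: "a \<in> borel_measurable lebesgue" using a(2) unfolding Linf_def by blast
  have [measurable]: "wderiv a \<in> borel_measurable lebesgue" using H1_wderiv_L2[OF a(1)] unfolding L2_def by blast
  have "(\<lambda>_. 0) \<in> H1_loc"
  proof (rule H1_locI)
    show "indef_integral (\<lambda>_. 0 :: real) (\<lambda>_. 0)" by (simp add: indef_integral_def)
    show "(\<lambda>_. 0) \<in> L2_loc" by (rule L2_loc_continuous) simp
  qed simp
  moreover have "phase_integral m a (\<lambda>_. 0) < \<infinity>"
  proof -
    \<comment> \<open>At \<delta> = 0 the density is (m sinh 2a)^2 + (m (cosh 2a - 1))^2 + a'^2, and
      the middle square is at most the first.\<close>
    let ?g = "\<lambda>t. 2 * m\<^sup>2 * (sinh (2 * a t))\<^sup>2 + (wderiv a t)\<^sup>2"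
    have int: "integrable lebesgue ?g"
      using H1_Linf_sinh[OF a] H1_wderiv_L2[OF a(1)] by (simp add: L2_def)
    have "phase_integral m a (\<lambda>_. 0) \<le> (\<integral>\<^sup>+t. ennreal (?g t) \<partial>lebesgue)"
      unfolding phase_integral_eq
    proof (rule nn_integral_mono_AE)
      from wderiv_const[of 0]
      show "AE t in lebesgue. ennreal (phase_density m (a t) (wderiv a t) 0 (wderiv (\<lambda>_. 0) t)) \<le> ennreal (?g t)"
      proof (rule eventually_mono)
        fix t assume 0: "wderiv (\<lambda>_. 0 :: real) t = 0"
        have "(cosh (2 * a t) - 1)\<^sup>2 \<le> \<bar>sinh (2 * a t)\<bar>\<^sup>2"
          by (rule power_mono[OF cosh_minus_1_le_abs_sinh]) (simp add: cosh_real_ge_1)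
        then have "m\<^sup>2 * (cosh (2 * a t) - 1)\<^sup>2 \<le> m\<^sup>2 * (sinh (2 * a t))\<^sup>2" by (intro mult_left_mono) simp_all
        moreover have "(m * cosh (2 * a t) - m)\<^sup>2 = m\<^sup>2 * (cosh (2 * a t) - 1)\<^sup>2"
          by (simp add: power2_eq_square algebra_simps)
        ultimately show "ennreal (phase_density m (a t) (wderiv a t) 0 (wderiv (\<lambda>_. 0) t)) \<le> ennreal (?g t)"
          by (intro ennreal_leI) (simp add: phase_density_def 0 power_mult_distrib)
      qed
    qed
    also have "\<dots> < \<infinity>"
      using integrableD(2)[OF int] by (simp add: top.not_eq_extremum)
    finally show ?thesis .
  qed
  ultimately show ?thesis by (simp add: admissible_phases_def)
qed

lemma positive_lift_gauge:
  assumes a: "a \<in> H1" "a \<in> Linf"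
  shows "\<exists>\<Theta>\<in>gauges (Ham a). (AE t in lebesgue. \<Theta> t = inv_sqrt (Ham a t))
           \<and> potential_in_L2 m \<Theta> \<and> gauge_energy m \<Theta> = phase_energy m a (\<lambda>_. 0)"
proof -
  have 0: "(\<lambda>_. 0) \<in> H1_loc" "phase_integral m a (\<lambda>_. 0) < \<infinity>"
    using zero_phase_admissible[OF a, of m] by (auto simp: admissible_phases_def)
  obtain \<Theta> where \<Theta>: "\<Theta> \<in> gauges (Ham a)" "AE t in lebesgue. \<Theta> t = twist (a t) (cis 0) (cis (- 0))"
     "gauge_potential m \<Theta> \<in> borel_measurable lebesgue" "gauge_energy m \<Theta> = phase_energy m a (\<lambda>_. 0)"
    using gauge_of_phase[OF H1_subset_H1_loc[OF a(1)] 0(1), of m] by blast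
  moreover have "twist (a t) (cis 0) (cis (- 0)) = inv_sqrt (Ham a t)" for t
    by (simp add: inv_sqrt_Ham twist_eq hrot_def)
  moreover have "potential_in_L2 m \<Theta>"
    using \<Theta>(3,4) 0(2) by (simp add: potential_in_L2_def phase_energy_def ennreal_mult_less_top)
  ultimately show ?thesis by auto
qed

subsection \<open>First variation\<close>

lemma abs_sin_diff_le: "\<bar>sin (y + h) - sin y\<bar> \<le> \<bar>h :: real\<bar>"
proof -
  have "norm (sin (y + h) - sin y) \<le> 1 * norm (y + h - y)"
    by (rule field_differentiable_bound[of UNIV sin cos]) (auto intro!: derivative_eq_intros)
  then show ?thesis by simp
qed

lemma abs_cos_diff_le: "\<bar>cos (y + h) - cos y\<bar> \<le> \<bar>h :: real\<bar>"
proof -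
  have "norm (cos (y + h) - cos y) \<le> 1 * norm (y + h - y)"
    by (rule field_differentiable_bound[of UNIV cos "\<lambda>x. - sin x"]) (auto intro!: derivative_eq_intros)
  then show ?thesis by simp
qed

text \<open>The remainder as a function of the increment has derivative at most |h| on the interval
  from -|h| to |h|, so the mean value inequality yields h^2.\<close>

lemma sin_expansion: "\<bar>sin (y + h) - sin y - h * cos y\<bar> \<le> (h :: real)\<^sup>2"
proof -
  have "norm ((sin (y + h) - h * cos y) - (sin (y + 0) - 0 * cos y)) \<le> \<bar>h\<bar> * norm (h - 0)"
  proof (rule field_differentiable_bound[of "{-\<bar>h\<bar>..\<bar>h\<bar>}" "\<lambda>x. sin (y + x) - x * cos y" "\<lambda>x. cos (y + x) - cos y"])
    fix z assume "z \<in> {-\<bar>h\<bar>..\<bar>h\<bar>}"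
    then show "norm (cos (y + z) - cos y) \<le> \<bar>h\<bar>" using abs_cos_diff_le[of y z] by auto
  qed (auto intro!: derivative_eq_intros)
  then show ?thesis by (simp add: power2_eq_square algebra_simps)
qed

lemma cos_expansion: "\<bar>cos (y + h) - cos y + h * sin y\<bar> \<le> (h :: real)\<^sup>2"
proof -
  have "norm ((cos (y + h) + h * sin y) - (cos (y + 0) + 0 * sin y)) \<le> \<bar>h\<bar> * norm (h - 0)"
  proof (rule field_differentiable_bound[of "{-\<bar>h\<bar>..\<bar>h\<bar>}" "\<lambda>x. cos (y + x) + x * sin y" "\<lambda>x. sin y - sin (y + x)"])
    fix z assume "z \<in> {-\<bar>h\<bar>..\<bar>h\<bar>}"
    then show "norm (sin y - sin (y + z)) \<le> \<bar>h\<bar>" using abs_sin_diff_le[of y z] by auto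
  qed (auto intro!: derivative_eq_intros)
  then show ?thesis by (simp add: power2_eq_square algebra_simps)
qed

text \<open>The derivative at s = 0 of \<open>phase_density\<close> along d + s e and d' + s e',
  once the squares have been expanded.\<close>

definition variation_density :: "real \<Rightarrow> real \<Rightarrow> real \<Rightarrow> real \<Rightarrow> real \<Rightarrow> real \<Rightarrow> real \<Rightarrow> real" where
  "variation_density m x x' d d' e e' =
     2 * (d' + m * sinh (2 * x)) * e' + 4 * m * (m * cosh (2 * x) * sin (2 * d) + x' * cos (2 * d)) * e"

text \<open>The squares of sine and cosine in \<open>phase_density\<close> add up, so the phase enters the potential
  part only linearly in \<open>cos (2 d)\<close> and \<open>sin (2 d)\<close>.\<close>

lemma phase_density_expand:
  "phase_density m x x' d d' = (d' + m * sinh (2 * x))\<^sup>2 + (m * cosh (2 * x))\<^sup>2 + x'\<^sup>2 + m\<^sup>2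
     - 2 * m * (m * cosh (2 * x) * cos (2 * d) - x' * sin (2 * d))"
proof -
  define c where "c = m * cosh (2 * x)"
  define C where "C = cos (2 * d)"
  define S where "S = sin (2 * d)"
  have CS: "S * S = 1 - C * C" using sin_squared_eq[of "2 * d"] by (simp add: C_def S_def power2_eq_square)
  have "(c * C - x' * S - m)\<^sup>2 + (c * S + x' * C)\<^sup>2 = c\<^sup>2 + x'\<^sup>2 + m\<^sup>2 - 2 * m * (c * C - x' * S)"
    unfolding power2_eq_square using CS by algebra
  then show ?thesis by (simp add: phase_density_def c_def C_def S_def)
qed

text \<open>The remainder is exactly s^2 e'^2 - 2m (c u - x' v), where \<open>u\<close> and
  \<open>v\<close> are the Taylor remainders of cosine and sine for the increment h = 2 s e. The
  constant 8 is 2 times the 4 in h^2.\<close>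

lemma phase_density_variation:
  assumes m: "0 \<le> m"
  shows "\<bar>phase_density m x x' (d + s * e) (d' + s * e') - phase_density m x x' d d'
      - s * variation_density m x x' d d' e e'\<bar>
    \<le> s\<^sup>2 * (e'\<^sup>2 + 8 * m * ((m * cosh (2 * x) + \<bar>x'\<bar>) * e\<^sup>2))"
proof -
  define h where "h = 2 * s * e"
  define c where "c = m * cosh (2 * x)"
  define u where "u = cos (2 * d + h) - cos (2 * d) + h * sin (2 * d)"
  define v where "v = sin (2 * d + h) - sin (2 * d) - h * cos (2 * d)"
  have arg: "2 * (d + s * e) = 2 * d + h" by (simp add: h_def algebra_simps)
  have "phase_density m x x' (d + s * e) (d' + s * e') - phase_density m x x' d d'
      - s * variation_density m x x' d d' e e' = s\<^sup>2 * e'\<^sup>2 - 2 * m * (c * u - x' * v)"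
    unfolding phase_density_expand variation_density_def arg u_def v_def h_def c_def
    by (simp add: power2_eq_square algebra_simps)
  also have "\<bar>\<dots>\<bar> \<le> s\<^sup>2 * e'\<^sup>2 + 2 * m * (c * h\<^sup>2 + \<bar>x'\<bar> * h\<^sup>2)"
  proof -
    have c: "c \<ge> 0" using m by (simp add: c_def cosh_real_nonneg)
    have "\<bar>u\<bar> \<le> h\<^sup>2" "\<bar>v\<bar> \<le> h\<^sup>2"
      unfolding u_def v_def by (rule cos_expansion, rule sin_expansion)
    then have "c * \<bar>u\<bar> \<le> c * h\<^sup>2" "\<bar>x'\<bar> * \<bar>v\<bar> \<le> \<bar>x'\<bar> * h\<^sup>2"
      using c by (auto intro: mult_left_mono)
    moreover have "\<bar>c * u - x' * v\<bar> \<le> c * \<bar>u\<bar> + \<bar>x'\<bar> * \<bar>v\<bar>"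
      using c by (intro order_trans[OF abs_triangle_ineq4]) (simp add: abs_mult)
    ultimately have "\<bar>c * u - x' * v\<bar> \<le> c * h\<^sup>2 + \<bar>x'\<bar> * h\<^sup>2" by linarith
    then have "2 * m * \<bar>c * u - x' * v\<bar> \<le> 2 * m * (c * h\<^sup>2 + \<bar>x'\<bar> * h\<^sup>2)"
      using m by (intro mult_left_mono) auto
    moreover have "\<bar>s\<^sup>2 * e'\<^sup>2 - 2 * m * (c * u - x' * v)\<bar> \<le> s\<^sup>2 * e'\<^sup>2 + 2 * m * \<bar>c * u - x' * v\<bar>"
      using m by (intro order_trans[OF abs_triangle_ineq4]) (simp add: abs_mult)
    ultimately show ?thesis by linarith
  qed
  also have "\<dots> = s\<^sup>2 * (e'\<^sup>2 + 8 * m * ((c + \<bar>x'\<bar>) * e\<^sup>2))"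
    by (simp add: h_def power2_eq_square algebra_simps)
  finally show ?thesis by (simp add: c_def)
qed

lemma continuous_AE_zero:
  fixes F :: "real \<Rightarrow> real"
  assumes F: "continuous_on UNIV F" and zero: "AE t in lebesgue. t \<notin> {c..d} \<longrightarrow> F t = 0" and t: "t \<notin> {c..d}"
  shows "F t = 0"
proof (rule ccontr)
  assume "F t \<noteq> 0"
  then have ne: "{t. F t \<noteq> 0} \<inter> - {c..d} \<noteq> {}" using t by blast
  have "open {t. F t \<noteq> 0}" by (rule open_Collect_neq[OF F continuous_on_const])
  then have op: "open ({t. F t \<noteq> 0} \<inter> - {c..d})" by (intro open_Int open_Compl) auto
  obtain N where N: "negligible N" "\<forall>t. t \<notin> N \<longrightarrow> (t \<notin> {c..d} \<longrightarrow> F t = 0)"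
    using zero unfolding AE_lebesgue_negligible by blast
  have "negligible ({t. F t \<noteq> 0} \<inter> - {c..d})"
    by (rule negligible_subset[OF N(1)]) (use N(2) in blast)
  with open_not_negligible[OF op ne] show False by blast
qed

text \<open>Integration by parts wants a boundary value at a point, so vanishing off the support is
  transferred from \<eta> to its continuous representative.\<close>

lemma H1_loc_compact_support:
  assumes \<eta>: "\<eta> \<in> H1_loc" and supp: "compactly_supported \<eta>"
  shows "\<exists>E c d. indef_integral E (wderiv \<eta>) \<and> (AE t in lebesgue. \<eta> t = E t) \<and> (\<forall>t. t \<notin> {c..d} \<longrightarrow> E t = 0)"
proof -
  obtain E where E: "indef_integral E (wderiv \<eta>)" and eq: "AE t in lebesgue. \<eta> t = E t"
    by (rule H1_loc_indef_integral[OF \<eta>])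
  obtain c d where cd: "\<forall>t. t \<notin> {c..d} \<longrightarrow> \<eta> t = 0" using supp unfolding compactly_supported_iff by blast
  have "AE t in lebesgue. t \<notin> {c..d} \<longrightarrow> E t = 0"
    using eq by (rule eventually_mono) (use cd in auto)
  then have "\<forall>t. t \<notin> {c..d} \<longrightarrow> E t = 0"
    using continuous_AE_zero[OF indef_integral_continuous[OF E]] by blast
  with E eq show ?thesis by blast
qed

lemma loc_integrable_continuous_mult:
  fixes f k :: "real \<Rightarrow> real"
  shows "continuous_on UNIV k \<Longrightarrow> loc_integrable f \<Longrightarrow> loc_integrable (\<lambda>t. k t * f t)"
  by (rule loc_integrable_bilinear[OF bounded_bilinear_mult])

text \<open>Integrates the pointwise expansion; the constant is twice the integral of
  \<open>R\<close>. The factor 2 before \<open>L\<close> appears because the energy is twice the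
  phase integral.\<close>

lemma phase_energy_variation:
  assumes m: "0 \<le> m" and a: "a \<in> H1_loc" and \<delta>: "\<delta> \<in> admissible_phases m a"
    and \<eta>: "\<eta> \<in> H1_loc" and supp: "compactly_supported \<eta>"
  defines "L \<equiv> (LINT t|lebesgue. variation_density m (a t) (wderiv a t) (\<delta> t) (wderiv \<delta> t) (\<eta> t) (wderiv \<eta> t))"
  shows "\<exists>C. \<forall>s. phase_energy m a (\<lambda>t. \<delta> t + s * \<eta> t) < \<infinity> \<and>
     \<bar>enn2real (phase_energy m a (\<lambda>t. \<delta> t + s * \<eta> t)) - enn2real (phase_energy m a \<delta>) - s * (2 * L)\<bar> \<le> C * s\<^sup>2"
proof -
  have \<delta>H: "\<delta> \<in> H1_loc" and fin: "phase_integral m a \<delta> < \<infinity>" using \<delta> by (auto simp: admissible_phases_def)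
  obtain X where X: "indef_integral X (wderiv a)" and aX: "AE t in lebesgue. a t = X t"
    by (rule H1_loc_indef_integral[OF a])
  obtain D where D: "indef_integral D (wderiv \<delta>)" and \<delta>D: "AE t in lebesgue. \<delta> t = D t"
    by (rule H1_loc_indef_integral[OF \<delta>H])
  obtain E c d where E: "indef_integral E (wderiv \<eta>)" and \<eta>E: "AE t in lebesgue. \<eta> t = E t"
    and E0: "\<forall>t. t \<notin> {c..d} \<longrightarrow> E t = 0"
    using H1_loc_compact_support[OF \<eta> supp] by blast
  note [measurable] = H1_loc_measurable[OF a] H1_loc_measurable[OF \<delta>H] H1_loc_measurable[OF \<eta>]
  have cX: "continuous_on UNIV X" and cD: "continuous_on UNIV D" and cE: "continuous_on UNIV E"
    by (intro indef_integral_continuous[OF X] indef_integral_continuous[OF D] indef_integral_continuous[OF E])+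
  have [measurable]: "X \<in> borel_measurable lebesgue" "D \<in> borel_measurable lebesgue" "E \<in> borel_measurable lebesgue"
    by (intro borel_measurable_continuous_lebesgue cX cD cE)+
  define \<rho> where "\<rho> s t = phase_density m (X t) (wderiv a t) (D t + s * E t) (wderiv \<delta> t + s * wderiv \<eta> t)" for s t
  define l where "l t = variation_density m (X t) (wderiv a t) (D t) (wderiv \<delta> t) (E t) (wderiv \<eta> t)" for t
  define R where "R t = (wderiv \<eta> t)\<^sup>2 + 8 * m * ((E t)\<^sup>2 * (m * cosh (2 * X t) + \<bar>wderiv a t\<bar>))" for t
  have \<rho>_meas: "\<rho> s \<in> borel_measurable lebesgue" for s
    unfolding \<rho>_def[abs_def] by (intro phase_density_measurable) measurable
  have l_meas: "l \<in> borel_measurable lebesgue"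
    unfolding l_def[abs_def] variation_density_def by measurable
  have \<rho>_nonneg: "0 \<le> \<rho> s t" for s t by (simp add: \<rho>_def phase_density_nonneg)
  have int_eq: "phase_integral m a (\<lambda>t. \<delta> t + s * \<eta> t) = (\<integral>\<^sup>+t. ennreal (\<rho> s t) \<partial>lebesgue)" for s
  proof -
    have "indef_integral (\<lambda>t. D t - (- s) * E t) (\<lambda>t. wderiv \<delta> t - (- s) * wderiv \<eta> t)"
      by (rule indef_integral_diff[OF D indef_integral_cmult[OF E]])
    then have "indef_integral (\<lambda>t. D t + s * E t) (\<lambda>t. wderiv \<delta> t + s * wderiv \<eta> t)" by simp
    moreover have "AE t in lebesgue. \<delta> t + s * \<eta> t = D t + s * E t"
      using \<delta>D \<eta>E by eventually_elim simp
    ultimately have "has_weak_deriv (\<lambda>t. \<delta> t + s * \<eta> t) (\<lambda>t. wderiv \<delta> t + s * wderiv \<eta> t)"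
      unfolding has_weak_deriv_iff by (intro exI[of _ "\<lambda>t. D t + s * E t"] conjI)
    note wd = wderiv_AE[OF this]
    show ?thesis
      unfolding phase_integral_eq
    proof (rule nn_integral_cong_AE)
      show "AE t in lebesgue. ennreal (phase_density m (a t) (wderiv a t) (\<delta> t + s * \<eta> t) (wderiv (\<lambda>t. \<delta> t + s * \<eta> t) t))
          = ennreal (\<rho> s t)"
        using wd aX \<delta>D \<eta>E by eventually_elim (simp add: \<rho>_def)
    qed
  qed
  have \<eta>'0: "AE t in lebesgue. t \<notin> {c..d} \<longrightarrow> wderiv \<eta> t = 0"
    using indef_integral_by_parts(4)[OF E _ E] E0 by blast
  have lx: "loc_integrable (wderiv a)" by (rule loc_integrable_indef_integral[OF X])
  have labs: "loc_integrable (\<lambda>t. m * cosh (2 * X t) + \<bar>wderiv a t\<bar>)"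
  proof (rule loc_integrable_add)
    show "loc_integrable (\<lambda>t. m * cosh (2 * X t))"
      by (rule loc_integrable_continuous) (intro continuous_intros cX)
    show "loc_integrable (\<lambda>t. \<bar>wderiv a t\<bar>)"
      using lx unfolding loc_integrable_def by (blast intro: set_integrable_abs)
  qed
  have int_\<eta>'2: "integrable lebesgue (\<lambda>t. (wderiv \<eta> t)\<^sup>2)"
  proof (rule loc_integrable_support)
    show "loc_integrable (\<lambda>t. (wderiv \<eta> t)\<^sup>2)" using H1_loc_weak_deriv(2)[OF \<eta>] unfolding L2_loc_iff by blast
    show "AE t in lebesgue. t \<notin> {c..d} \<longrightarrow> (wderiv \<eta> t)\<^sup>2 = 0" using \<eta>'0 by (rule eventually_mono) simp
  qed
  \<comment> \<open>A continuous factor that vanishes wherever \<open>E\<close> does has compact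
    support, so local integrability of the other factor is enough.\<close>
  have E_int: "integrable lebesgue (\<lambda>t. k t * f t)"
    if "continuous_on UNIV k" "\<And>t. E t = 0 \<Longrightarrow> k t = 0" "loc_integrable f" for k f :: "real \<Rightarrow> real"
    by (rule loc_integrable_support[OF loc_integrable_continuous_mult[OF that(1,3)], of c d]) (use E0 that(2) in simp)
  have int_E2: "integrable lebesgue (\<lambda>t. (E t)\<^sup>2 * (m * cosh (2 * X t) + \<bar>wderiv a t\<bar>))"
    by (intro E_int labs continuous_intros cE) simp
  have R_int: "integrable lebesgue R"
    unfolding R_def[abs_def]
    by (rule Bochner_Integration.integrable_add[OF int_\<eta>'2 integrable_mult_right[OF int_E2]])
  have \<rho>0_int: "integrable lebesgue (\<rho> 0)"
  proof (rule integrableI_bounded[OF \<rho>_meas])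
    show "(\<integral>\<^sup>+t. ennreal (norm (\<rho> 0 t)) \<partial>lebesgue) < \<infinity>"
      using fin int_eq[of 0] \<rho>_nonneg by simp
  qed
  have l_int: "integrable lebesgue l"
  proof -
    have "integrable lebesgue (\<lambda>t. (wderiv \<delta> t + m * sinh (2 * X t)) * wderiv \<eta> t)"
    proof (rule Bochner_Integration.integrable_bound[OF Bochner_Integration.integrable_add[OF \<rho>0_int int_\<eta>'2]])
      \<comment> \<open>Used with the first square of the density as p^2: the term \<delta>' + m
        sinh 2a is controlled by the finite energy of \<delta>.\<close>
      have "\<bar>p * q\<bar> \<le> p\<^sup>2 + q\<^sup>2" for p q :: real
      proof -
        have "0 \<le> (\<bar>p\<bar> - \<bar>q\<bar>)\<^sup>2" by simp
        then have "2 * (\<bar>p\<bar> * \<bar>q\<bar>) \<le> p\<^sup>2 + q\<^sup>2" by (simp add: power2_diff mult_ac)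
        moreover have "0 \<le> \<bar>p\<bar> * \<bar>q\<bar>" by simp
        ultimately show ?thesis unfolding abs_mult by linarith
      qed
      note pq = this
      have "\<bar>(wderiv \<delta> t + m * sinh (2 * X t)) * wderiv \<eta> t\<bar> \<le> \<rho> 0 t + (wderiv \<eta> t)\<^sup>2" for t
        using pq[of "wderiv \<delta> t + m * sinh (2 * X t)" "wderiv \<eta> t"]
        by (rule order_trans) (simp add: \<rho>_def phase_density_def)
      then show "AE t in lebesgue. norm ((wderiv \<delta> t + m * sinh (2 * X t)) * wderiv \<eta> t) \<le> norm (\<rho> 0 t + (wderiv \<eta> t)\<^sup>2)"
        by (simp add: \<rho>_nonneg)
    qed measurable
    moreover have "integrable lebesgue (\<lambda>t. E t * (m * cosh (2 * X t) * sin (2 * D t) + cos (2 * D t) * wderiv a t))"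
      by (intro E_int loc_integrable_add loc_integrable_continuous loc_integrable_continuous_mult lx
          continuous_intros cX cD cE)
    ultimately have "integrable lebesgue (\<lambda>t. 2 * ((wderiv \<delta> t + m * sinh (2 * X t)) * wderiv \<eta> t)
        + 4 * m * (E t * (m * cosh (2 * X t) * sin (2 * D t) + cos (2 * D t) * wderiv a t)))"
      by (intro Bochner_Integration.integrable_add integrable_mult_right)
    then show ?thesis unfolding l_def[abs_def] variation_density_def by (simp add: mult_ac)
  qed
  have L_eq: "L = (LINT t|lebesgue. l t)"
    unfolding L_def
  proof (rule integral_cong_AE)
    show "AE t in lebesgue. variation_density m (a t) (wderiv a t) (\<delta> t) (wderiv \<delta> t) (\<eta> t) (wderiv \<eta> t) = l t"
      using aX \<delta>D \<eta>E by eventually_elim (simp add: l_def)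
    show "(\<lambda>t. variation_density m (a t) (wderiv a t) (\<delta> t) (wderiv \<delta> t) (\<eta> t) (wderiv \<eta> t)) \<in> borel_measurable lebesgue"
      unfolding variation_density_def by measurable
  qed (rule l_meas)
  have rem: "\<bar>\<rho> s t - \<rho> 0 t - s * l t\<bar> \<le> s\<^sup>2 * R t" for s t
    using phase_density_variation[OF m, of "X t" "wderiv a t" "D t" s "E t" "wderiv \<delta> t" "wderiv \<eta> t"]
    unfolding \<rho>_def l_def R_def mult.commute[of "(E t)\<^sup>2"] by simp
  have rem_int: "integrable lebesgue (\<lambda>t. \<rho> s t - \<rho> 0 t - s * l t)" for s
  proof (rule Bochner_Integration.integrable_bound[OF integrable_mult_right[OF R_int, of "s\<^sup>2"]])
    show "(\<lambda>t. \<rho> s t - \<rho> 0 t - s * l t) \<in> borel_measurable lebesgue"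
      using \<rho>_meas l_meas by (intro borel_measurable_diff borel_measurable_times borel_measurable_const)
    have "\<bar>\<rho> s t - \<rho> 0 t - s * l t\<bar> \<le> \<bar>s\<^sup>2 * R t\<bar>" for t using rem[of s t] by linarith
    then show "AE t in lebesgue. norm (\<rho> s t - \<rho> 0 t - s * l t) \<le> norm (s\<^sup>2 * R t)" by simp
  qed
  \<comment> \<open>The perturbed density is recovered from remainder, base density and linear term;
    this is what shows the perturbed energy to be finite.\<close>
  have \<rho>_int: "integrable lebesgue (\<rho> s)" for s
  proof -
    have "integrable lebesgue (\<lambda>t. (\<rho> s t - \<rho> 0 t - s * l t) + \<rho> 0 t + s * l t)"
      by (intro Bochner_Integration.integrable_add rem_int \<rho>0_int integrable_mult_right l_int)
    then show ?thesis by simp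
  qed
  have energy: "phase_energy m a (\<lambda>t. \<delta> t + s * \<eta> t) = ennreal (2 * (LINT t|lebesgue. \<rho> s t))" for s
    unfolding phase_energy_def int_eq
    using nn_integral_eq_integral[OF \<rho>_int[of s]] \<rho>_nonneg by (simp add: ennreal_mult')
  have nn: "0 \<le> (LINT t|lebesgue. \<rho> s t)" for s by (rule integral_nonneg_AE) (simp add: \<rho>_nonneg)
  have "\<bar>2 * (LINT t|lebesgue. \<rho> s t) - 2 * (LINT t|lebesgue. \<rho> 0 t) - s * (2 * L)\<bar> \<le> (2 * (LINT t|lebesgue. R t)) * s\<^sup>2" for s
  proof -
    have "(LINT t|lebesgue. \<rho> s t - \<rho> 0 t - s * l t) = (LINT t|lebesgue. \<rho> s t) - (LINT t|lebesgue. \<rho> 0 t) - s * L"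
      unfolding L_eq using \<rho>_int l_int by simp
    moreover have "\<bar>LINT t|lebesgue. \<rho> s t - \<rho> 0 t - s * l t\<bar> \<le> (LINT t|lebesgue. s\<^sup>2 * R t)"
      using Bochner_Integration.integral_norm_bound_integral[OF rem_int integrable_mult_right[OF R_int, of "s\<^sup>2"], of s] rem by simp
    ultimately show ?thesis by (simp add: mult_ac)
  qed
  then show ?thesis
    using energy energy[of 0] nn by (intro exI[of _ "2 * (LINT t|lebesgue. R t)"]) simp
qed

text \<open>The quadratic error makes the difference quotient differ from twice the integral by at
  most C |h|, so the derivative at 0 exists and vanishes exactly when the integral does.\<close>

lemma critical_phase_iff:
  assumes m: "0 \<le> m" and a: "a \<in> H1_loc"
  shows "critical_phase m a \<delta> \<longleftrightarrow> \<delta> \<in> admissible_phases m a \<and>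
     (\<forall>\<eta>\<in>H1_loc. compactly_supported \<eta> \<longrightarrow>
        (LINT t|lebesgue. variation_density m (a t) (wderiv a t) (\<delta> t) (wderiv \<delta> t) (\<eta> t) (wderiv \<eta> t)) = 0)"
proof -
  have "((\<lambda>s. enn2real (phase_energy m a (\<lambda>t. \<delta> t + s * \<eta> t))) has_real_derivative 0) (at 0)
      \<longleftrightarrow> (LINT t|lebesgue. variation_density m (a t) (wderiv a t) (\<delta> t) (wderiv \<delta> t) (\<eta> t) (wderiv \<eta> t)) = 0"
    if \<delta>: "\<delta> \<in> admissible_phases m a" and \<eta>: "\<eta> \<in> H1_loc" "compactly_supported \<eta>" for \<eta>
  proof -
    define L where "L = (LINT t|lebesgue. variation_density m (a t) (wderiv a t) (\<delta> t) (wderiv \<delta> t) (\<eta> t) (wderiv \<eta> t))"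
    define e where "e s = enn2real (phase_energy m a (\<lambda>t. \<delta> t + s * \<eta> t))" for s
    obtain C where C: "\<bar>e s - e 0 - s * (2 * L)\<bar> \<le> C * s\<^sup>2" for s
      using phase_energy_variation[OF m a \<delta> \<eta>] unfolding e_def L_def by auto
    have "((\<lambda>h. (e (0 + h) - e 0) / h - 2 * L) \<longlongrightarrow> 0) (at 0)"
    proof (rule Lim_null_comparison)
      have "norm ((e (0 + h) - e 0) / h - 2 * L) \<le> C * \<bar>h\<bar>" if "h \<noteq> 0" for h
      proof -
        have "(e (0 + h) - e 0) / h - 2 * L = (e h - e 0 - h * (2 * L)) / h" using that by (simp add: field_simps)
        then have "norm ((e (0 + h) - e 0) / h - 2 * L) = \<bar>e h - e 0 - h * (2 * L)\<bar> / \<bar>h\<bar>" by simp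
        also have "\<dots> \<le> C * h\<^sup>2 / \<bar>h\<bar>" using C[of h] by (rule divide_right_mono) simp
        also have "\<dots> = C * \<bar>h\<bar>" using that by (simp add: power2_eq_square field_simps abs_if)
        finally show ?thesis .
      qed
      then show "\<forall>\<^sub>F h in at 0. norm ((e (0 + h) - e 0) / h - 2 * L) \<le> C * \<bar>h\<bar>"
        by (auto simp: eventually_at_filter)
      show "((\<lambda>h. C * \<bar>h\<bar>) \<longlongrightarrow> 0) (at 0)" by (auto intro!: tendsto_eq_intros)
    qed
    then have "(e has_real_derivative 2 * L) (at 0)"
      unfolding DERIV_def by (simp add: LIM_zero_iff)
    then have "(e has_real_derivative 0) (at 0) \<longleftrightarrow> L = 0"
      using DERIV_unique[of e 0 0 "2 * L"] by auto
    then show ?thesis unfolding e_def L_def .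
  qed
  then show ?thesis unfolding critical_phase_def by blast
qed

section \<open>The Euler-Lagrange equation\<close>

lemma test_function_H1_loc:
  assumes "test_function \<phi>"
  shows "\<phi> \<in> H1_loc" "compactly_supported \<phi>" "AE t in lebesgue. wderiv \<phi> t = deriv \<phi> t"
proof -
  have sm: "smooth \<phi>" and "compactly_supported \<phi>" using assms by (auto simp: test_function_iff)
  then show "compactly_supported \<phi>" by blast
  have ii: "indef_integral \<phi> (deriv \<phi>)" by (rule smooth_indef_integral[OF sm])
  have "deriv \<phi> \<in> L2_loc"
    by (intro L2_loc_continuous loc_abs_cont_continuous smooth_loc_abs_cont smooth_deriv sm)
  then show "\<phi> \<in> H1_loc" by (rule H1_locI[OF ii]) simp
  show "AE t in lebesgue. wderiv \<phi> t = deriv \<phi> t"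
    by (rule wderiv_AE) (use ii in \<open>auto simp: has_weak_deriv_iff\<close>)
qed

lemma indef_integral_sinh:
  fixes X :: "real \<Rightarrow> real"
  assumes X: "indef_integral X x'"
  shows "indef_integral (\<lambda>t. sinh (2 * X t)) (\<lambda>t. 2 * cosh (2 * X t) * x' t)"
proof (rule indef_integral_loc_abs_contI)
  show "loc_abs_cont (\<lambda>t. sinh (2 * X t))"
    by (rule loc_abs_cont_compose[OF indef_integral_loc_abs_cont[OF X], of "\<lambda>x. sinh (2 * x)" "\<lambda>x. 2 * cosh (2 * x)"])
      (auto intro!: derivative_eq_intros continuous_intros)
  from indef_integral_AE_deriv[OF X]
  show "AE t in lebesgue. ((\<lambda>t. sinh (2 * X t)) has_vector_derivative 2 * cosh (2 * X t) * x' t) (at t)"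
  proof (rule eventually_mono)
    fix t assume "(X has_vector_derivative x' t) (at t)"
    then have "(X has_real_derivative x' t) (at t)" by (simp add: has_real_derivative_iff_has_vector_derivative)
    then have "((\<lambda>t. sinh (2 * X t)) has_real_derivative 2 * cosh (2 * X t) * x' t) (at t)"
      by (auto intro!: derivative_eq_intros)
    then show "((\<lambda>t. sinh (2 * X t)) has_vector_derivative 2 * cosh (2 * X t) * x' t) (at t)"
      by (simp add: has_real_derivative_iff_has_vector_derivative)
  qed
qed

lemma has_weak_deriv_cong_AE:
  fixes f :: "real \<Rightarrow> 'a::euclidean_space"
  assumes "has_weak_deriv f g" "AE t in lebesgue. g t = h t"
  shows "has_weak_deriv f h"
  using assms unfolding has_weak_deriv_iff by (blast intro: indef_integral_cong_AE)

text \<open>Test functions are admissible directions. Integration by parts moves the derivative from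
  the test function to sinh 2a, and what is left is the definition of the weak derivative of
  \<delta>'.\<close>

lemma critical_phase_Euler_Lagrange:
  assumes m: "0 \<le> m" and a: "a \<in> H1_loc" and crit: "critical_phase m a \<delta>"
  shows "has_weak_deriv (wderiv \<delta>)
     (\<lambda>t. - (2 * m * wderiv a t * cosh (2 * a t)
             - 2 * m\<^sup>2 * cosh (2 * a t) * sin (2 * \<delta> t)
             - 2 * m * wderiv a t * cos (2 * \<delta> t)))"
proof -
  have \<delta>: "\<delta> \<in> H1_loc" and zero: "\<And>\<eta>. \<eta> \<in> H1_loc \<Longrightarrow> compactly_supported \<eta> \<Longrightarrow>
     (LINT t|lebesgue. variation_density m (a t) (wderiv a t) (\<delta> t) (wderiv \<delta> t) (\<eta> t) (wderiv \<eta> t)) = 0"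
    using crit unfolding critical_phase_iff[OF m a] by (auto simp: admissible_phases_def)
  obtain X where X: "indef_integral X (wderiv a)" and aX: "AE t in lebesgue. a t = X t"
    by (rule H1_loc_indef_integral[OF a])
  obtain D where D: "indef_integral D (wderiv \<delta>)" and \<delta>D: "AE t in lebesgue. \<delta> t = D t"
    by (rule H1_loc_indef_integral[OF \<delta>])
  note meas[measurable] = H1_loc_measurable[OF a] H1_loc_measurable[OF \<delta>]
  have cX: "continuous_on UNIV X" and cD: "continuous_on UNIV D"
    by (intro indef_integral_continuous[OF X] indef_integral_continuous[OF D])+
  have la: "loc_integrable (wderiv a)" by (rule loc_integrable_indef_integral[OF X])
  have l\<delta>: "loc_integrable (wderiv \<delta>)" by (rule loc_integrable_indef_integral[OF D])
  define S where "S t = sinh (2 * X t)" for t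
  define S' where "S' t = 2 * cosh (2 * X t) * wderiv a t" for t
  define g where "g t = m * cosh (2 * X t) * sin (2 * D t) + cos (2 * D t) * wderiv a t" for t
  have S: "indef_integral S S'" unfolding S_def[abs_def] S'_def[abs_def] by (rule indef_integral_sinh[OF X])
  have lg: "loc_integrable g"
    unfolding g_def[abs_def]
    by (intro loc_integrable_add loc_integrable_continuous loc_integrable_continuous_mult la continuous_intros cX cD)
  have lS: "loc_integrable S'" by (rule loc_integrable_indef_integral[OF S])
  have lG: "loc_integrable (\<lambda>t. 2 * m * g t - m * S' t)"
    by (intro loc_integrable_diff loc_integrable_continuous_mult continuous_on_const lg lS)
  \<comment> \<open>The term in \<open>g\<close> comes from the potential part and the one in
    \<open>S'\<close> from integrating by parts, after dividing the first variation by 2.\<close>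
  have "has_weak_deriv (wderiv \<delta>) (\<lambda>t. 2 * m * g t - m * S' t)"
    unfolding has_weak_deriv_def
  proof (intro conjI allI impI l\<delta> lG)
    fix \<phi> assume \<phi>: "test_function \<phi>"
    note \<phi>H = test_function_H1_loc[OF \<phi>]
    obtain c d where cd: "\<forall>t. t \<notin> {c..d} \<longrightarrow> \<phi> t = 0" by (rule test_function_support[OF \<phi>])
    have ii: "indef_integral \<phi> (deriv \<phi>)"
      using \<phi> by (intro smooth_indef_integral) (simp add: test_function_iff)
    note parts = indef_integral_by_parts[OF ii _ S, of c d]
    have iS: "integrable lebesgue (\<lambda>t. deriv \<phi> t * S t)" "integrable lebesgue (\<lambda>t. \<phi> t * S' t)"
      and pS: "(LINT t|lebesgue. deriv \<phi> t * S t) = - (LINT t|lebesgue. \<phi> t * S' t)"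
      using parts cd by auto
    have i1: "integrable lebesgue (\<lambda>t. deriv \<phi> t * wderiv \<delta> t)"
      using test_function_integrable[OF l\<delta> test_function_deriv[OF \<phi>]] by simp
    have i3: "integrable lebesgue (\<lambda>t. \<phi> t * g t)"
      using test_function_integrable[OF lg \<phi>] by simp
    have "(LINT t|lebesgue. variation_density m (a t) (wderiv a t) (\<delta> t) (wderiv \<delta> t) (\<phi> t) (wderiv \<phi> t))
      = (LINT t|lebesgue. 2 * (deriv \<phi> t * wderiv \<delta> t) + 2 * m * (deriv \<phi> t * S t) + 4 * m * (\<phi> t * g t))"
    proof (rule integral_cong_AE)
      show "AE t in lebesgue. variation_density m (a t) (wderiv a t) (\<delta> t) (wderiv \<delta> t) (\<phi> t) (wderiv \<phi> t)
         = 2 * (deriv \<phi> t * wderiv \<delta> t) + 2 * m * (deriv \<phi> t * S t) + 4 * m * (\<phi> t * g t)"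
        using aX \<delta>D \<phi>H(3) by eventually_elim (simp add: variation_density_def S_def g_def algebra_simps)
      note [measurable] = H1_loc_measurable[OF \<phi>H(1)]
      show "(\<lambda>t. variation_density m (a t) (wderiv a t) (\<delta> t) (wderiv \<delta> t) (\<phi> t) (wderiv \<phi> t)) \<in> borel_measurable lebesgue"
        unfolding variation_density_def by measurable
    qed (intro borel_measurable_integrable Bochner_Integration.integrable_add integrable_mult_right i1 i3 iS)
    then have "2 * (LINT t|lebesgue. deriv \<phi> t * wderiv \<delta> t) - 2 * m * (LINT t|lebesgue. \<phi> t * S' t)
        + 4 * m * (LINT t|lebesgue. \<phi> t * g t) = 0"
      using zero[OF \<phi>H(1,2)] i1 i3 iS pS by simp
    moreover have "(LINT t|lebesgue. \<phi> t * (2 * m * g t - m * S' t)) = 2 * m * (LINT t|lebesgue. \<phi> t * g t) - m * (LINT t|lebesgue. \<phi> t * S' t)"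
    proof -
      have "(LINT t|lebesgue. \<phi> t * (2 * m * g t - m * S' t)) = (LINT t|lebesgue. 2 * m * (\<phi> t * g t) - m * (\<phi> t * S' t))"
        by (simp add: algebra_simps)
      also have "\<dots> = 2 * m * (LINT t|lebesgue. \<phi> t * g t) - m * (LINT t|lebesgue. \<phi> t * S' t)"
        by (subst Bochner_Integration.integral_diff) (intro integrable_mult_right i3 iS(2) | simp)+
      finally show ?thesis .
    qed
    ultimately show "(LINT t|lebesgue. deriv \<phi> t *\<^sub>R wderiv \<delta> t) = - (LINT t|lebesgue. \<phi> t *\<^sub>R (2 * m * g t - m * S' t))"
      by simp
  qed
  moreover have "AE t in lebesgue. 2 * m * g t - m * S' t = - (2 * m * wderiv a t * cosh (2 * a t)
             - 2 * m\<^sup>2 * cosh (2 * a t) * sin (2 * \<delta> t) - 2 * m * wderiv a t * cos (2 * \<delta> t))"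
    using aX \<delta>D by eventually_elim (simp add: g_def S'_def power2_eq_square algebra_simps)
  ultimately show ?thesis by (rule has_weak_deriv_cong_AE)
qed

subsection \<open>Stationarity of the positive lift\<close>

text \<open>At \<delta> = 0 the integrand is 2m sinh(2a) \<eta>' + 4m a' \<eta>. Integrating the
  first term by parts gives -4m a' cosh(2a) \<eta>, which combines with the second.\<close>

lemma variation_at_zero:
  assumes a: "a \<in> H1_loc" and \<eta>: "\<eta> \<in> H1_loc" and supp: "compactly_supported \<eta>"
  shows "(LINT t|lebesgue. variation_density m (a t) (wderiv a t) 0 (wderiv (\<lambda>_. 0) t) (\<eta> t) (wderiv \<eta> t))
    = - (4 * m * (LINT t|lebesgue. \<eta> t * (wderiv a t * (cosh (2 * a t) - 1))))"
proof -
  obtain X where X: "indef_integral X (wderiv a)" and aX: "AE t in lebesgue. a t = X t"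
    by (rule H1_loc_indef_integral[OF a])
  obtain E c d where E: "indef_integral E (wderiv \<eta>)" and \<eta>E: "AE t in lebesgue. \<eta> t = E t"
    and E0: "\<forall>t. t \<notin> {c..d} \<longrightarrow> E t = 0"
    using H1_loc_compact_support[OF \<eta> supp] by blast
  note [measurable] = H1_loc_measurable[OF a] H1_loc_measurable[OF \<eta>]
  define S where "S t = sinh (2 * X t)" for t
  define S' where "S' t = 2 * cosh (2 * X t) * wderiv a t" for t
  have S: "indef_integral S S'" unfolding S_def[abs_def] S'_def[abs_def] by (rule indef_integral_sinh[OF X])
  have iS: "integrable lebesgue (\<lambda>t. wderiv \<eta> t * S t)" "integrable lebesgue (\<lambda>t. E t * S' t)"
    and pS: "(LINT t|lebesgue. wderiv \<eta> t * S t) = - (LINT t|lebesgue. E t * S' t)"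
    using indef_integral_by_parts[OF E _ S, of c d] E0 by auto
  have iX: "integrable lebesgue (\<lambda>t. E t * wderiv a t)"
    using indef_integral_by_parts(2)[OF E _ X, of c d] E0 by auto
  have "(LINT t|lebesgue. variation_density m (a t) (wderiv a t) 0 (wderiv (\<lambda>_. 0) t) (\<eta> t) (wderiv \<eta> t))
      = (LINT t|lebesgue. 2 * m * (wderiv \<eta> t * S t) + 4 * m * (E t * wderiv a t))"
  proof (rule integral_cong_AE)
    show "AE t in lebesgue. variation_density m (a t) (wderiv a t) 0 (wderiv (\<lambda>_. 0) t) (\<eta> t) (wderiv \<eta> t)
        = 2 * m * (wderiv \<eta> t * S t) + 4 * m * (E t * wderiv a t)"
      using aX \<eta>E wderiv_const[of 0] by eventually_elim (simp add: variation_density_def S_def algebra_simps)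
    \<comment> \<open>Even for the zero function \<open>wderiv\<close> is a choice that is 0 only
      a.e.; Lebesgue measure is complete, so it is measurable.\<close>
    have [measurable]: "wderiv (\<lambda>_. 0 :: real) \<in> borel_measurable lebesgue"
    proof (rule borel_measurable_AE)
      show "AE t in lebesgue. 0 = wderiv (\<lambda>_. 0 :: real) t"
        using wderiv_const[of 0] by (rule eventually_mono) simp
    qed simp
    show "(\<lambda>t. variation_density m (a t) (wderiv a t) 0 (wderiv (\<lambda>_. 0) t) (\<eta> t) (wderiv \<eta> t)) \<in> borel_measurable lebesgue"
      unfolding variation_density_def by measurable
  qed (intro borel_measurable_integrable Bochner_Integration.integrable_add integrable_mult_right iX iS)
  also have "\<dots> = - (2 * m * (LINT t|lebesgue. E t * S' t)) + 4 * m * (LINT t|lebesgue. E t * wderiv a t)"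
    using iX iS pS by simp
  also have "\<dots> = (LINT t|lebesgue. - (2 * m) * (E t * S' t) + 4 * m * (E t * wderiv a t))"
    using iX iS by simp
  also have "\<dots> = (LINT t|lebesgue. - (4 * m) * (\<eta> t * (wderiv a t * (cosh (2 * a t) - 1))))"
  proof (rule integral_cong_AE)
    show "AE t in lebesgue. - (2 * m) * (E t * S' t) + 4 * m * (E t * wderiv a t)
        = - (4 * m) * (\<eta> t * (wderiv a t * (cosh (2 * a t) - 1)))"
      using aX \<eta>E by eventually_elim (simp add: S'_def algebra_simps)
    show "(\<lambda>t. - (2 * m) * (E t * S' t) + 4 * m * (E t * wderiv a t)) \<in> borel_measurable lebesgue"
      by (intro borel_measurable_integrable Bochner_Integration.integrable_add integrable_mult_right iX iS)
  qed measurable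
  finally show ?thesis by simp
qed

lemma loc_integrable_stationarity:
  assumes a: "a \<in> H1_loc"
  shows "loc_integrable (\<lambda>t. wderiv a t * (cosh (2 * a t) - 1))"
proof -
  obtain X where X: "indef_integral X (wderiv a)" and aX: "AE t in lebesgue. a t = X t"
    by (rule H1_loc_indef_integral[OF a])
  have "loc_integrable (\<lambda>t. (cosh (2 * X t) - 1) * wderiv a t)"
    by (intro loc_integrable_continuous_mult loc_integrable_indef_integral[OF X] continuous_intros
        indef_integral_continuous[OF X])
  then show ?thesis
    by (rule loc_integrable_cong_AE) (use aX in \<open>auto elim!: eventually_mono\<close>)
qed

text \<open>The fundamental lemma in contrapositive form; it provides a smooth direction in which
  the first variation at \<delta> = 0 is nonzero.\<close>

lemma not_stationary_test_function:
  assumes a: "a \<in> H1_loc" and "\<not> (AE t in lebesgue. wderiv a t * (cosh (2 * a t) - 1) = 0)"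
  shows "\<exists>\<phi>. test_function \<phi> \<and> (LINT t|lebesgue. \<phi> t * (wderiv a t * (cosh (2 * a t) - 1))) \<noteq> 0"
  using fundamental_lemma[OF loc_integrable_stationarity[OF a]] assms(2) by auto

lemma critical_zero_iff:
  assumes m: "0 < m" and a: "a \<in> H1" "a \<in> Linf"
  shows "critical_phase m a (\<lambda>_. 0) \<longleftrightarrow> (AE t in lebesgue. wderiv a t * (cosh (2 * a t) - 1) = 0)"
proof
  note aH = H1_subset_H1_loc[OF a(1)]
  have m0: "0 \<le> m" using m by simp
  show "AE t in lebesgue. wderiv a t * (cosh (2 * a t) - 1) = 0" if crit: "critical_phase m a (\<lambda>_. 0)"
  proof (rule ccontr)
    assume "\<not> (AE t in lebesgue. wderiv a t * (cosh (2 * a t) - 1) = 0)"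
    then obtain \<phi> where \<phi>: "test_function \<phi>" "(LINT t|lebesgue. \<phi> t * (wderiv a t * (cosh (2 * a t) - 1))) \<noteq> 0"
      using not_stationary_test_function[OF aH] by blast
    note \<phi>H = test_function_H1_loc[OF \<phi>(1)]
    have "(LINT t|lebesgue. variation_density m (a t) (wderiv a t) 0 (wderiv (\<lambda>_. 0) t) (\<phi> t) (wderiv \<phi> t)) = 0"
      using crit \<phi>H(1,2) unfolding critical_phase_iff[OF m0 aH] by blast
    then show False using \<phi>(2) m unfolding variation_at_zero[OF aH \<phi>H(1,2)] by simp
  qed
  show "critical_phase m a (\<lambda>_. 0)" if st: "AE t in lebesgue. wderiv a t * (cosh (2 * a t) - 1) = 0"
    unfolding critical_phase_iff[OF m0 aH]
  proof (intro conjI ballI impI zero_phase_admissible[OF a])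
    fix \<eta> assume \<eta>: "\<eta> \<in> H1_loc" "compactly_supported \<eta>"
    have "(LINT t|lebesgue. \<eta> t * (wderiv a t * (cosh (2 * a t) - 1))) = 0"
      by (rule integral_eq_zero_AE) (use st in \<open>auto elim!: eventually_mono\<close>)
    then show "(LINT t|lebesgue. variation_density m (a t) (wderiv a t) 0 (wderiv (\<lambda>_. 0) t) (\<eta> t) (wderiv \<eta> t)) = 0"
      unfolding variation_at_zero[OF aH \<eta>] by simp
  qed
qed

lemma positive_lift_descent:
  assumes m: "0 < m" and a: "a \<in> H1" "a \<in> Linf"
    and st: "\<not> (AE t in lebesgue. wderiv a t * (cosh (2 * a t) - 1) = 0)"
  shows "\<exists>\<delta>\<in>H1_loc. compactly_supported \<delta> \<and> phase_energy m a \<delta> < phase_energy m a (\<lambda>_. 0)"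
proof -
  note aH = H1_subset_H1_loc[OF a(1)]
  have m0: "0 \<le> m" using m by simp
  obtain \<phi> where \<phi>: "test_function \<phi>" "(LINT t|lebesgue. \<phi> t * (wderiv a t * (cosh (2 * a t) - 1))) \<noteq> 0"
    using not_stationary_test_function[OF aH st] by blast
  note \<phi>H = test_function_H1_loc[OF \<phi>(1)]
  define L where "L = 2 * (LINT t|lebesgue. variation_density m (a t) (wderiv a t) 0 (wderiv (\<lambda>_. 0) t) (\<phi> t) (wderiv \<phi> t))"
  have L: "L \<noteq> 0" using \<phi>(2) m unfolding L_def variation_at_zero[OF aH \<phi>H(1,2)] by simp
  obtain C where "\<forall>s. phase_energy m a (\<lambda>t. 0 + s * \<phi> t) < \<infinity> \<and>
     \<bar>enn2real (phase_energy m a (\<lambda>t. 0 + s * \<phi> t)) - enn2real (phase_energy m a (\<lambda>_. 0)) - s * L\<bar> \<le> C * s\<^sup>2"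
    using phase_energy_variation[OF m0 aH zero_phase_admissible[OF a] \<phi>H(1,2)] unfolding L_def by blast
  then have fin: "phase_energy m a (\<lambda>t. s * \<phi> t) < \<infinity>"
    and C: "\<bar>enn2real (phase_energy m a (\<lambda>t. s * \<phi> t)) - enn2real (phase_energy m a (\<lambda>_. 0)) - s * L\<bar> \<le> C * s\<^sup>2" for s
    by simp_all
  \<comment> \<open>With this \<open>s\<close> one has (|C| + 1) s^2 = - s L, which strictly exceeds
    C s^2, so the error cannot undo the decrease s L. The added 1 keeps the denominator
    positive.\<close>
  define s where "s = - (L / (\<bar>C\<bar> + 1))"
  have "C * s\<^sup>2 < - (s * L)"
  proof -
    have "C * s\<^sup>2 \<le> \<bar>C\<bar> * s\<^sup>2" by (intro mult_right_mono) auto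
    also have "\<dots> < (\<bar>C\<bar> + 1) * s\<^sup>2" using L by (intro mult_strict_right_mono) (auto simp: s_def)
    also have "\<dots> = - (s * L)" proof -
      have "\<bar>C\<bar> + 1 \<noteq> 0" by linarith
      then have "(\<bar>C\<bar> + 1) * s = - L" by (simp add: s_def)
      then show ?thesis by (simp add: power2_eq_square mult.assoc[symmetric])
    qed
    finally show ?thesis .
  qed
  then have "enn2real (phase_energy m a (\<lambda>t. s * \<phi> t)) < enn2real (phase_energy m a (\<lambda>_. 0))"
    using C[of s] by linarith
  \<comment> \<open>\<open>enn2real\<close> sends infinity to 0, so finiteness is recorded before
    the strict inequality is carried back to \<open>ennreal\<close>.\<close>
  moreover have "phase_energy m a (\<lambda>_. 0) < \<infinity>" using fin[of 0] by simp
  ultimately have "phase_energy m a (\<lambda>t. s * \<phi> t) < phase_energy m a (\<lambda>_. 0)"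
    using fin[of s] by (metis enn2real_mono infinity_ennreal_def not_less)
  moreover have "test_function (\<lambda>t. s * \<phi> t)"
    using \<phi>(1) unfolding test_function_iff compactly_supported_iff by (auto intro: smooth_cmult)
  then have "(\<lambda>t. s * \<phi> t) \<in> H1_loc" "compactly_supported (\<lambda>t. s * \<phi> t)"
    by (rule test_function_H1_loc)+
  ultimately show ?thesis by blast
qed

text \<open>The positive lift appears twice: pointwise through the values of \<open>a\<close>, and
  as an actual gauge that agrees with it a.e., because \<open>a\<close> need not be
  continuous.\<close>

theorem proposition7p1:
  fixes m :: real and a :: "real \<Rightarrow> real"
  assumes "m > 0" and "a \<in> H1" and "a \<in> Linf"
  shows "optimal_energy m (Ham a) = 2 * (INF \<delta>\<in>admissible_phases m a. phase_integral m a \<delta>)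
    \<and> (\<forall>\<delta>. critical_phase m a \<delta> \<longrightarrow>
           has_weak_deriv (wderiv \<delta>)
             (\<lambda>t. - (2 * m * wderiv a t * cosh (2 * a t)
                     - 2 * m\<^sup>2 * cosh (2 * a t) * sin (2 * \<delta> t)
                     - 2 * m * wderiv a t * cos (2 * \<delta> t))))
    \<and> (\<forall>t. inv_sqrt (Ham a t) = mexp (a t *\<^sub>R Bmat)
           \<and> inv_sqrt (Ham a t) = phase_gauge a (\<lambda>_. 0) (\<lambda>_. 0) t)
    \<and> (\<exists>\<Theta>\<in>gauges (Ham a). (AE t in lebesgue. \<Theta> t = inv_sqrt (Ham a t))
           \<and> potential_in_L2 m \<Theta> \<and> gauge_energy m \<Theta> = phase_energy m a (\<lambda>_. 0))
    \<and> (critical_phase m a (\<lambda>_. 0)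
           \<longleftrightarrow> (AE t in lebesgue. wderiv a t * (cosh (2 * a t) - 1) = 0))
    \<and> (\<not> (AE t in lebesgue. wderiv a t * (cosh (2 * a t) - 1) = 0) \<longrightarrow>
           (\<exists>\<delta>\<in>H1_loc. compactly_supported \<delta> \<and> phase_energy m a \<delta> < phase_energy m a (\<lambda>_. 0)))"
proof -
  have m0: "0 \<le> m" using assms(1) by simp
  note aH = H1_subset_H1_loc[OF assms(2)]
  show ?thesis
  proof (intro conjI)
    show "optimal_energy m (Ham a) = 2 * (INF \<delta>\<in>admissible_phases m a. phase_integral m a \<delta>)"
      by (rule optimal_energy_eq[OF aH])
    show "\<forall>\<delta>. critical_phase m a \<delta> \<longrightarrow>
           has_weak_deriv (wderiv \<delta>)
             (\<lambda>t. - (2 * m * wderiv a t * cosh (2 * a t)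
                     - 2 * m\<^sup>2 * cosh (2 * a t) * sin (2 * \<delta> t)
                     - 2 * m * wderiv a t * cos (2 * \<delta> t)))"
      using critical_phase_Euler_Lagrange[OF m0 aH] by blast
    show "\<forall>t. inv_sqrt (Ham a t) = mexp (a t *\<^sub>R Bmat)
           \<and> inv_sqrt (Ham a t) = phase_gauge a (\<lambda>_. 0) (\<lambda>_. 0) t"
      unfolding inv_sqrt_Ham phase_gauge_0 mexp_Bmat by simp
    show "\<exists>\<Theta>\<in>gauges (Ham a). (AE t in lebesgue. \<Theta> t = inv_sqrt (Ham a t))
           \<and> potential_in_L2 m \<Theta> \<and> gauge_energy m \<Theta> = phase_energy m a (\<lambda>_. 0)"
      by (rule positive_lift_gauge[OF assms(2,3)])
    show "critical_phase m a (\<lambda>_. 0)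
           \<longleftrightarrow> (AE t in lebesgue. wderiv a t * (cosh (2 * a t) - 1) = 0)"
      by (rule critical_zero_iff[OF assms])
    show "\<not> (AE t in lebesgue. wderiv a t * (cosh (2 * a t) - 1) = 0) \<longrightarrow>
           (\<exists>\<delta>\<in>H1_loc. compactly_supported \<delta> \<and> phase_energy m a \<delta> < phase_energy m a (\<lambda>_. 0))"
      using positive_lift_descent[OF assms] by blast
  qed
qed

end
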